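(* Fix $\lambda$. There exist unique elements $\xi_I\in(\mathbb C^N)^{\otimes n}\otimes\mathbb C[z^{\pm1},h^{\pm1},D^{-1}]$, $I\in\mathcal I_\lambda$, such that $\xi_{I^{\min}}=v_{I^{\min}}$ and $\xi_{s_i(I)}=\tilde s_i\,\xi_I$ for every $I\in\mathcal I_\lambda$ and $i=1,\dots,n-1$. Moreover $\xi_I=\sum_{J\le_{\mathrm{id}}I}X_{I,J}v_J$ with $X_{I,J}\in\mathbb C[z^{\pm1},h^{\pm1},D^{-1}]$, $X_{I,I}=\prod_{k<l}\prod_{a\in I_k}\prod_{b\in I_l,\,b<a}\frac{1-z_b/z_a}{1-hz_b/z_a}$, and for all $I,J$: $X_{I,J}=h^{p(J)}\,\widetilde W_{\sigma_0,J}(z_I^{-1},z^{-1},h^{-1})\,\frac{P(z_I)}{Q(z_I,h)}$.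
   Context: $v_1,\dots,v_N$ standard basis of $\mathbb C^N$; $\mathcal I_\lambda$ = ordered partitions $I=(I_1,\dots,I_N)$ of $\{1..n\}$ with $|I_k|=\lambda_k$; $v_I=v_{i_1}\otimes\dots\otimes v_{i_n}$, $i_j=k$ iff $j\in I_k$. $s_i(I)$: $I$ with $i$ and $i+1$ swapped. $I^{\min}=(\{1,\dots,\lambda_1\},\{\lambda_1+1,\dots,\lambda_1+\lambda_2\},\dots,\{n-\lambda_N+1,\dots,n\})$. $D=\prod_{1\le b<a\le n}(1-hz_b/z_a)$. Order $\le_{\mathrm{id}}$: with $I_1\cup\dots\cup I_k=\{a^k_1<\dots\}$, $J_1\cup\dots\cup J_k=\{b^k_1<\dots\}$, $J\le_{\mathrm{id}}I$ iff $b^k_i\le a^k_i$ for all $k<N$, $i$. $\mathcal R(z,h)$: $v_i\otimes v_i\mapsto v_i\otimes v_i$; for $i<j$, $v_i\otimes v_j\mapsto\frac{1-z}{1-hz}v_i\otimes v_j+\frac{(1-h)z}{1-hz}v_j\otimes v_i$, $v_j\otimes v_i\mapsto\frac{1-h}{1-hz}v_i\otimes v_j+\frac{h(1-z)}{1-hz}v_j\otimes v_i$. On $(\mathbb C^N)^{\otimes n}$-valued functions $f(z,h)$: $K_i$ swaps $z_i,z_{i+1}$ in the argument; $P^{(i,i+1)}$ swaps the $i$-th and $(i+1)$-st tensor factors; $\tilde s_i f=P^{(i,i+1)}\mathcal R^{(i,i+1)}(z_i/z_{i+1},h)\,(K_if)$. $p(J)$ = number of inversions in the sequence listing $J_N$,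 then $J_{N-1}$, ..., then $J_1$, each in increasing order. $P(z_I)=\prod_{k<l}\prod_{a\in I_k}\prod_{b\in I_l}(-z_b/z_a)$, $Q(z_I,h)=\prod_{k<l}\prod_{a\in I_k}\prod_{b\in I_l}(1-hz_b/z_a)$. $\sigma_0(m)=n+1-m$. Weight functions: $\lambda^{(k)}=\lambda_1+\dots+\lambda_k$, $I_1\cup\dots\cup I_k=\{i^{(k)}_1<\dots\}$, $t^{(N)}_a=z_a$, $U_I=\prod_{k=1}^{N-1}\prod_{a=1}^{\lambda^{(k)}}\Big(\prod_{c:\,i^{(k+1)}_c<i^{(k)}_a}(1-ht^{(k+1)}_c/t^{(k)}_a)\prod_{c:\,i^{(k+1)}_c>i^{(k)}_a}(1-t^{(k+1)}_c/t^{(k)}_a)\prod_{b>a}\frac{1-ht^{(k)}_b/t^{(k)}_a}{1-t^{(k)}_b/t^{(k)}_a}\Big)$, $W_I=(1-h)^{\sum_{k<N}\lambda^{(k)}}\mathrm{Sym}_{t^{(1)}}\cdots\mathrm{Sym}_{t^{(N-1)}}U_I$, $W_{\sigma,I}(t,z,h)=W_{\sigma^{-1}(I)}(t,z_{\sigma(1)},\dots,z_{\sigma(n)},h)$, $E=\prod_{k<N}\prod_{a,b}(1-ht^{(k)}_b/t^{(k)}_a)$, $\widetilde W=W/E$; $f(z_I,z,h)$ is the substitution $t^{(k)}_a=z_{i^{(k)}_a}$, and $\widetilde W_{\sigma_0,J}(z_I^{-1},z^{-1},h^{-1})$ is the Laurent polynomial $\widetilde W_{\sigma_0,J}(z_I,z,h)$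 with all $z_i\mapsto z_i^{-1}$, $h\mapsto h^{-1}$. *)

theory Defs
  imports Complex_Main "HOL-Combinatorics.Permutations"
begin

text \<open>Conventions. Indices are 1-based as in the paper: positions 1..n, colours 1..N.
  A composition lam gives parts lam 1, ..., lam N, and n = lcum lam N.
  An ordered partition I is a function k to I k (a set of positions), with I k = {} for k outside 1..N.
  A coefficient (element of C[z^{+-1},h^{+-1},D^{-1}]) is represented by the function (z,h) to its value,
  with z :: nat => complex (z 1, ..., z n); it is only meaningful on the domain gdom.
  A vector of the tensor power (C^N)^{n} with such coefficients is a function from words
  (lists of length n with entries in 1..N; word w encodes v_{w_1} x ... x v_{w_n}) to coefficients.\<close>

type_synonym coef = "(nat \<Rightarrow> complex) \<Rightarrow> complex \<Rightarrow> complex"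
type_synonym tvec = "nat list \<Rightarrow> coef"
type_synonym opart = "nat \<Rightarrow> nat set"

definition lcum :: "(nat \<Rightarrow> nat) \<Rightarrow> nat \<Rightarrow> nat" where
  "lcum lam k = (\<Sum>j\<in>{1..k}. lam j)"

definition Dv :: "nat \<Rightarrow> (nat \<Rightarrow> complex) \<Rightarrow> complex \<Rightarrow> complex" where
  "Dv n z h = (\<Prod>a\<in>{1..n}. \<Prod>b\<in>{1..<a}. (1 - h * z b / z a))"

definition gdom :: "nat \<Rightarrow> (nat \<Rightarrow> complex) \<Rightarrow> complex \<Rightarrow> bool" where
  "gdom n z h \<longleftrightarrow> (\<forall>i\<in>{1..n}. z i \<noteq> 0) \<and> h \<noteq> 0 \<and> Dv n z h \<noteq> 0"

inductive_set laurent :: "nat \<Rightarrow> coef set" for n :: nat where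
  lconst: "(\<lambda>z h. c) \<in> laurent n"
| lvar: "i \<in> {1..n} \<Longrightarrow> (\<lambda>z h. z i) \<in> laurent n"
| livar: "i \<in> {1..n} \<Longrightarrow> (\<lambda>z h. inverse (z i)) \<in> laurent n"
| lh: "(\<lambda>z h. h) \<in> laurent n"
| lih: "(\<lambda>z h. inverse h) \<in> laurent n"
| ladd: "p \<in> laurent n \<Longrightarrow> q \<in> laurent n \<Longrightarrow> (\<lambda>z h. p z h + q z h) \<in> laurent n"
| lmult: "p \<in> laurent n \<Longrightarrow> q \<in> laurent n \<Longrightarrow> (\<lambda>z h. p z h * q z h) \<in> laurent n"

definition in_ring :: "nat \<Rightarrow> coef \<Rightarrow> bool" where
  "in_ring n f \<longleftrightarrow> (\<exists>p\<in>laurent n. \<exists>k::nat. \<forall>z h. gdom n z h \<longrightarrow> f z h = p z h / Dv n z h ^ k)"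

definition words :: "nat \<Rightarrow> nat \<Rightarrow> nat list set" where
  "words n N = {w. length w = n \<and> set w \<subseteq> {1..N}}"

definition is_vec :: "nat \<Rightarrow> nat \<Rightarrow> tvec \<Rightarrow> bool" where
  "is_vec n N f \<longleftrightarrow> (\<forall>w\<in>words n N. in_ring n (f w)) \<and> (\<forall>w. w \<notin> words n N \<longrightarrow> f w = (\<lambda>z h. 0))"

definition veq :: "nat \<Rightarrow> nat \<Rightarrow> tvec \<Rightarrow> tvec \<Rightarrow> bool" where
  "veq n N f g \<longleftrightarrow> (\<forall>w\<in>words n N. \<forall>z h. gdom n z h \<longrightarrow> f w z h = g w z h)"

definition bvec :: "nat list \<Rightarrow> tvec" where
  "bvec w = (\<lambda>u z h. if u = w then 1 else 0)"

definition ordparts :: "(nat \<Rightarrow> nat) \<Rightarrow> nat \<Rightarrow> opart set" where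
  "ordparts lam N = {I. (\<forall>k\<in>{1..N}. I k \<subseteq> {1..lcum lam N} \<and> card (I k) = lam k)
      \<and> (\<forall>k\<in>{1..N}. \<forall>l\<in>{1..N}. k \<noteq> l \<longrightarrow> I k \<inter> I l = {})
      \<and> (\<Union>k\<in>{1..N}. I k) = {1..lcum lam N}
      \<and> (\<forall>k. k \<notin> {1..N} \<longrightarrow> I k = {})}"

definition wordof :: "nat \<Rightarrow> opart \<Rightarrow> nat list" where
  "wordof n I = map (\<lambda>j. THE k. j \<in> I k) [1..<n+1]"

definition sw :: "nat \<Rightarrow> nat \<Rightarrow> nat \<Rightarrow> nat" where
  "sw i j x = (if x = i then j else if x = j then i else x)"

definition s_part :: "nat \<Rightarrow> opart \<Rightarrow> opart" where
  "s_part i I = (\<lambda>k. sw i (i+1) ` I k)"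

definition Imin :: "(nat \<Rightarrow> nat) \<Rightarrow> nat \<Rightarrow> opart" where
  "Imin lam N = (\<lambda>k. if k \<in> {1..N} then {lcum lam (k-1) + 1 .. lcum lam k} else {})"

text \<open>Entries of R(x,h): R (v_a x v_b) = sum over c d of Rent x h c d a b * v_c x v_d.\<close>
definition Rent :: "complex \<Rightarrow> complex \<Rightarrow> nat \<Rightarrow> nat \<Rightarrow> nat \<Rightarrow> nat \<Rightarrow> complex" where
  "Rent x h c d a b =
    (if a = b then (if c = a \<and> d = a then 1 else 0)
     else if a < b then
       (if c = a \<and> d = b then (1 - x) / (1 - h * x)
        else if c = b \<and> d = a then (1 - h) * x / (1 - h * x) else 0)
     else
       (if c = b \<and> d = a then (1 - h) / (1 - h * x)
        else if c = a \<and> d = b then h * (1 - x) / (1 - h * x) else 0))"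

text \<open>tilde s_i f = P^{(i,i+1)} R^{(i,i+1)}(z_i/z_{i+1},h) (K_i f), coefficientwise (positions 1-based,
  list indices 0-based).\<close>
definition ts :: "nat \<Rightarrow> nat \<Rightarrow> nat \<Rightarrow> tvec \<Rightarrow> tvec" where
  "ts n N i f = (\<lambda>w z h. if w \<in> words n N then
      (\<Sum>a\<in>{1..N}. \<Sum>b\<in>{1..N}.
         Rent (z i / z (i+1)) h (w ! i) (w ! (i - 1)) a b
         * f (w[i - 1 := a, i := b]) (z \<circ> sw i (i+1)) h)
     else 0)"

definition cum :: "opart \<Rightarrow> nat \<Rightarrow> nat set" where
  "cum I k = (\<Union>j\<in>{1..k}. I j)"

definition ix :: "opart \<Rightarrow> nat \<Rightarrow> nat \<Rightarrow> nat" where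
  "ix I k a = sorted_list_of_set (cum I k) ! (a - 1)"

definition leid :: "(nat \<Rightarrow> nat) \<Rightarrow> nat \<Rightarrow> opart \<Rightarrow> opart \<Rightarrow> bool" where
  "leid lam N J I \<longleftrightarrow> (\<forall>k\<in>{1..<N}. \<forall>a\<in>{1..lcum lam k}. ix J k a \<le> ix I k a)"

definition invseq :: "nat list \<Rightarrow> nat" where
  "invseq s = card {(a, b). a < b \<and> b < length s \<and> s ! a > s ! b}"

definition pinv :: "nat \<Rightarrow> opart \<Rightarrow> nat" where
  "pinv N J = invseq (concat (map (\<lambda>k. sorted_list_of_set (J k)) (rev [1..<N+1])))"

definition Pf :: "nat \<Rightarrow> opart \<Rightarrow> (nat \<Rightarrow> complex) \<Rightarrow> complex" where
  "Pf N I z = (\<Prod>k\<in>{1..N}. \<Prod>l\<in>{k<..N}. \<Prod>a\<in>I k. \<Prod>b\<in>I l. (- z b / z a))"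

definition Qf :: "nat \<Rightarrow> opart \<Rightarrow> (nat \<Rightarrow> complex) \<Rightarrow> complex \<Rightarrow> complex" where
  "Qf N I z h = (\<Prod>k\<in>{1..N}. \<Prod>l\<in>{k<..N}. \<Prod>a\<in>I k. \<Prod>b\<in>I l. (1 - h * z b / z a))"

definition Xdiag :: "nat \<Rightarrow> opart \<Rightarrow> (nat \<Rightarrow> complex) \<Rightarrow> complex \<Rightarrow> complex" where
  "Xdiag N I z h = (\<Prod>k\<in>{1..N}. \<Prod>l\<in>{k<..N}. \<Prod>a\<in>I k. \<Prod>b\<in>{b\<in>I l. b < a}.
       (1 - z b / z a) / (1 - h * z b / z a))"

definition Uf :: "(nat \<Rightarrow> nat) \<Rightarrow> nat \<Rightarrow> opart \<Rightarrow> (nat \<Rightarrow> nat \<Rightarrow> complex) \<Rightarrow> (nat \<Rightarrow> complex) \<Rightarrow> complex \<Rightarrow> complex" where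
  "Uf lam N I t z h =
    (let tt = (\<lambda>k a. if k = N then z a else t k a) in
     \<Prod>k\<in>{1..<N}. \<Prod>a\<in>{1..lcum lam k}.
       (\<Prod>c\<in>{c\<in>{1..lcum lam (k+1)}. ix I (k+1) c < ix I k a}. (1 - h * tt (k+1) c / tt k a))
     * (\<Prod>c\<in>{c\<in>{1..lcum lam (k+1)}. ix I (k+1) c > ix I k a}. (1 - tt (k+1) c / tt k a))
     * (\<Prod>b\<in>{a<..lcum lam k}. (1 - h * tt k b / tt k a) / (1 - tt k b / tt k a)))"

definition symperms :: "(nat \<Rightarrow> nat) \<Rightarrow> nat \<Rightarrow> (nat \<Rightarrow> nat \<Rightarrow> nat) set" where
  "symperms lam N = {\<sigma>. (\<forall>k\<in>{1..<N}. \<sigma> k permutes {1..lcum lam k}) \<and> (\<forall>k. k \<notin> {1..<N} \<longrightarrow> \<sigma> k = id)}"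

definition Wf :: "(nat \<Rightarrow> nat) \<Rightarrow> nat \<Rightarrow> opart \<Rightarrow> (nat \<Rightarrow> nat \<Rightarrow> complex) \<Rightarrow> (nat \<Rightarrow> complex) \<Rightarrow> complex \<Rightarrow> complex" where
  "Wf lam N I t z h = (1 - h) ^ (\<Sum>k\<in>{1..<N}. lcum lam k)
     * (\<Sum>\<sigma>\<in>symperms lam N. Uf lam N I (\<lambda>k a. t k (\<sigma> k a)) z h)"

definition sigma0 :: "nat \<Rightarrow> nat \<Rightarrow> nat" where
  "sigma0 n m = n + 1 - m"

definition Wsig0 :: "(nat \<Rightarrow> nat) \<Rightarrow> nat \<Rightarrow> opart \<Rightarrow> (nat \<Rightarrow> nat \<Rightarrow> complex) \<Rightarrow> (nat \<Rightarrow> complex) \<Rightarrow> complex \<Rightarrow> complex" where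
  "Wsig0 lam N J t z h = Wf lam N (\<lambda>k. inv_into {1..lcum lam N} (sigma0 (lcum lam N)) ` J k) t
       (\<lambda>a. z (sigma0 (lcum lam N) a)) h"

definition Ef :: "(nat \<Rightarrow> nat) \<Rightarrow> nat \<Rightarrow> (nat \<Rightarrow> nat \<Rightarrow> complex) \<Rightarrow> complex \<Rightarrow> complex" where
  "Ef lam N t h = (\<Prod>k\<in>{1..<N}. \<Prod>a\<in>{1..lcum lam k}. \<Prod>b\<in>{1..lcum lam k}. (1 - h * t k b / t k a))"

definition tsub :: "opart \<Rightarrow> (nat \<Rightarrow> complex) \<Rightarrow> nat \<Rightarrow> nat \<Rightarrow> complex" where
  "tsub I z = (\<lambda>k a. z (ix I k a))"

definition Xformula :: "(nat \<Rightarrow> nat) \<Rightarrow> nat \<Rightarrow> opart \<Rightarrow> opart \<Rightarrow> (nat \<Rightarrow> complex) \<Rightarrow> complex \<Rightarrow> complex" where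
  "Xformula lam N I J z h =
    (let zi = (\<lambda>a. inverse (z a)); hi = inverse h in
     h ^ pinv N J * (Wsig0 lam N J (tsub I zi) zi hi / Ef lam N (tsub I zi) hi)
       * Pf N I z / Qf N I z h)"

text \<open>Points where all denominators occurring in Xformula are nonzero (a dense open set).\<close>
definition xgen :: "(nat \<Rightarrow> nat) \<Rightarrow> nat \<Rightarrow> opart \<Rightarrow> (nat \<Rightarrow> complex) \<Rightarrow> complex \<Rightarrow> bool" where
  "xgen lam N I z h \<longleftrightarrow> gdom (lcum lam N) z h \<and> inj_on z {1..lcum lam N}
     \<and> Qf N I z h \<noteq> 0 \<and> Ef lam N (tsub I (\<lambda>a. inverse (z a))) (inverse h) \<noteq> 0"

end

theory Submission
  imports Defs "HOL-Computational_Algebra.Polynomial"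
begin

text \<open>Symmetrize the weight function level by level. After each level, exchanging two adjacent
  positions of the partition acts by a Demazure--Lusztig operator on the two variables attached to
  these positions; this passes from one level to the next by a single rational identity in four variables.
  At the last level, after inverting all variables and reversing the positions, the operator becomes
  exactly the R-matrix recursion, so the explicit formula satisfies it at generic points.
  For the minimal partition all but one term of the symmetrization vanishes, and only
  for the minimal word, which gives the initial condition.

  On the other hand, applying the recursion along ascents starting from the minimal partition produces
  vectors whose denominators only involve inversions of the partition, hence divide D, and for which
  triangularity and the diagonal coefficients are read off directly. They agree with the formula
  at generic points, so by density the recursion holds in every direction and
  independently of the chosen chain of ascents.\<close>

section \<open>One level of the weight function\<close>

text \<open>The recursion is overdetermined: many chains of exchanges lead from \<open>Imin\<close>
  to the same I, and each exchange can also be run backwards. Their agreement is drawn from the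
  closed formula, which mentions no chain. The formula alone does not show membership in the ring,
  since its denominators \<open>Ef\<close>, \<open>Qf\<close> and differences of variables are not
  powers of D. The recursion does show it, but in one direction only. Along an ascent the new
  denominator 1 - h z_i/z_{i+1} is a factor of D, and K_i keeps the old ones indexed by pairs b < a.
  Along a descent K_i would turn the factor of (i, i+1) into 1 - h z_{i+1}/z_i, which is not a
  factor of D.

  The two descriptions are compared on \<open>gen\<close>, which is stable under exchanging
  variables, whereas \<open>gdom\<close> is not. Coefficients are functions with total division, so
  the other points are reached by continuity along curves of generic points. The reversal sigma_0 in
  the formula turns a descent of J at i into an ascent at n - i, the case in which the exchange
  relation is proved.\<close>

lemma sw_eq_transpose: "sw = transpose"
  by (intro ext) (simp add: sw_def transpose_def)

lemma sw_sw [simp]: "sw i j (sw i j x) = x"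
  by (simp add: sw_def)

lemma sw_simps [simp]: "sw i j i = j" "sw i j j = i"
  by (auto simp: sw_def)

lemma sw_permutes: "i \<in> A \<Longrightarrow> j \<in> A \<Longrightarrow> sw i j permutes A"
  by (simp add: sw_eq_transpose permutes_swap_id)

lemma inj_sw: "inj (sw i j)"
  by (metis injI sw_sw)

lemma sw_mem_iff: "i \<in> A \<Longrightarrow> j \<in> A \<Longrightarrow> sw i j x \<in> A \<longleftrightarrow> x \<in> A"
  by (auto simp: sw_def)

lemma sw_interval: "1 \<le> i \<Longrightarrow> i < m \<Longrightarrow> sw i (i+1) x \<in> {1..m} \<longleftrightarrow> x \<in> {1..m}"
  by (rule sw_mem_iff) auto

lemma sw_pair: "sw i (i+1) x \<in> {i, i+1} \<longleftrightarrow> x \<in> {i, i+1}"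
  by (rule sw_mem_iff) auto

lemma prod_involution:
  assumes "\<And>x. x \<in> T \<Longrightarrow> \<phi> x \<in> T" "\<And>x. x \<in> T \<Longrightarrow> \<phi> (\<phi> x) = x" "\<And>x. x \<in> T \<Longrightarrow> G (\<phi> x) = F x"
  shows "prod F T = prod G T"
  by (rule prod.reindex_bij_witness[of _ \<phi> \<phi>]) (use assms in auto)

text \<open>The factor of U that couples levels k and k+1: p and q list the positions at the two levels,
  f and u the variables attached to them.\<close>

definition lvl :: "nat \<Rightarrow> nat \<Rightarrow> (nat \<Rightarrow> nat) \<Rightarrow> (nat \<Rightarrow> nat) \<Rightarrow> complex \<Rightarrow> (nat \<Rightarrow> complex) \<Rightarrow> (nat \<Rightarrow> complex) \<Rightarrow> complex" where
  "lvl m m' p q h f u = (\<Prod>a\<in>{1..m}.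
       (\<Prod>c\<in>{c\<in>{1..m'}. q c < p a}. (1 - h * u c / f a))
     * (\<Prod>c\<in>{c\<in>{1..m'}. q c > p a}. (1 - u c / f a))
     * (\<Prod>b\<in>{a<..m}. (1 - h * f b / f a) / (1 - f b / f a)))"

text \<open>The value 1 at equal positions reflects that a position present at both levels
  contributes no factor to U.\<close>

definition cross_fac :: "(nat \<Rightarrow> nat) \<Rightarrow> (nat \<Rightarrow> nat) \<Rightarrow> complex \<Rightarrow> (nat \<Rightarrow> complex) \<Rightarrow> (nat \<Rightarrow> complex) \<Rightarrow> nat \<times> nat \<Rightarrow> complex" where
  "cross_fac p q h f u = (\<lambda>(a, c). if q c < p a then 1 - h * u c / f a
     else if q c > p a then 1 - u c / f a else 1)"

definition same_fac :: "complex \<Rightarrow> (nat \<Rightarrow> complex) \<Rightarrow> nat \<times> nat \<Rightarrow> complex" where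
  "same_fac h f = (\<lambda>(a, b). (1 - h * f b / f a) / (1 - f b / f a))"

definition upairs :: "nat \<Rightarrow> (nat \<times> nat) set" where
  "upairs m = {(a, b). 1 \<le> a \<and> a < b \<and> b \<le> m}"

lemma finite_upairs [simp]: "finite (upairs m)"
  by (rule finite_subset[of _ "{1..m} \<times> {1..m}"]) (auto simp: upairs_def)

text \<open>Products over sets of index pairs let an exchange of two variables be treated as an
  involution of the index set.\<close>

lemma lvl_pairs:
  "lvl m m' p q h f u = prod (cross_fac p q h f u) ({1..m} \<times> {1..m'}) * prod (same_fac h f) (upairs m)"
proof -
  have 1: "(\<Prod>c\<in>{c\<in>{1..m'}. q c < p a}. (1 - h * u c / f a)) * (\<Prod>c\<in>{c\<in>{1..m'}. q c > p a}. (1 - u c / f a))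
      = (\<Prod>c\<in>{1..m'}. cross_fac p q h f u (a, c))" for a
  proof -
    have "(\<Prod>c\<in>{1..m'}. cross_fac p q h f u (a, c)) =
      (\<Prod>c\<in>{1..m'}. (if q c < p a then 1 - h * u c / f a else 1) * (if q c > p a then 1 - u c / f a else 1))"
      by (rule prod.cong) (auto simp: cross_fac_def)
    then show ?thesis
      by (simp only: prod.distrib prod.inter_filter finite_atLeastAtMost)
  qed
  have 2: "upairs m = (SIGMA a:{1..m}. {a<..m})"
    by (auto simp: upairs_def)
  show ?thesis
    unfolding lvl_def 1 prod.distrib prod.cartesian_product 2
    by (simp add: prod.Sigma same_fac_def)
qed

lemma lvl_cong:
  "(\<And>a. a \<in> {1..m} \<Longrightarrow> f a = f' a) \<Longrightarrow> (\<And>c. c \<in> {1..m'} \<Longrightarrow> u c = u' c) \<Longrightarrow>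
   lvl m m' p q h f u = lvl m m' p q h f' u'"
  unfolding lvl_def by (intro prod.cong refl arg_cong2[where f = "(*)"] arg_cong2[where f = "(/)"]) auto

text \<open>Positions enter only through comparisons between the two levels.\<close>

lemma lvl_order_cong:
  assumes "\<And>a c. a \<in> {1..m} \<Longrightarrow> c \<in> {1..m'} \<Longrightarrow> (q c < p a \<longleftrightarrow> q' c < p' a) \<and> (q c > p a \<longleftrightarrow> q' c > p' a)"
  shows "lvl m m' p q h f u = lvl m m' p' q' h f u"
  unfolding lvl_pairs
  by (intro arg_cong2[where f = "(*)"] prod.cong refl) (use assms in \<open>auto simp: cross_fac_def\<close>)

text \<open>The pair (s, s+1) is the only one whose order the exchange reverses; the remaining
  ordered pairs are permuted among themselves.\<close>

lemma prod_same_fac_swap: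
  assumes "1 \<le> s" "s < m"
  shows "prod (same_fac h (f \<circ> sw s (s+1))) (upairs m - {(s, s+1)}) = prod (same_fac h f) (upairs m - {(s, s+1)})"
  by (rule prod.reindex_bij_witness[of _ "map_prod (sw s (s+1)) (sw s (s+1))" "map_prod (sw s (s+1)) (sw s (s+1))"])
    (use assms in \<open>auto simp: upairs_def same_fac_def sw_def split: if_splits\<close>)

text \<open>The summand of one symmetrization level, split into the factors that couple the adjacent
  positions i, i+1 and a remainder that is symmetric in the variables attached to them.\<close>

lemma lvl_split_both:
  assumes s: "1 \<le> s" "s < m" and r: "1 \<le> r" "r < m'"
    and q: "q r = i" "q (r+1) = i+1" "inj_on q {1..m'}"
    and p: "p s = i" "p (s+1) = i+1" "inj_on p {1..m}"
  obtains C where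
    "\<And>f u. lvl m m' p q h f u = C f u * ((1 - u (r+1) / f s) * (1 - h * u r / f (s+1)) * ((1 - h * f (s+1) / f s) / (1 - f (s+1) / f s)))"
    "\<And>f u. C (f \<circ> sw s (s+1)) u = C f u"
    "\<And>f u. C f (u \<circ> sw r (r+1)) = C f u"
proof
  let ?S = "{s,s+1} \<times> {r,r+1}" and ?T = "{1..m} \<times> {1..m'} - {s,s+1} \<times> {r,r+1}"
  define C where "C f u = prod (cross_fac p q h f u) ?T * prod (same_fac h f) (upairs m - {(s,s+1)})" for f u
  \<comment> \<open>A position other than i and i+1 compares alike with both, so exchanging their
    variables only permutes the factors in which it occurs.\<close>
  have qn: "q c \<noteq> i \<and> q c \<noteq> i+1" if "c \<in> {1..m'}" "c \<noteq> r" "c \<noteq> r+1" for c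
    using that q r inj_onD[OF q(3), of c r] inj_onD[OF q(3), of c "r+1"] by auto
  have pn: "p c \<noteq> i \<and> p c \<noteq> i+1" if "c \<in> {1..m}" "c \<noteq> s" "c \<noteq> s+1" for c
    using that p s inj_onD[OF p(3), of c s] inj_onD[OF p(3), of c "s+1"] by auto
  show "lvl m m' p q h f u = C f u * ((1 - u (r+1) / f s) * (1 - h * u r / f (s+1)) * ((1 - h * f (s+1) / f s) / (1 - f (s+1) / f s)))" for f u
  proof -
    have a: "prod (cross_fac p q h f u) ({1..m} \<times> {1..m'}) = prod (cross_fac p q h f u) ?T * prod (cross_fac p q h f u) ?S"
      by (rule prod.subset_diff) (use s r in auto)
    \<comment> \<open>Of the four pairs, (s, r) and (s+1, r+1) have equal positions and contribute
      1.\<close>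
    have b: "prod (cross_fac p q h f u) ?S = (1 - u (r+1) / f s) * (1 - h * u r / f (s+1))"
      using p q by (simp add: cross_fac_def prod.cartesian_product[symmetric])
    have c: "prod (same_fac h f) (upairs m) = same_fac h f (s,s+1) * prod (same_fac h f) (upairs m - {(s,s+1)})"
      by (rule prod.remove) (use s in \<open>simp, simp add: upairs_def\<close>)
    show ?thesis
      unfolding lvl_pairs a b c C_def by (simp add: same_fac_def)
  qed
  show "C (f \<circ> sw s (s+1)) u = C f u" for f u
  proof -
    have "prod (cross_fac p q h (f \<circ> sw s (s+1)) u) ?T = prod (cross_fac p q h f u) ?T"
    proof (rule prod_involution[where \<phi> = "apfst (sw s (s+1))"])
      fix x assume "x \<in> ?T"
      then obtain a c where x: "x = (a, c)" "a \<in> {1..m}" "c \<in> {1..m'}" "a \<notin> {s,s+1} \<or> c \<notin> {r,r+1}"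
        by (cases x) (metis DiffD1 DiffD2 mem_Sigma_iff singleton_iff)
      show "apfst (sw s (s+1)) x \<in> ?T"
        using x sw_interval[OF s] sw_pair[of s] by (simp only: apfst_conv apsnd_conv Diff_iff mem_Sigma_iff) blast
      show "apfst (sw s (s+1)) (apfst (sw s (s+1)) x) = x" using x by simp
      show "cross_fac p q h f u (apfst (sw s (s+1)) x) = cross_fac p q h (f \<circ> sw s (s+1)) u x"
        using x qn[of c] p by (auto simp: cross_fac_def sw_def)
    qed
    then show ?thesis
      using prod_same_fac_swap[OF s] by (simp add: C_def)
  qed
  show "C f (u \<circ> sw r (r+1)) = C f u" for f u
  proof -
    have "prod (cross_fac p q h f (u \<circ> sw r (r+1))) ?T = prod (cross_fac p q h f u) ?T"
    proof (rule prod_involution[where \<phi> = "apsnd (sw r (r+1))"])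
      fix x assume "x \<in> ?T"
      then obtain a c where x: "x = (a, c)" "a \<in> {1..m}" "c \<in> {1..m'}" "a \<notin> {s,s+1} \<or> c \<notin> {r,r+1}"
        by (cases x) (metis DiffD1 DiffD2 mem_Sigma_iff singleton_iff)
      show "apsnd (sw r (r+1)) x \<in> ?T"
        using x sw_interval[OF r] sw_pair[of r] by (simp only: apfst_conv apsnd_conv Diff_iff mem_Sigma_iff) blast
      show "apsnd (sw r (r+1)) (apsnd (sw r (r+1)) x) = x" using x by simp
      show "cross_fac p q h f u (apsnd (sw r (r+1)) x) = cross_fac p q h f (u \<circ> sw r (r+1)) x"
        using x pn[of a] q by (auto simp: cross_fac_def sw_def)
    qed
    then show ?thesis
      by (simp add: C_def)
  qed
qed

text \<open>The lower level contains exactly one of the two positions: i for \<open>p\<close>, i+1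
  for \<open>p'\<close>. All other comparisons agree for \<open>p\<close> and \<open>p'\<close>, so
  one remainder serves both, and the difference sits in the factors linking s to r and r+1.\<close>

lemma lvl_split_one:
  assumes s: "1 \<le> s" "s \<le> m" and r: "1 \<le> r" "r < m'"
    and q: "q r = i" "q (r+1) = i+1" "inj_on q {1..m'}"
    and p: "p s = i" "p' s = i+1"
    and pp: "\<And>a. a \<in> {1..m} \<Longrightarrow> a \<noteq> s \<Longrightarrow> p' a = p a \<and> p a \<noteq> i \<and> p a \<noteq> i+1"
  obtains C where
    "\<And>f u. lvl m m' p q h f u = C f u * (1 - u (r+1) / f s)"
    "\<And>f u. lvl m m' p' q h f u = C f u * (1 - h * u r / f s)"
    "\<And>f u. C f (u \<circ> sw r (r+1)) = C f u"
proof
  let ?S = "{s} \<times> {r,r+1}" and ?T = "{1..m} \<times> {1..m'} - {s} \<times> {r,r+1}"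
  define C where "C f u = prod (cross_fac p q h f u) ?T * prod (same_fac h f) (upairs m)" for f u
  have qn: "q c \<noteq> i \<and> q c \<noteq> i+1" if "c \<in> {1..m'}" "c \<noteq> r" "c \<noteq> r+1" for c
    using that q r inj_onD[OF q(3), of c r] inj_onD[OF q(3), of c "r+1"] by auto
  have a: "prod (cross_fac p q h f u) ({1..m} \<times> {1..m'}) = prod (cross_fac p q h f u) ?T * prod (cross_fac p q h f u) ?S" for f u p
    by (rule prod.subset_diff) (use s r in auto)
  have b: "prod (cross_fac p q h f u) ?S = 1 - u (r+1) / f s" "prod (cross_fac p' q h f u) ?S = 1 - h * u r / f s" for f u
    using p q by (simp_all add: cross_fac_def prod.cartesian_product[symmetric])
  show "lvl m m' p q h f u = C f u * (1 - u (r+1) / f s)" for f u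
    by (simp only: lvl_pairs a b C_def mult_ac)
  show "lvl m m' p' q h f u = C f u * (1 - h * u r / f s)" for f u
  proof -
    have "prod (cross_fac p' q h f u) ?T = prod (cross_fac p q h f u) ?T"
    proof (rule prod.cong[OF refl])
      fix x assume "x \<in> ?T"
      then obtain a c where x: "x = (a, c)" "a \<in> {1..m}" "c \<in> {1..m'}" "a \<noteq> s \<or> c \<notin> {r,r+1}"
        by (cases x) (metis DiffD1 DiffD2 mem_Sigma_iff singleton_iff)
      show "cross_fac p' q h f u x = cross_fac p q h f u x"
        using x qn[of c] pp[of a] p q by (cases "a = s") (auto simp: cross_fac_def)
    qed
    then show ?thesis
      by (simp only: lvl_pairs a b C_def mult_ac)
  qed
  show "C f (u \<circ> sw r (r+1)) = C f u" for f u
  proof -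
    have "prod (cross_fac p q h f (u \<circ> sw r (r+1))) ?T = prod (cross_fac p q h f u) ?T"
    proof (rule prod_involution[where \<phi> = "apsnd (sw r (r+1))"])
      fix x assume "x \<in> ?T"
      then obtain a c where x: "x = (a, c)" "a \<in> {1..m}" "c \<in> {1..m'}" "a \<noteq> s \<or> c \<notin> {r,r+1}"
        by (cases x) (metis DiffD1 DiffD2 mem_Sigma_iff singleton_iff)
      show "apsnd (sw r (r+1)) x \<in> ?T"
        using x sw_interval[OF r] sw_pair[of r] by (simp only: apfst_conv apsnd_conv Diff_iff mem_Sigma_iff) blast
      show "apsnd (sw r (r+1)) (apsnd (sw r (r+1)) x) = x" using x by simp
      show "cross_fac p q h f u (apsnd (sw r (r+1)) x) = cross_fac p q h f (u \<circ> sw r (r+1)) x"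
        using x pp[of a] q by (auto simp: cross_fac_def sw_def)
    qed
    then show ?thesis
      by (simp add: C_def)
  qed
qed

text \<open>Every lower position compares alike with i and i+1.\<close>

lemma lvl_swap_none:
  assumes r: "1 \<le> r" "r < m'" and q: "q r = i" "q (r+1) = i+1"
    and p: "\<And>a. a \<in> {1..m} \<Longrightarrow> p a \<noteq> i \<and> p a \<noteq> i+1"
  shows "lvl m m' p q h f (u \<circ> sw r (r+1)) = lvl m m' p q h f u"
proof -
  have "prod (cross_fac p q h f (u \<circ> sw r (r+1))) ({1..m} \<times> {1..m'}) = prod (cross_fac p q h f u) ({1..m} \<times> {1..m'})"
  proof (rule prod_involution[where \<phi> = "apsnd (sw r (r+1))"])
    fix x assume "x \<in> {1..m} \<times> {1..m'}"
    then obtain a c where x: "x = (a, c)" "a \<in> {1..m}" "c \<in> {1..m'}" by blast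
    show "apsnd (sw r (r+1)) x \<in> {1..m} \<times> {1..m'}"
        using x sw_interval[OF r] sw_pair[of r] by (simp only: apfst_conv apsnd_conv Diff_iff mem_Sigma_iff)
      show "apsnd (sw r (r+1)) (apsnd (sw r (r+1)) x) = x" using x by simp
    show "cross_fac p q h f u (apsnd (sw r (r+1)) x) = cross_fac p q h f (u \<circ> sw r (r+1)) x"
      using x p[of a] q by (auto simp: cross_fac_def sw_def)
  qed
  then show ?thesis by (simp add: lvl_pairs)
qed

text \<open>Here x, y are the variables at positions i, i+1 of the lower level, a, b those of the
  upper level, and \<open>g\<close> is the coupling factor of \<open>lvl_split_both\<close>. The
  left side is the operator in x, y, transposed so as to act on \<open>g\<close>; the right side is
  the operator in a, b. Clearing denominators leaves a polynomial identity.\<close>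

lemma exchange_rational_identity:
  fixes x y a b h :: complex
  assumes "x \<noteq> 0" "y \<noteq> 0" "x \<noteq> y"
  defines "g \<equiv> \<lambda>x y a b. (1 - b / x) * (1 - h * a / y) * ((1 - h * y / x) / (1 - y / x))"
  shows "(b - a) * ((x - h * y) / (x - y) * g y x a b - (1 - h) * x / (y - x) * g x y a b)
     = (b - h * a) * g x y b a - (1 - h) * a * g x y a b"
proof -
  define d where "d = x - y"
  have d: "d \<noteq> 0" "y - x = - d" using assms by (auto simp: d_def)
  have e: "1 - v / w = (w - v) / w" if "w \<noteq> 0" for v w :: complex
    using that by (simp add: diff_divide_distrib)
  have c: "(A / x') * (B / y') * ((E / x') / (D / x')) * (D * x' * y') = A * B * E"
    if "x' \<noteq> 0" "y' \<noteq> 0" "D \<noteq> 0" for A B E D x' y' :: complex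
    using that by simp
  have g: "g x y a b * (d * x * y) = (x - b) * (y - h * a) * (x - h * y)"
    "g x y b a * (d * x * y) = (x - a) * (y - h * b) * (x - h * y)"
    "g y x a b * (d * x * y) = - ((y - b) * (x - h * a) * (y - h * x))"
  proof -
    have "g x y a b * (d * x * y) = (x - b) * (y - h * a) * (x - h * y)" for a b
      unfolding g_def d_def e[OF assms(1)] e[OF assms(2)] by (rule c) (use assms in auto)
    then show "g x y a b * (d * x * y) = (x - b) * (y - h * a) * (x - h * y)"
      "g x y b a * (d * x * y) = (x - a) * (y - h * b) * (x - h * y)" by blast+
    have "g y x a b * ((y - x) * y * x) = (y - b) * (x - h * a) * (y - h * x)"
      unfolding g_def d_def e[OF assms(1)] e[OF assms(2)] by (rule c) (use assms in auto)
    then show "g y x a b * (d * x * y) = - ((y - b) * (x - h * a) * (y - h * x))"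
      unfolding d_def by algebra
  qed
  \<comment> \<open>The common denominator is (x - y)^2 x y: one factor x - y comes from the
    operator, the rest from \<open>g\<close>.\<close>
  have "((b - a) * ((x - h * y) / d * g y x a b - (1 - h) * x / (- d) * g x y a b)) * (d * (d * x * y))
     = (b - a) * ((x - h * y) * (g y x a b * (d * x * y)) + (1 - h) * x * (g x y a b * (d * x * y)))"
  proof -
    have "(b - a) * (A / d * G - B / (- d) * F) * (d * w) = (b - a) * (A * (G * w) + B * (F * w))" for A B G F w
      using d(1) by (simp add: field_simps)
    then show ?thesis .
  qed
  also have "\<dots> = d * ((b - h * a) * (g x y b a * (d * x * y)) - (1 - h) * a * (g x y a b * (d * x * y)))"
    unfolding g unfolding d_def by algebra
  also have "\<dots> = ((b - h * a) * g x y b a - (1 - h) * a * g x y a b) * (d * (d * x * y))"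
  proof -
    have "d * ((b - h * a) * (G * w) - A * (F * w)) = ((b - h * a) * G - A * F) * (d * w)" for A G F w
      by (simp add: algebra_simps)
    then show ?thesis .
  qed
  finally have "(b - a) * ((x - h * y) / d * g y x a b - (1 - h) * x / (- d) * g x y a b)
     = (b - h * a) * g x y b a - (1 - h) * a * g x y a b"
    using assms(1,2) d(1) by (simp only: mult_cancel_right mult_eq_0_iff) simp
  then show ?thesis unfolding d(2) unfolding d_def .
qed

section \<open>Ordered partitions and the exchange relation\<close>

text \<open>Written with the same \<open>THE\<close> as \<open>wordof\<close>, so that the word of I
  is literally the list of its colours.\<close>

definition col :: "opart \<Rightarrow> nat \<Rightarrow> nat" where
  "col I j = (THE k. j \<in> I k)"

lemma ordpartsD:
  assumes "I \<in> ordparts lam N"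
  shows "k \<in> {1..N} \<Longrightarrow> card (I k) = lam k" "finite (I k)" "I k \<subseteq> {1..lcum lam N}"
    "k \<noteq> l \<Longrightarrow> I k \<inter> I l = {}" "(\<Union>k\<in>{1..N}. I k) = {1..lcum lam N}" "k \<notin> {1..N} \<Longrightarrow> I k = {}"
proof -
  have 1: "\<And>k. k \<in> {1..N} \<Longrightarrow> I k \<subseteq> {1..lcum lam N}" and 2: "\<And>k. k \<in> {1..N} \<Longrightarrow> card (I k) = lam k"
    and 3: "\<And>k l. k \<in> {1..N} \<Longrightarrow> l \<in> {1..N} \<Longrightarrow> k \<noteq> l \<Longrightarrow> I k \<inter> I l = {}"
    and 4: "(\<Union>k\<in>{1..N}. I k) = {1..lcum lam N}" and 5: "\<And>k. k \<notin> {1..N} \<Longrightarrow> I k = {}"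
    using assms unfolding ordparts_def mem_Collect_eq by simp_all
  show "k \<in> {1..N} \<Longrightarrow> card (I k) = lam k" "(\<Union>k\<in>{1..N}. I k) = {1..lcum lam N}" "k \<notin> {1..N} \<Longrightarrow> I k = {}"
    by (fact 2 4 5)+
  show sub: "I k \<subseteq> {1..lcum lam N}" using 1[of k] 5[of k] by (cases "k \<in> {1..N}") simp_all
  show "finite (I k)" by (rule finite_subset[OF sub]) simp
  show "k \<noteq> l \<Longrightarrow> I k \<inter> I l = {}"
    using 3[of k l] 5[of k] 5[of l] by (cases "k \<in> {1..N}"; cases "l \<in> {1..N}") simp_all
qed

lemma col_eqI: "I \<in> ordparts lam N \<Longrightarrow> j \<in> I k \<Longrightarrow> col I j = k"
  unfolding col_def using ordpartsD(4)[of I lam N] by (intro the_equality) blast+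

lemma part_iff_col:
  assumes I: "I \<in> ordparts lam N"
  shows "j \<in> I k \<longleftrightarrow> j \<in> {1..lcum lam N} \<and> col I j = k"
proof
  assume "j \<in> I k" then show "j \<in> {1..lcum lam N} \<and> col I j = k"
    using col_eqI[OF I] ordpartsD(3)[OF I] by blast
next
  assume j: "j \<in> {1..lcum lam N} \<and> col I j = k"
  then obtain l where "j \<in> I l" using ordpartsD(5)[OF I] by blast
  then show "j \<in> I k" using col_eqI[OF I] j by blast
qed

lemma col_range: "I \<in> ordparts lam N \<Longrightarrow> j \<in> {1..lcum lam N} \<Longrightarrow> col I j \<in> {1..N}"
  using part_iff_col[of I lam N j "col I j"] ordpartsD(6)[of I lam N "col I j"] by blast

lemma ordparts_eqI:
  assumes "I \<in> ordparts lam N" "J \<in> ordparts lam N" "\<And>j. j \<in> {1..lcum lam N} \<Longrightarrow> col I j = col J j"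
  shows "I = J"
  by (intro ext set_eqI) (use assms part_iff_col in metis)

lemma cum_iff_col:
  assumes I: "I \<in> ordparts lam N"
  shows "j \<in> cum I k \<longleftrightarrow> j \<in> {1..lcum lam N} \<and> col I j \<le> k"
proof -
  have "j \<in> cum I k \<longleftrightarrow> (\<exists>l\<in>{1..k}. j \<in> {1..lcum lam N} \<and> col I j = l)"
    unfolding cum_def using part_iff_col[OF I] by simp
  then show ?thesis using col_range[OF I, of j] by auto
qed

lemma finite_cum: "I \<in> ordparts lam N \<Longrightarrow> finite (cum I k)"
  unfolding cum_def using ordpartsD(2) by blast

lemma card_cum:
  assumes I: "I \<in> ordparts lam N" and k: "k \<le> N"
  shows "card (cum I k) = lcum lam k"
proof -
  have "card (cum I k) = (\<Sum>j\<in>{1..k}. card (I j))"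
    unfolding cum_def by (rule card_UN_disjoint) (use ordpartsD(2,4)[OF I] in auto)
  also have "\<dots> = lcum lam k"
    unfolding lcum_def by (rule sum.cong) (use ordpartsD(1)[OF I] k in auto)
  finally show ?thesis .
qed

lemma lcum_Suc: "lcum lam (Suc k) = lcum lam k + lam (Suc k)"
  by (simp add: lcum_def)

lemma lcum_0 [simp]: "lcum lam 0 = 0"
  by (simp add: lcum_def)

lemma lcum_mono: "k \<le> l \<Longrightarrow> lcum lam k \<le> lcum lam l"
  unfolding lcum_def by (rule sum_mono2) auto

lemma ix_strict_mono:
  assumes "I \<in> ordparts lam N" "k \<le> N" "1 \<le> a" "a < b" "b \<le> lcum lam k"
  shows "ix I k a < ix I k b"
  using assms card_cum[of I lam N k] strict_sorted_list_of_set[of "cum I k"]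
  unfolding ix_def by (simp add: sorted_wrt_iff_nth_less)

lemma ix_bij:
  assumes I: "I \<in> ordparts lam N" and k: "k \<le> N"
  shows "bij_betw (ix I k) {1..lcum lam k} (cum I k)"
proof -
  have "bij_betw (\<lambda>a. a - 1) {1..lcum lam k} {..<lcum lam k}"
    by (rule bij_betw_byWitness[where f' = Suc]) auto
  moreover have "bij_betw ((!) (sorted_list_of_set (cum I k))) {..<lcum lam k} (cum I k)"
    using bij_betw_nth[of "sorted_list_of_set (cum I k)" "{..<lcum lam k}" "cum I k"] finite_cum[OF I] card_cum[OF I k] by simp
  ultimately have "bij_betw ((!) (sorted_list_of_set (cum I k)) \<circ> (\<lambda>a. a - 1)) {1..lcum lam k} (cum I k)"
    by (rule bij_betw_trans)
  then show ?thesis by (simp add: ix_def[abs_def] comp_def)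
qed

lemma ix_mem: "I \<in> ordparts lam N \<Longrightarrow> k \<le> N \<Longrightarrow> a \<in> {1..lcum lam k} \<Longrightarrow> ix I k a \<in> cum I k"
  using ix_bij bij_betwE by blast

lemma ix_surj:
  assumes "I \<in> ordparts lam N" "k \<le> N" "j \<in> cum I k"
  obtains a where "a \<in> {1..lcum lam k}" "ix I k a = j"
  using bij_betw_imp_surj_on[OF ix_bij[OF assms(1,2)]] assms(3) by (metis imageE)

lemma ix_inj: "I \<in> ordparts lam N \<Longrightarrow> k \<le> N \<Longrightarrow> inj_on (ix I k) {1..lcum lam k}"
  by (rule bij_betw_imp_inj_on[OF ix_bij])

text \<open>A finite set of numbers has only one increasing enumeration, so exhibiting one computes
  \<open>ix\<close>.\<close>

lemma ix_eqI:
  assumes f: "\<And>a b. 1 \<le> a \<Longrightarrow> a < b \<Longrightarrow> b \<le> m \<Longrightarrow> f a < f b" and im: "f ` {1..m} = cum I k" and a: "a \<in> {1..m}"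
  shows "ix I k a = f a"
proof -
  have s: "sorted_wrt (<) (map f [1..<m+1])"
    using f by (auto simp: sorted_wrt_iff_nth_less simp del: upt_Suc)
  have "set (map f [1..<m+1]) = cum I k" using im by (simp add: atLeastLessThanSuc_atLeastAtMost del: upt_Suc)
  then have "sorted_list_of_set (cum I k) = map f [1..<m+1]"
    using s by (metis strict_sorted_iff sorted_list_of_set.idem_if_sorted_distinct)
  then show ?thesis unfolding ix_def using a by (auto simp del: upt_Suc)
qed

text \<open>Nothing lies strictly between i and i+1, so their ranks are consecutive.\<close>

lemma ix_adjacent:
  assumes I: "I \<in> ordparts lam N" and k: "k \<le> N" and i: "i \<in> cum I k" "i + 1 \<in> cum I k"
  obtains s where "1 \<le> s" "s < lcum lam k" "ix I k s = i" "ix I k (s + 1) = i + 1"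
proof -
  obtain s where s: "s \<in> {1..lcum lam k}" "ix I k s = i" using ix_surj[OF I k i(1)] .
  obtain s' where s': "s' \<in> {1..lcum lam k}" "ix I k s' = i + 1" using ix_surj[OF I k i(2)] .
  have "s < s'"
  proof (rule ccontr)
    assume "\<not> s < s'"
    then consider "s = s'" | "s' < s" by linarith
    then show False using ix_strict_mono[OF I k, of s' s] s s' by cases auto
  qed
  moreover have "s' = s + 1"
  proof (rule ccontr)
    assume "s' \<noteq> s + 1"
    then have "s + 1 < s'" using \<open>s < s'\<close> by simp
    then show False using ix_strict_mono[OF I k, of s "s+1"] ix_strict_mono[OF I k, of "s+1" s'] s s' by auto
  qed
  ultimately show ?thesis using that s s' by auto
qed

section \<open>Adjacent exchanges acting on ordered partitions\<close>

lemma s_part_mem: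
  assumes I: "I \<in> ordparts lam N" and i: "i \<in> {1..<lcum lam N}"
  shows "s_part i I \<in> ordparts lam N"
proof -
  let ?s = "sw i (i+1)"
  have p: "?s permutes {1..lcum lam N}" using i by (intro sw_permutes) auto
  have "?s ` {1..lcum lam N} = {1..lcum lam N}" using permutes_image[OF p] .
  moreover have "(\<Union>k\<in>{1..N}. ?s ` I k) = ?s ` {1..lcum lam N}"
    using ordpartsD(5)[OF I] by blast
  moreover have "?s ` I k \<subseteq> ?s ` {1..lcum lam N}" for k using ordpartsD(3)[OF I] by blast
  moreover have "card (?s ` I k) = card (I k)" for k
    by (rule card_image) (rule inj_on_subset[OF inj_sw], simp)
  moreover have "?s ` I k \<inter> ?s ` I l = {}" if "k \<noteq> l" for k l
    using ordpartsD(4)[OF I that] image_Int[OF inj_sw[of i "i+1"], of "I k" "I l"] by simp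
  ultimately show ?thesis
    unfolding ordparts_def s_part_def using ordpartsD(1,6)[OF I] by simp
qed

lemma s_part_s_part [simp]: "s_part i (s_part i I) = I"
  by (simp add: s_part_def image_image)

lemma mem_s_part: "j \<in> s_part i I k \<longleftrightarrow> sw i (i+1) j \<in> I k"
proof -
  have "j = sw i (i+1) (sw i (i+1) j)" by simp
  then show ?thesis unfolding s_part_def using inj_image_mem_iff[OF inj_sw] by metis
qed

lemma col_s_part: "col (s_part i I) j = col I (sw i (i+1) j)"
  unfolding col_def mem_s_part ..

lemma s_part_same:
  assumes I: "I \<in> ordparts lam N" and i: "i \<in> {1..<lcum lam N}" and c: "col I i = col I (i+1)"
  shows "s_part i I = I"
  by (rule ordparts_eqI[OF s_part_mem[OF I i] I]) (use c in \<open>auto simp: col_s_part sw_def\<close>)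

lemma cum_s_part: "cum (s_part i I) k = sw i (i+1) ` cum I k"
  unfolding cum_def s_part_def by blast

context
  fixes lam :: "nat \<Rightarrow> nat" and N :: nat and I :: opart and i :: nat
  assumes I: "I \<in> ordparts lam N" and i: "i \<in> {1..<lcum lam N}" and le: "col I i \<le> col I (i+1)"
begin

text \<open>At these levels i+1 is vacant, so moving i there preserves all ranks.\<close>

lemma ix_s_part_low:
  assumes k: "k < col I (i+1)" and a: "a \<in> {1..lcum lam k}"
  shows "ix (s_part i I) k a = sw i (i+1) (ix I k a)"
proof (rule ix_eqI[of "lcum lam k" "\<lambda>a. sw i (i+1) (ix I k a)"])
  have kN: "k \<le> N" using col_range[OF I, of "i+1"] i k by auto
  show "a \<in> {1..lcum lam k}" by (rule a)
  show "(\<lambda>a. sw i (i+1) (ix I k a)) ` {1..lcum lam k} = cum (s_part i I) k"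
    using ix_bij[OF I kN] unfolding cum_s_part bij_betw_def by (metis image_image)
  fix a b assume ab: "1 \<le> a" "a < b" "b \<le> lcum lam k"
  have "ix I k a < ix I k b" using ix_strict_mono[OF I kN ab] .
  moreover have "ix I k a \<noteq> i+1" "ix I k b \<noteq> i+1"
    using ix_mem[OF I kN, of a] ix_mem[OF I kN, of b] ab k cum_iff_col[OF I] by (auto simp: not_le)
  ultimately show "sw i (i+1) (ix I k a) < sw i (i+1) (ix I k b)" by (auto simp: sw_def)
qed

text \<open>By \<open>le\<close> both positions already belong to level k, so the cumulative set is
  mapped to itself.\<close>

lemma ix_s_part_high:
  assumes k: "col I (i+1) \<le> k"
  shows "ix (s_part i I) k = ix I k"
proof -
  have "cum (s_part i I) k = cum I k"
    unfolding cum_s_part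
    by (rule permutes_image, rule sw_permutes) (use k le i cum_iff_col[OF I] in auto)
  then show ?thesis by (simp add: ix_def fun_eq_iff)
qed

end

text \<open>The weight function (up to a power of 1-h) with the levels below k symmetrized, as a function of
  the ordered variables u of level k; level N is never symmetrized.\<close>

fun Psi :: "(nat \<Rightarrow> nat) \<Rightarrow> opart \<Rightarrow> complex \<Rightarrow> (nat \<Rightarrow> nat \<Rightarrow> complex) \<Rightarrow> nat \<Rightarrow> (nat \<Rightarrow> complex) \<Rightarrow> complex" where
  "Psi lam I h t 0 u = 1"
| "Psi lam I h t (Suc k) u = (\<Sum>\<sigma> | \<sigma> permutes {1..lcum lam k}. Psi lam I h t k (t k \<circ> \<sigma>)
     * lvl (lcum lam k) (lcum lam (Suc k)) (ix I k) (ix I (Suc k)) h (t k \<circ> \<sigma>) u)"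

lemma Psi_cong:
  assumes "\<And>c. c \<in> {1..lcum lam k} \<Longrightarrow> u c = u' c"
  shows "Psi lam I h t k u = Psi lam I h t k u'"
  by (cases k) (use assms in \<open>auto intro!: sum.cong arg_cong2[where f = "(*)"] lvl_cong\<close>)

text \<open>Until i+1 enters, the exchange at most moves i to a vacant neighbour, which changes no
  comparison between levels.\<close>

lemma Psi_s_part_low:
  assumes I: "I \<in> ordparts lam N" and i: "i \<in> {1..<lcum lam N}" and le: "col I i \<le> col I (i+1)"
  shows "k < col I (i+1) \<Longrightarrow> Psi lam (s_part i I) h t k u = Psi lam I h t k u"
proof (induction k arbitrary: u)
  case (Suc k)
  have kN: "Suc k \<le> N" using col_range[OF I, of "i+1"] i Suc.prems by auto
  have "lvl (lcum lam k) (lcum lam (Suc k)) (ix (s_part i I) k) (ix (s_part i I) (Suc k)) h f u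
      = lvl (lcum lam k) (lcum lam (Suc k)) (ix I k) (ix I (Suc k)) h f u" for f
  proof (rule lvl_order_cong)
    fix a c assume a: "a \<in> {1..lcum lam k}" and c: "c \<in> {1..lcum lam (Suc k)}"
    have "ix I k a \<noteq> i+1" "ix I (Suc k) c \<noteq> i+1"
      using ix_mem[OF I _ a] ix_mem[OF I _ c] kN Suc.prems cum_iff_col[OF I] by (auto simp: not_le)
    then show "(ix (s_part i I) (Suc k) c < ix (s_part i I) k a) = (ix I (Suc k) c < ix I k a) \<and>
           (ix (s_part i I) k a < ix (s_part i I) (Suc k) c) = (ix I k a < ix I (Suc k) c)"
      using ix_s_part_low[OF I i le _ a] ix_s_part_low[OF I i le _ c] Suc.prems by (auto simp: sw_def)
  qed
  then show ?case using Suc by simp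
qed simp

text \<open>Exchanging adjacent positions acts on the partially symmetrized weight function by a
  Demazure--Lusztig operator in the two variables attached to them. One more symmetrization
  preserves this because the summand intertwines the operators in the old and the new variables.\<close>

lemma Psi_exchange:
  assumes I: "I \<in> ordparts lam N" and i: "i \<in> {1..<lcum lam N}" and le: "col I i \<le> col I (i+1)"
    and t: "\<And>k. k < N \<Longrightarrow> inj_on (t k) {1..lcum lam k}" "\<And>k a. k < N \<Longrightarrow> a \<in> {1..lcum lam k} \<Longrightarrow> t k a \<noteq> 0"
  shows "col I (i+1) \<le> k \<Longrightarrow> k \<le> N \<Longrightarrow> 1 \<le> r \<Longrightarrow> r < lcum lam k \<Longrightarrow> ix I k r = i \<Longrightarrow> ix I k (r+1) = i+1 \<Longrightarrow>
    (u (r+1) - u r) * Psi lam (s_part i I) h t k u =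
    (u (r+1) - h * u r) * Psi lam I h t k (u \<circ> sw r (r+1)) - (1 - h) * u r * Psi lam I h t k u"
proof (induction k arbitrary: u r)
  case 0
  then show ?case using col_range[OF I, of "i+1"] i by auto
next
  case (Suc j u r)
  let ?I' = "s_part i I" and ?m = "lcum lam j" and ?m' = "lcum lam (Suc j)"
  let ?L = "lvl ?m ?m' (ix I j) (ix I (Suc j)) h" and ?L' = "lvl ?m ?m' (ix ?I' j) (ix I (Suc j)) h"
  let ?P = "Psi lam I h t j" and ?P' = "Psi lam ?I' h t j"
  let ?S = "{\<sigma>. \<sigma> permutes {1..?m}}"
  note r = Suc.prems(3-6)
  have jN: "j \<le> N" "j < N" using Suc.prems by auto
  have q: "ix I (Suc j) r = i" "ix I (Suc j) (r+1) = i+1" "inj_on (ix I (Suc j)) {1..?m'}"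
    using r ix_inj[OF I Suc.prems(2)] by auto
  have hi: "ix ?I' (Suc j) = ix I (Suc j)" by (rule ix_s_part_high[OF I i le Suc.prems(1)])
  have ad: "(A::complex) * sum F ?S = B * sum G ?S - C * sum H ?S"
    if "\<And>\<sigma>. \<sigma> \<in> ?S \<Longrightarrow> A * F \<sigma> = B * G \<sigma> - C * H \<sigma>" for A B C F G H
    using that by (simp add: sum_distrib_left sum_subtractf[symmetric])
  have sc: "d * (c * x) = d1 * (c * y) - d2 * (c * z)" if "d * x = d1 * y - d2 * z" for c d d1 d2 x y z :: complex
    using arg_cong[OF that, of "(*) c"] by (simp add: algebra_simps)
  show ?case
  proof (cases "j < col I (i+1)")
    \<comment> \<open>Level j+1 is the first to contain i+1: everything below is unaffected, and
      only the coupling of levels j and j+1 changes.\<close>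
    case True
    have P': "?P' f = ?P f" for f by (rule Psi_s_part_low[OF I i le True])
    have "(u (r+1) - u r) * ?L' f u = (u (r+1) - h * u r) * ?L f (u \<circ> sw r (r+1)) - (1 - h) * u r * ?L f u" for f
    proof (cases "col I i = col I (i+1)")
      \<comment> \<open>Equal colours: neither position occurs at level j, and the coupling is
        symmetric in the two variables.\<close>
      case True
      have "?L f (u \<circ> sw r (r+1)) = ?L f u"
      proof (rule lvl_swap_none[OF r(1,2) q(1,2)])
        fix a assume "a \<in> {1..?m}"
        then show "ix I j a \<noteq> i \<and> ix I j a \<noteq> i+1"
          using ix_mem[OF I jN(1)] cum_iff_col[OF I] True \<open>j < col I (i+1)\<close> by (metis leD)
      qed
      moreover have "?I' = I" by (rule s_part_same[OF I i True])
      ultimately show ?thesis by (simp add: algebra_simps)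
    next
      case False
      then have "col I i \<le> j" using le True Suc.prems(1) by simp
      then have "i \<in> cum I j" using cum_iff_col[OF I] i by auto
      then obtain s where s: "s \<in> {1..?m}" "ix I j s = i" by (rule ix_surj[OF I jN(1)])
      have s12: "1 \<le> s" "s \<le> ?m" using s by auto
      have p': "ix ?I' j s = i+1" using ix_s_part_low[OF I i le True s(1)] s by simp
      have pp: "ix ?I' j a = ix I j a \<and> ix I j a \<noteq> i \<and> ix I j a \<noteq> i+1" if a: "a \<in> {1..?m}" "a \<noteq> s" for a
      proof -
        have "ix I j a \<noteq> i" using inj_onD[OF ix_inj[OF I jN(1)], of a s] s a by auto
        moreover have "ix I j a \<noteq> i+1" using ix_mem[OF I jN(1) a(1)] cum_iff_col[OF I] True by (metis leD)
        ultimately show ?thesis using ix_s_part_low[OF I i le True a(1)] by (simp add: sw_def)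
      qed
      obtain C where C: "\<And>f u. ?L f u = C f u * (1 - u (r+1) / f s)"
        "\<And>f u. ?L' f u = C f u * (1 - h * u r / f s)" "\<And>f u. C f (u \<circ> sw r (r+1)) = C f u"
        using lvl_split_one[where p = "ix I j" and p' = "ix ?I' j" and q = "ix I (Suc j)" and h = h, OF s12 r(1,2) q s(2) p' pp]
        by metis
      \<comment> \<open>With u = \<open>u r\<close>, u' = \<open>u (r+1)\<close>, x =
        \<open>f s\<close>, this is (u' - u)(1 - h u/x) = (u' - h u)(1 - u/x) - (1 - h) u (1 -
        u'/x), multiplied by a remainder symmetric in u and u'.\<close>
      show ?thesis unfolding C divide_inverse by (simp add: algebra_simps)
    qed
    then have "(u (r+1) - u r) * (?P (t j \<circ> \<sigma>) * ?L' (t j \<circ> \<sigma>) u) = (u (r+1) - h * u r) * (?P (t j \<circ> \<sigma>) * ?L (t j \<circ> \<sigma>) (u \<circ> sw r (r+1)))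
         - (1 - h) * u r * (?P (t j \<circ> \<sigma>) * ?L (t j \<circ> \<sigma>) u)" for \<sigma>
      by (rule sc)
    then show ?thesis unfolding Psi.simps hi P' by (intro ad)
  next
    \<comment> \<open>Both positions occur at level j too, so the induction hypothesis acts on its
      variables s and s+1.\<close>
    case False
    then have hj: "ix ?I' j = ix I j" by (intro ix_s_part_high[OF I i le]) simp
    have "i \<in> cum I j" "i+1 \<in> cum I j" using False le i cum_iff_col[OF I] by auto
    then obtain s where s: "1 \<le> s" "s < ?m" "ix I j s = i" "ix I j (s+1) = i+1"
      by (rule ix_adjacent[OF I jN(1)])
    have perm: "sw s (s+1) permutes {1..?m}" using s by (intro sw_permutes) auto
    obtain C where C: "\<And>f u. ?L f u = C f u * ((1 - u (r+1) / f s) * (1 - h * u r / f (s+1)) * ((1 - h * f (s+1) / f s) / (1 - f (s+1) / f s)))"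
        "\<And>f u. C (f \<circ> sw s (s+1)) u = C f u" "\<And>f u. C f (u \<circ> sw r (r+1)) = C f u"
      using lvl_split_both[where p = "ix I j" and q = "ix I (Suc j)" and h = h, OF s(1,2) r(1,2) q s(3,4) ix_inj[OF I jN(1)]]
      by metis
    \<comment> \<open>Coefficients of the induction hypothesis after division by
      \<open>f (s+1) - f s\<close>.\<close>
    define A where "A f = (f (s+1) - h * f s) / (f (s+1) - f s)" for f
    define B where "B f = (1 - h) * f s / (f (s+1) - f s)" for f
    have dis: "(t j \<circ> \<sigma>) s \<noteq> 0" "(t j \<circ> \<sigma>) (s+1) \<noteq> 0" "(t j \<circ> \<sigma>) s \<noteq> (t j \<circ> \<sigma>) (s+1)" if "\<sigma> \<in> ?S" for \<sigma>
    proof -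
      have \<sigma>: "\<sigma> s \<in> {1..?m}" "\<sigma> (s+1) \<in> {1..?m}" "\<sigma> s \<noteq> \<sigma> (s+1)"
        using that s permutes_in_image[of \<sigma> "{1..?m}"] permutes_inj[of \<sigma> "{1..?m}"] by (auto dest: injD)
      then show "(t j \<circ> \<sigma>) s \<noteq> 0" "(t j \<circ> \<sigma>) (s+1) \<noteq> 0" "(t j \<circ> \<sigma>) s \<noteq> (t j \<circ> \<sigma>) (s+1)"
        using t(2)[OF jN(2)] inj_onD[OF t(1)[OF jN(2)]] by auto
    qed
    have P': "?P' (t j \<circ> \<sigma>) = A (t j \<circ> \<sigma>) * ?P (t j \<circ> \<sigma> \<circ> sw s (s+1)) - B (t j \<circ> \<sigma>) * ?P (t j \<circ> \<sigma>)" if "\<sigma> \<in> ?S" for \<sigma>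
    proof -
      let ?f = "t j \<circ> \<sigma>"
      have nz: "?f (s+1) - ?f s \<noteq> 0" using dis[OF that] by simp
      have "(?f (s+1) - ?f s) * ?P' ?f = (?f (s+1) - h * ?f s) * ?P (?f \<circ> sw s (s+1)) - (1 - h) * ?f s * ?P ?f"
        by (rule Suc.IH) (use False jN s in auto)
      moreover have "A' / d * X - B' / d * Y = Z" if "d * Z = A' * X - B' * Y" "d \<noteq> 0" for A' B' X Y Z d :: complex
        using that by (metis diff_divide_distrib nonzero_mult_div_cancel_left times_divide_eq_left)
      ultimately show ?thesis unfolding A_def B_def using nz by metis
    qed
    have "Psi lam ?I' h t (Suc j) u = (\<Sum>\<sigma>\<in>?S. A (t j \<circ> \<sigma>) * ?P (t j \<circ> \<sigma> \<circ> sw s (s+1)) * ?L (t j \<circ> \<sigma>) u)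
        - (\<Sum>\<sigma>\<in>?S. B (t j \<circ> \<sigma>) * ?P (t j \<circ> \<sigma>) * ?L (t j \<circ> \<sigma>) u)"
      unfolding Psi.simps hi hj sum_subtractf[symmetric]
      by (rule sum.cong[OF refl]) (simp add: P' left_diff_distrib)
    \<comment> \<open>Right multiplication of the summation index by the exchange moves the operator
      from \<open>?P\<close> onto \<open>?L\<close>, where the rational identity turns it into the
      operator in the variables of level j+1.\<close>
    also have "(\<Sum>\<sigma>\<in>?S. A (t j \<circ> \<sigma>) * ?P (t j \<circ> \<sigma> \<circ> sw s (s+1)) * ?L (t j \<circ> \<sigma>) u)
       = (\<Sum>\<sigma>\<in>?S. A (t j \<circ> \<sigma> \<circ> sw s (s+1)) * ?P (t j \<circ> \<sigma>) * ?L (t j \<circ> \<sigma> \<circ> sw s (s+1)) u)"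
      by (subst sum_permutations_compose_right[OF perm]) (simp add: comp_assoc, simp add: comp_def)
    finally have e: "Psi lam ?I' h t (Suc j) u = (\<Sum>\<sigma>\<in>?S. ?P (t j \<circ> \<sigma>) * (A (t j \<circ> \<sigma> \<circ> sw s (s+1)) * ?L (t j \<circ> \<sigma> \<circ> sw s (s+1)) u - B (t j \<circ> \<sigma>) * ?L (t j \<circ> \<sigma>) u))"
      by (simp only: right_diff_distrib sum_subtractf mult_ac)
    have key: "(u (r+1) - u r) * (A (f \<circ> sw s (s+1)) * ?L (f \<circ> sw s (s+1)) u - B f * ?L f u)
       = (u (r+1) - h * u r) * ?L f (u \<circ> sw r (r+1)) - (1 - h) * u r * ?L f u"
      if "f s \<noteq> 0" "f (s+1) \<noteq> 0" "f s \<noteq> f (s+1)" for f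
    proof -
      have m: "d * (a * (c * x) - b * (c * y)) = d1 * (c * z) - d2 * (c * y)"
        if "d * (a * x - b * y) = d1 * z - d2 * y" for a b c d x y z d1 d2 :: complex
      proof -
        have "c * (d * (a * x - b * y)) = c * (d1 * z - d2 * y)" using that by simp
        then show ?thesis by (simp add: algebra_simps)
      qed
      show ?thesis
        unfolding C A_def B_def
        by (rule m) (use exchange_rational_identity[OF that, of "u (r+1)" "u r" h] in simp)
    qed
    show ?thesis
      unfolding e unfolding Psi.simps
    proof (rule ad)
      fix \<sigma> assume "\<sigma> \<in> ?S"
      from key[OF dis[OF this]]
      show "(u (r+1) - u r) * (?P (t j \<circ> \<sigma>) * (A (t j \<circ> \<sigma> \<circ> sw s (s+1)) * ?L (t j \<circ> \<sigma> \<circ> sw s (s+1)) u - B (t j \<circ> \<sigma>) * ?L (t j \<circ> \<sigma>) u))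
        = (u (r+1) - h * u r) * (?P (t j \<circ> \<sigma>) * ?L (t j \<circ> \<sigma>) (u \<circ> sw r (r+1))) - (1 - h) * u r * (?P (t j \<circ> \<sigma>) * ?L (t j \<circ> \<sigma>) u)"
        by (rule sc)
    qed
  qed
qed

text \<open>Every level below k is summed over all permutations, which absorbs a relabelling.
  Substitutions therefore do not depend on the order in which such a level is enumerated.\<close>

lemma Psi_permute_variables:
  assumes "\<And>j. j < k \<Longrightarrow> \<pi> j permutes {1..lcum lam j}"
    and "\<And>j a. j < k \<Longrightarrow> a \<in> {1..lcum lam j} \<Longrightarrow> t' j a = t j (\<pi> j a)"
  shows "Psi lam I h t' k u = Psi lam I h t k u"
  using assms
proof (induction k arbitrary: u)
  case (Suc k)
  have *: "Psi lam I h t' k v = Psi lam I h t k v" for v by (rule Suc.IH) (use Suc.prems in auto)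
  have "Psi lam I h t' (Suc k) u = (\<Sum>\<sigma> | \<sigma> permutes {1..lcum lam k}. Psi lam I h t k (t k \<circ> (\<pi> k \<circ> \<sigma>))
     * lvl (lcum lam k) (lcum lam (Suc k)) (ix I k) (ix I (Suc k)) h (t k \<circ> (\<pi> k \<circ> \<sigma>)) u)"
    unfolding Psi.simps *
  proof (rule sum.cong[OF refl])
    fix \<sigma> assume "\<sigma> \<in> {\<sigma>. \<sigma> permutes {1..lcum lam k}}"
    then have "(t' k \<circ> \<sigma>) a = (t k \<circ> (\<pi> k \<circ> \<sigma>)) a" if "a \<in> {1..lcum lam k}" for a
      using Suc.prems(2)[of k] that permutes_in_image[of \<sigma> "{1..lcum lam k}"] by simp
    then show "Psi lam I h t k (t' k \<circ> \<sigma>) * lvl (lcum lam k) (lcum lam (Suc k)) (ix I k) (ix I (Suc k)) h (t' k \<circ> \<sigma>) u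
       = Psi lam I h t k (t k \<circ> (\<pi> k \<circ> \<sigma>)) * lvl (lcum lam k) (lcum lam (Suc k)) (ix I k) (ix I (Suc k)) h (t k \<circ> (\<pi> k \<circ> \<sigma>)) u"
      by (intro arg_cong2[where f = "(*)"] Psi_cong lvl_cong) auto
  qed
  also have "\<dots> = Psi lam I h t (Suc k) u"
    unfolding Psi.simps
    using setum_permutations_compose_left[OF Suc.prems(1)[of k], of "\<lambda>\<sigma>. Psi lam I h t k (t k \<circ> \<sigma>)
     * lvl (lcum lam k) (lcum lam (Suc k)) (ix I k) (ix I (Suc k)) h (t k \<circ> \<sigma>) u"] by simp
  finally show ?case .
qed simp

section \<open>Inversions and the weight function as an iterated symmetrization\<close>

text \<open>The pairs indexing the factors of \<open>Xdiag\<close>; their number is the length of I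
  above the minimal partition, and the denominators they name all divide D.\<close>

definition linv :: "nat \<Rightarrow> opart \<Rightarrow> (nat \<times> nat) set" where
  "linv n I = {(b, a). 1 \<le> b \<and> b < a \<and> a \<le> n \<and> col I a < col I b}"

lemma finite_linv [simp]: "finite (linv n I)"
  by (rule finite_subset[of _ "{1..n} \<times> {1..n}"]) (auto simp: linv_def)

text \<open>The exchange changes the relative order of no pair except (i, i+1), which becomes a new
  inversion.\<close>

lemma linv_s_part:
  assumes i: "i \<in> {1..<n}" and c: "col I i < col I (i+1)"
  defines "\<phi> \<equiv> map_prod (sw i (i+1)) (sw i (i+1))"
  shows "linv n (s_part i I) = insert (i, i+1) (\<phi> ` linv n I)" "(i, i+1) \<notin> \<phi> ` linv n I" "inj_on \<phi> (linv n I)"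
proof -
  have \<phi>: "\<phi> (\<phi> x) = x" for x by (cases x) (simp add: \<phi>_def)
  have mem: "x \<in> \<phi> ` A \<longleftrightarrow> \<phi> x \<in> A" for x A by (metis \<phi> image_iff)
  have in1: "1 \<le> i" "i < n" using i by auto
  show "(i, i+1) \<notin> \<phi> ` linv n I" unfolding mem by (simp add: \<phi>_def linv_def)
  show "inj_on \<phi> (linv n I)" by (metis \<phi> inj_onI)
  have "(b, a) \<in> linv n (s_part i I) \<longleftrightarrow> (b, a) \<in> insert (i, i+1) (\<phi> ` linv n I)" for a b
  proof (cases "(b, a) = (i, i+1)")
    case True
    then show ?thesis using in1 c by (simp add: linv_def col_s_part)
  next
    case False
    have "b \<in> {1..n} \<and> a \<in> {1..n} \<and> b < a \<and> col I (sw i (i+1) a) < col I (sw i (i+1) b) \<longleftrightarrow>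
      sw i (i+1) b \<in> {1..n} \<and> sw i (i+1) a \<in> {1..n} \<and> sw i (i+1) b < sw i (i+1) a \<and> col I (sw i (i+1) a) < col I (sw i (i+1) b)"
      unfolding sw_interval[OF in1] using False c by (auto simp: sw_def)
    moreover have "(b, a) \<in> linv n J \<longleftrightarrow> b \<in> {1..n} \<and> a \<in> {1..n} \<and> b < a \<and> col J a < col J b" for a b J
      by (auto simp: linv_def)
    ultimately have "(b, a) \<in> linv n (s_part i I) \<longleftrightarrow> (sw i (i+1) b, sw i (i+1) a) \<in> linv n I"
      by (simp only: col_s_part)
    then show ?thesis using False mem[of "(b, a)"] by (auto simp: \<phi>_def)
  qed
  then show "linv n (s_part i I) = insert (i, i+1) (\<phi> ` linv n I)" by auto
qed

lemma card_linv_s_part: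
  assumes "i \<in> {1..<n}" "col I i < col I (i+1)"
  shows "card (linv n (s_part i I)) = Suc (card (linv n I))"
  using linv_s_part[OF assms] by (simp add: card_image)

text \<open>With all pairs of increasing colour in one index set, P, Q, the diagonal coefficient and
  the power of h can be compared factor by factor.\<close>

lemma prod_blocks:
  assumes I: "I \<in> ordparts lam N"
  shows "(\<Prod>k\<in>{1..N}. \<Prod>l\<in>{k<..N}. \<Prod>a\<in>I k. \<Prod>b\<in>I l. g a b)
    = (\<Prod>(a, b)\<in>{(a, b). a \<in> {1..lcum lam N} \<and> b \<in> {1..lcum lam N} \<and> col I a < col I b}. (g a b :: complex))"
proof -
  note fin = ordpartsD(2)[OF I]
  have "(\<Prod>k\<in>{1..N}. \<Prod>l\<in>{k<..N}. \<Prod>a\<in>I k. \<Prod>b\<in>I l. g a b)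
      = (\<Prod>((k, l), (a, b))\<in>(SIGMA (k, l):(SIGMA k:{1..N}. {k<..N}). I k \<times> I l). g a b)"
  proof -
    define H where "H p = (\<Prod>x\<in>I (fst p) \<times> I (snd p). g (fst x) (snd x))" for p
    have "(\<Prod>k\<in>{1..N}. \<Prod>l\<in>{k<..N}. \<Prod>a\<in>I k. \<Prod>b\<in>I l. g a b) = (\<Prod>k\<in>{1..N}. \<Prod>l\<in>{k<..N}. H (k, l))"
      unfolding H_def prod.cartesian_product by (simp add: split_def)
    also have "\<dots> = (\<Prod>(k, l)\<in>(SIGMA k:{1..N}. {k<..N}). H (k, l))"
      by (rule prod.Sigma) auto
    also have "\<dots> = (\<Prod>p\<in>(SIGMA k:{1..N}. {k<..N}). \<Prod>x\<in>I (fst p) \<times> I (snd p). g (fst x) (snd x))"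
      by (rule prod.cong) (auto simp: H_def)
    also have "\<dots> = (\<Prod>(p, x)\<in>(SIGMA p:(SIGMA k:{1..N}. {k<..N}). I (fst p) \<times> I (snd p)). g (fst x) (snd x))"
      by (rule prod.Sigma) (use fin in auto)
    finally show ?thesis by (simp add: split_def)
  qed
  also have "\<dots> = (\<Prod>(a, b)\<in>{(a, b). a \<in> {1..lcum lam N} \<and> b \<in> {1..lcum lam N} \<and> col I a < col I b}. g a b)"
  proof (rule prod.reindex_bij_witness[where i = "\<lambda>(a, b). ((col I a, col I b), (a, b))" and j = snd], goal_cases)
    case (1 x) then show ?case using part_iff_col[OF I] by auto
  next
    case (2 x) then show ?case using part_iff_col[OF I] by auto
  next
    case (3 x) then show ?case by auto
  next
    case (4 x) then show ?case using part_iff_col[OF I] col_range[OF I] by auto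
  next
    case (5 x) then show ?case by auto
  qed
  finally show ?thesis .
qed

lemma Xdiag_linv:
  assumes I: "I \<in> ordparts lam N"
  shows "Xdiag N I z h = (\<Prod>(b, a)\<in>linv (lcum lam N) I. (1 - z b / z a) / (1 - h * z b / z a))"
proof -
  let ?A = "{(a, b). a \<in> {1..lcum lam N} \<and> b \<in> {1..lcum lam N} \<and> col I a < col I b}"
  let ?g = "\<lambda>a b. (1 - z b / z a) / (1 - h * z b / z a)"
  have fA: "finite ?A" by (rule finite_subset[of _ "{1..lcum lam N} \<times> {1..lcum lam N}"]) auto
  have "Xdiag N I z h = (\<Prod>k\<in>{1..N}. \<Prod>l\<in>{k<..N}. \<Prod>a\<in>I k. \<Prod>b\<in>I l. if b < a then ?g a b else 1)"
    unfolding Xdiag_def using ordpartsD(2)[OF I] by (simp only: prod.inter_filter)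
  also have "\<dots> = (\<Prod>x\<in>?A. if snd x < fst x then ?g (fst x) (snd x) else 1)"
    by (subst prod_blocks[OF I]) (simp add: split_def)
  also have "\<dots> = (\<Prod>x\<in>{x\<in>?A. snd x < fst x}. ?g (fst x) (snd x))"
    by (rule prod.inter_filter[OF fA, symmetric])
  also have "\<dots> = (\<Prod>(b, a)\<in>linv (lcum lam N) I. ?g a b)"
    by (rule prod.reindex_bij_witness[where i = prod.swap and j = prod.swap]) (auto simp: linv_def)
  finally show ?thesis .
qed

text \<open>The listed sequence is strictly sorted by decreasing colour and then increasing
  position. Order in the list can thus be replaced by this relation, and an inversion needs two
  different colours.\<close>

lemma pinv_col:
  assumes J: "J \<in> ordparts lam N"
  defines "n \<equiv> lcum lam N"
  shows "pinv N J = card {(x, y). x \<in> {1..n} \<and> y \<in> {1..n} \<and> y < x \<and> col J y < col J x}"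
proof -
  let ?s = "\<lambda>M. concat (map (\<lambda>k. sorted_list_of_set (J k)) (rev [1..<M+1]))"
  define R where "R x y \<longleftrightarrow> col J y < col J x \<or> col J x = col J y \<and> x < y" for x y
  have set_s: "set (?s M) = (\<Union>k\<in>{1..M}. J k)" for M
    using ordpartsD(2)[OF J] by (simp add: atLeastLessThanSuc_atLeastAtMost del: upt_Suc)
  \<comment> \<open>Induction on the number of blocks, since \<open>rev\<close> puts the newest
    block in front.\<close>
  have sorted: "sorted_wrt R (?s M)" for M
  proof (induction M)
    case (Suc M)
    have "sorted_wrt R (sorted_list_of_set (J (Suc M)))"
      by (rule sorted_wrt_mono_rel[OF _ strict_sorted_list_of_set])
         (use ordpartsD(2)[OF J] col_eqI[OF J] in \<open>auto simp: R_def\<close>)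
    moreover have "R x y" if "x \<in> J (Suc M)" "y \<in> set (?s M)" for x y
      using that col_eqI[OF J] unfolding set_s by (force simp: R_def)
    ultimately show ?case using Suc ordpartsD(2)[OF J]
      by (simp add: sorted_wrt_append)
  qed simp
  define s where "s = ?s N"
  have s: "set s = {1..n}" "sorted_wrt R s"
    unfolding s_def set_s n_def using ordpartsD(5)[OF J] sorted by auto
  have nth: "R (s ! a) (s ! b)" if "a < b" "b < length s" for a b
    using s(2) that by (simp add: sorted_wrt_iff_nth_less)
  have irr: "\<not> (R x y \<and> R y x)" "\<not> R x x" for x y by (auto simp: R_def)
  have inj: "a = b" if "a < length s" "b < length s" "s ! a = s ! b" for a b
    using nth[of a b] nth[of b a] that irr(2) by (metis linorder_neqE_nat)
  have "bij_betw (map_prod ((!) s) ((!) s)) {(a, b). a < b \<and> b < length s \<and> s ! a > s ! b}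
      {(x, y). x \<in> {1..n} \<and> y \<in> {1..n} \<and> y < x \<and> col J y < col J x}" (is "bij_betw ?f ?A ?B")
  proof (rule bij_betw_imageI)
    show "inj_on ?f ?A"
    proof (rule inj_onI, clarsimp)
      fix a b a' b' assume "a < b" "b < length s" "a' < b'" "b' < length s" "s ! a = s ! a'" "s ! b = s ! b'"
      then show "a = a' \<and> b = b'" using inj[of a a'] inj[of b b'] by simp
    qed
    show "?f ` ?A = ?B"
    proof (intro subset_antisym subsetI)
      fix p assume "p \<in> ?f ` ?A"
      then obtain a b where ab: "p = (s ! a, s ! b)" "a < b" "b < length s" "s ! b < s ! a" by auto
      have "s ! a \<in> set s" "s ! b \<in> set s" using ab by auto
      then show "p \<in> ?B" using nth[OF ab(2,3)] ab s(1) by (auto simp: R_def)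
    next
      fix p assume "p \<in> ?B"
      then obtain x y where p: "p = (x, y)" "x \<in> set s" "y \<in> set s" "y < x" "col J y < col J x" using s(1) by auto
      obtain a b where ab: "a < length s" "s ! a = x" "b < length s" "s ! b = y" using p(2,3) by (metis in_set_conv_nth)
      have "R x y" using p by (simp add: R_def)
      then have "a < b" using nth[of b a] ab irr by (metis linorder_neqE_nat)
      then show "p \<in> ?f ` ?A" using ab p by (auto intro!: image_eqI[of _ _ "(a, b)"])
    qed
  qed
  then show ?thesis unfolding pinv_def invseq_def s_def[symmetric] by (rule bij_betw_same_card)
qed

section \<open>Reversal of positions, and p(J) as a length\<close>

lemma sigma0_interval [simp]: "sigma0 n j \<in> {1..n} \<longleftrightarrow> j \<in> {1..n}"
  by (auto simp: sigma0_def)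

lemma sigma0_sigma0 [simp]: "j \<in> {1..n} \<Longrightarrow> sigma0 n (sigma0 n j) = j"
  by (auto simp: sigma0_def)

text \<open>Since sigma_0 is an involution on positions, this is also the preimage partition used by
  \<open>Wsig0\<close>.\<close>

definition rpart :: "nat \<Rightarrow> opart \<Rightarrow> opart" where
  "rpart n J = (\<lambda>k. sigma0 n ` J k)"

lemma inj_sigma0: "inj_on (sigma0 n) {1..n}"
  by (metis inj_onI sigma0_sigma0)

lemma rpart_mem:
  assumes J: "J \<in> ordparts lam N"
  shows "rpart (lcum lam N) J \<in> ordparts lam N"
proof -
  let ?n = "lcum lam N"
  let ?s = "sigma0 ?n"
  note sub = ordpartsD(3)[OF J]
  have "?s ` {1..?n} = {1..?n}"
    by (metis endo_inj_surj finite_atLeastAtMost image_subsetI inj_sigma0 sigma0_interval)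
  moreover have "(\<Union>k\<in>{1..N}. ?s ` J k) = ?s ` {1..?n}" using ordpartsD(5)[OF J] by blast
  moreover have "?s ` J k \<subseteq> ?s ` {1..?n}" for k using sub by blast
  moreover have "card (?s ` J k) = card (J k)" for k
    by (rule card_image) (rule inj_on_subset[OF inj_sigma0 sub])
  moreover have "?s ` J k \<inter> ?s ` J l = {}" if "k \<noteq> l" for k l
    using ordpartsD(4)[OF J that] inj_on_image_Int[OF inj_sigma0 sub[of k] sub[of l]] by simp
  ultimately show ?thesis
    unfolding ordparts_def rpart_def using ordpartsD(1,6)[OF J] by simp
qed

lemma col_rpart:
  assumes J: "J \<in> ordparts lam N" and j: "j \<in> {1..lcum lam N}"
  shows "col (rpart (lcum lam N) J) j = col J (sigma0 (lcum lam N) j)"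
proof (rule col_eqI[OF rpart_mem[OF J]])
  have "sigma0 (lcum lam N) j \<in> J (col J (sigma0 (lcum lam N) j))"
    unfolding part_iff_col[OF J] sigma0_interval using j by blast
  then show "j \<in> rpart (lcum lam N) J (col J (sigma0 (lcum lam N) j))"
    unfolding rpart_def using sigma0_sigma0[OF j] by (metis image_eqI)
qed

lemma sw_sigma0:
  assumes "i \<in> {1..<n}" "j \<in> {1..n}"
  shows "sw i (i+1) (sigma0 n j) = sigma0 n (sw (n-i) (n-i+1) j)"
  using assms by (auto simp: sw_def sigma0_def)

text \<open>Conjugation by the reversal carries the exchange at i to the one at n - i, where the two
  colours stand in opposite order.\<close>

lemma rpart_s_part:
  assumes J: "J \<in> ordparts lam N" and i: "i \<in> {1..<lcum lam N}"
  shows "rpart (lcum lam N) (s_part i J) = s_part (lcum lam N - i) (rpart (lcum lam N) J)"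
proof (rule ordparts_eqI[of _ lam N])
  let ?n = "lcum lam N"
  have i': "?n - i \<in> {1..<?n}" using i by auto
  show "rpart ?n (s_part i J) \<in> ordparts lam N" by (intro rpart_mem s_part_mem J i)
  show "s_part (?n - i) (rpart ?n J) \<in> ordparts lam N" by (intro rpart_mem s_part_mem J i')
  fix j assume j: "j \<in> {1..?n}"
  have "sw (?n-i) (?n-i+1) j \<in> {1..?n}" using j i' sw_interval[of "?n-i" ?n] by auto
  then show "col (rpart ?n (s_part i J)) j = col (s_part (?n - i) (rpart ?n J)) j"
    unfolding col_rpart[OF s_part_mem[OF J i] j] col_s_part
    by (subst col_rpart[OF J]) (use sw_sigma0[OF i j] in simp_all)
qed

text \<open>Reversal turns pairs whose colours increase with position into inversions. Hence
  \<open>pinv\<close> is a length and inherits its behaviour under exchanges.\<close>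

lemma pinv_linv:
  assumes J: "J \<in> ordparts lam N"
  shows "pinv N J = card (linv (lcum lam N) (rpart (lcum lam N) J))"
  unfolding pinv_col[OF J]
proof (rule bij_betw_same_card)
  let ?n = "lcum lam N"
  let ?A = "{(x, y). x \<in> {1..?n} \<and> y \<in> {1..?n} \<and> y < x \<and> col J y < col J x}"
  have B: "linv ?n (rpart ?n J) = {(b, a). b \<in> {1..?n} \<and> a \<in> {1..?n} \<and> b < a \<and> col J (sigma0 ?n a) < col J (sigma0 ?n b)}"
    unfolding linv_def using col_rpart[OF J] by auto
  have lt: "sigma0 ?n x < sigma0 ?n y \<longleftrightarrow> y < x" if "x \<in> {1..?n}" "y \<in> {1..?n}" for x y
    using that by (auto simp: sigma0_def)
  show "bij_betw (map_prod (sigma0 ?n) (sigma0 ?n)) ?A (linv ?n (rpart ?n J))"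
    unfolding B
  proof (rule bij_betw_byWitness[where f' = "map_prod (sigma0 ?n) (sigma0 ?n)"], goal_cases)
    case 1 then show ?case using sigma0_sigma0 by (auto simp del: atLeastAtMost_iff)
  next
    case 2 then show ?case using sigma0_sigma0 by (auto simp del: atLeastAtMost_iff)
  next
    case 3 then show ?case using sigma0_sigma0 lt sigma0_interval by (auto simp del: atLeastAtMost_iff)
  next
    case 4 then show ?case using sigma0_sigma0 lt sigma0_interval by (auto simp del: atLeastAtMost_iff)
  qed
qed

lemma pinv_s_part:
  assumes J: "J \<in> ordparts lam N" and i: "i \<in> {1..<lcum lam N}" and c: "col J (i+1) < col J i"
  shows "pinv N (s_part i J) = Suc (pinv N J)"
proof -
  let ?n = "lcum lam N"
  have e: "sigma0 ?n (?n - i) = i + 1" "sigma0 ?n (?n - i + 1) = i" using i by (auto simp: sigma0_def)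
  have "col (rpart ?n J) (?n - i) < col (rpart ?n J) (?n - i + 1)"
  proof -
    have "?n - i \<in> {1..?n}" "?n - i + 1 \<in> {1..?n}" using i by auto
    from this[THEN col_rpart[OF J]] show ?thesis using c e by metis
  qed
  then show ?thesis
    unfolding pinv_linv[OF J] pinv_linv[OF s_part_mem[OF J i]] rpart_s_part[OF J i]
    by (intro card_linv_s_part) (use i in auto)
qed

section \<open>The weight function as an iterated symmetrization\<close>

lemma Psi_symperms:
  assumes "M \<ge> 1"
  shows "Psi lam I h t M u = (\<Sum>\<sigma>\<in>symperms lam M. \<Prod>k\<in>{1..<M}.
     lvl (lcum lam k) (lcum lam (k+1)) (ix I k) (ix I (k+1)) h (t k \<circ> \<sigma> k) (if k + 1 = M then u else t (k+1) \<circ> \<sigma> (k+1)))"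
  using assms
proof (induction M arbitrary: u rule: dec_induct)
  case base
  have "symperms lam 1 = {\<lambda>_. id}" by (auto simp: symperms_def fun_eq_iff)
  \<comment> \<open>Level 0 has no variables: one permutation, and an empty product as its coupling
    with level 1.\<close>
  moreover have "{\<sigma>. \<sigma> permutes {1..lcum lam 0}} = {id}" by auto
  ultimately show ?case by (simp add: lvl_def)
next
  case (step M)
  let ?P = "{\<sigma>. \<sigma> permutes {1..lcum lam M}}"
  let ?L = "\<lambda>k. lvl (lcum lam k) (lcum lam (k+1)) (ix I k) (ix I (k+1)) h"
  have "Psi lam I h t (Suc M) u = (\<Sum>\<pi>\<in>?P. \<Sum>\<sigma>\<in>symperms lam M. (\<Prod>k\<in>{1..<M}.
     ?L k (t k \<circ> \<sigma> k) (if k + 1 = M then t M \<circ> \<pi> else t (k+1) \<circ> \<sigma> (k+1))) * ?L M (t M \<circ> \<pi>) u)"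
    unfolding Psi.simps step.IH sum_distrib_right by simp
  also have "\<dots> = (\<Sum>(\<pi>, \<sigma>)\<in>?P \<times> symperms lam M. (\<Prod>k\<in>{1..<M}.
     ?L k (t k \<circ> \<sigma> k) (if k + 1 = M then t M \<circ> \<pi> else t (k+1) \<circ> \<sigma> (k+1))) * ?L M (t M \<circ> \<pi>) u)"
    by (rule sum.cartesian_product)
  also have "\<dots> = (\<Sum>\<sigma>\<in>symperms lam (Suc M). \<Prod>k\<in>{1..<Suc M}.
     ?L k (t k \<circ> \<sigma> k) (if k + 1 = Suc M then u else t (k+1) \<circ> \<sigma> (k+1)))"
  \<comment> \<open>A family is split into its component at M and the family with that component
    reset to \<open>id\<close>, the value \<open>symperms\<close> demands outside its range.\<close>
  proof (rule sum.reindex_bij_witness[where i = "\<lambda>\<sigma>. (\<sigma> M, \<sigma>(M := id))" and j = "\<lambda>(\<pi>, \<sigma>). \<sigma>(M := \<pi>)"], goal_cases)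
    case (1 x)
    then have "(snd x) M = id" by (auto simp: symperms_def)
    then show ?case by (cases x) (simp add: fun_upd_idem)
  next
    case (2 x) then show ?case using step.hyps by (auto simp: symperms_def)
  next
    case (3 x) then show ?case by simp
  next
    case (4 x) then show ?case using step.hyps by (auto simp: symperms_def)
  next
    case (5 x)
    obtain \<pi> \<sigma> where x: "x = (\<pi>, \<sigma>)" by (cases x)
    show ?case unfolding x split_conv
      using step.hyps by (simp add: prod.atLeastLessThan_Suc) (intro disjI2 prod.cong, auto)
  qed
  finally show ?case .
qed

lemma Wf_Psi:
  assumes "N \<ge> 1"
  shows "Wf lam N I t z h = (1 - h) ^ (\<Sum>k\<in>{1..<N}. lcum lam k) * Psi lam I h t N z"
proof -
  have "Uf lam N I (\<lambda>k a. t k (\<sigma> k a)) z h = (\<Prod>k\<in>{1..<N}.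
     lvl (lcum lam k) (lcum lam (k+1)) (ix I k) (ix I (k+1)) h (t k \<circ> \<sigma> k) (if k + 1 = N then z else t (k+1) \<circ> \<sigma> (k+1)))" for \<sigma>
    unfolding Uf_def Let_def
  proof (rule prod.cong[OF refl])
    fix k assume k: "k \<in> {1..<N}"
    have e: "(\<lambda>c. if k + 1 = N then z c else t (k+1) (\<sigma> (k+1) c)) = (if k + 1 = N then z else t (k+1) \<circ> \<sigma> (k+1))"
      by auto
    show "(\<Prod>a\<in>{1..lcum lam k}.
       (\<Prod>c\<in>{c\<in>{1..lcum lam (k+1)}. ix I (k+1) c < ix I k a}. (1 - h * (if k + 1 = N then z c else t (k+1) (\<sigma> (k+1) c)) / (if k = N then z a else t k (\<sigma> k a))))
     * (\<Prod>c\<in>{c\<in>{1..lcum lam (k+1)}. ix I (k+1) c > ix I k a}. (1 - (if k + 1 = N then z c else t (k+1) (\<sigma> (k+1) c)) / (if k = N then z a else t k (\<sigma> k a))))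
     * (\<Prod>b\<in>{a<..lcum lam k}. (1 - h * (if k = N then z b else t k (\<sigma> k b)) / (if k = N then z a else t k (\<sigma> k a))) / (1 - (if k = N then z b else t k (\<sigma> k b)) / (if k = N then z a else t k (\<sigma> k a)))))
      = lvl (lcum lam k) (lcum lam (k+1)) (ix I k) (ix I (k+1)) h (t k \<circ> \<sigma> k) (if k + 1 = N then z else t (k+1) \<circ> \<sigma> (k+1))"
      unfolding e[symmetric] lvl_def using k by simp
  qed
  then show ?thesis unfolding Wf_def Psi_symperms[OF assms] by simp
qed

lemma Wsig0_Psi:
  assumes "N \<ge> 1" and J: "J \<in> ordparts lam N"
  shows "Wsig0 lam N J t z h = (1 - h) ^ (\<Sum>k\<in>{1..<N}. lcum lam k) * Psi lam (rpart (lcum lam N) J) h t N (z \<circ> sigma0 (lcum lam N))"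
proof -
  have "inv_into {1..lcum lam N} (sigma0 (lcum lam N)) ` J k = sigma0 (lcum lam N) ` J k" for k
  proof (rule image_cong[OF refl])
    fix j assume "j \<in> J k"
    then have j: "j \<in> {1..lcum lam N}" using ordpartsD(3)[OF J] by blast
    then show "inv_into {1..lcum lam N} (sigma0 (lcum lam N)) j = sigma0 (lcum lam N) j"
      using inv_into_f_f[OF inj_sigma0, of "sigma0 (lcum lam N) j"] sigma0_interval sigma0_sigma0 by metis
  qed
  then show ?thesis
    unfolding Wsig0_def Wf_Psi[OF assms(1)] rpart_def comp_def by simp
qed

section \<open>The exchange relation for the explicit formula\<close>

text \<open>A dense set stable under permuting variables; \<open>gdom\<close> is not, as D contains
  1 - h z_b/z_a only for b < a. For n \<ge> 1 the case a = b of the last clause excludes h =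
  1.\<close>

definition gen :: "nat \<Rightarrow> (nat \<Rightarrow> complex) \<Rightarrow> complex \<Rightarrow> bool" where
  "gen n z h \<longleftrightarrow> h \<noteq> 0 \<and> inj_on z {1..n} \<and> (\<forall>a\<in>{1..n}. z a \<noteq> 0) \<and> (\<forall>a\<in>{1..n}. \<forall>b\<in>{1..n}. z a \<noteq> h * z b)"

lemma gen_sw:
  assumes g: "gen n z h" and i: "i \<in> {1..<n}"
  shows "gen n (z \<circ> sw i (i+1)) h"
proof -
  have p: "sw i (i+1) permutes {1..n}" using i by (intro sw_permutes) auto
  have "inj_on (z \<circ> sw i (i+1)) {1..n}"
    by (rule comp_inj_on) (use g permutes_inj_on[OF p] permutes_image[OF p] in \<open>auto simp: gen_def\<close>)
  then show ?thesis using g permutes_in_image[OF p] unfolding gen_def by simp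
qed

lemma gen_gdom: "gen n z h \<Longrightarrow> gdom n z h"
  unfolding gen_def gdom_def Dv_def by (auto simp: field_simps)

lemma enum_permutation:
  assumes f: "bij_betw f A B" and g: "bij_betw g A B"
  obtains \<pi> where "\<pi> permutes A" "\<And>a. a \<in> A \<Longrightarrow> f a = g (\<pi> a)"
proof
  let ?p = "\<lambda>a. if a \<in> A then inv_into A g (f a) else a"
  have "bij_betw (inv_into A g \<circ> f) A A" using f bij_betw_inv_into[OF g] by (rule bij_betw_trans)
  then have "bij_betw ?p A A" by (rule bij_betw_cong[THEN iffD1, rotated]) simp
  then show "?p permutes A" by (rule bij_imp_permutes) simp
  show "f a = g (?p a)" if "a \<in> A" for a
    using that bij_betw_inv_into_right[OF g, of "f a"] bij_betwE[OF f] by simp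
qed

text \<open>The part of \<open>Xformula\<close> independent of J. It is the same in all three terms
  of the exchange relation and factors out.\<close>

definition Kf :: "(nat \<Rightarrow> nat) \<Rightarrow> nat \<Rightarrow> opart \<Rightarrow> (nat \<Rightarrow> complex) \<Rightarrow> complex \<Rightarrow> complex" where
  "Kf lam N I z h = (1 - inverse h) ^ (\<Sum>k\<in>{1..<N}. lcum lam k) / Ef lam N (tsub I (\<lambda>a. inverse (z a))) (inverse h)
     * Pf N I z / Qf N I z h"

lemma Xformula_Psi:
  assumes "N \<ge> 1" "J \<in> ordparts lam N"
  shows "Xformula lam N I J z h = h ^ pinv N J * (Kf lam N I z h *
    Psi lam (rpart (lcum lam N) J) (inverse h) (tsub I (\<lambda>a. inverse (z a))) N ((\<lambda>a. inverse (z a)) \<circ> sigma0 (lcum lam N)))"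
  unfolding Xformula_def Let_def Wsig0_Psi[OF assms] Kf_def by simp

lemma prod_s_part_blocks:
  "(\<Prod>k\<in>{1..N}. \<Prod>l\<in>{k<..N}. \<Prod>a\<in>s_part i I k. \<Prod>b\<in>s_part i I l. g a b)
   = (\<Prod>k\<in>{1..N}. \<Prod>l\<in>{k<..N}. \<Prod>a\<in>I k. \<Prod>b\<in>I l. (g (sw i (i+1) a) (sw i (i+1) b) :: complex))"
  unfolding s_part_def by (simp add: prod.reindex[OF inj_on_subset[OF inj_sw subset_UNIV]])

lemma Pf_s_part: "Pf N (s_part i I) z = Pf N I (z \<circ> sw i (i+1))"
  unfolding Pf_def prod_s_part_blocks by simp

lemma Qf_s_part: "Qf N (s_part i I) z h = Qf N I (z \<circ> sw i (i+1)) h"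
  unfolding Qf_def prod_s_part_blocks by simp

text \<open>At each level both substitutions list the same values, but possibly in a different
  order; \<open>\<pi>\<close> records the difference.\<close>

lemma tsub_s_part:
  assumes I: "I \<in> ordparts lam N" and i: "i \<in> {1..<lcum lam N}"
  obtains \<pi> where "\<And>k. k \<le> N \<Longrightarrow> \<pi> k permutes {1..lcum lam k}"
    "\<And>z k a. k \<le> N \<Longrightarrow> a \<in> {1..lcum lam k} \<Longrightarrow> tsub I (z \<circ> sw i (i+1)) k a = tsub (s_part i I) z k (\<pi> k a)"
proof -
  have "\<exists>\<pi>. \<pi> permutes {1..lcum lam k} \<and> (\<forall>a\<in>{1..lcum lam k}. (sw i (i+1) \<circ> ix I k) a = ix (s_part i I) k (\<pi> a))" if k: "k \<le> N" for k
  proof -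
    have "bij_betw (sw i (i+1)) (cum I k) (cum (s_part i I) k)"
      unfolding cum_s_part using inj_on_subset[OF inj_sw subset_UNIV] by (simp add: bij_betw_def)
    then have "bij_betw (sw i (i+1) \<circ> ix I k) {1..lcum lam k} (cum (s_part i I) k)"
      using ix_bij[OF I k] by (rule bij_betw_trans[rotated])
    from enum_permutation[OF this ix_bij[OF s_part_mem[OF I i] k]] obtain \<pi> where
      "\<pi> permutes {1..lcum lam k}" "\<And>a. a \<in> {1..lcum lam k} \<Longrightarrow> (sw i (i+1) \<circ> ix I k) a = ix (s_part i I) k (\<pi> a)"
      by blast
    then show ?thesis by blast
  qed
  then have "\<forall>k. \<exists>\<pi>. k \<le> N \<longrightarrow> \<pi> permutes {1..lcum lam k} \<and> (\<forall>a\<in>{1..lcum lam k}. (sw i (i+1) \<circ> ix I k) a = ix (s_part i I) k (\<pi> a))"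
    by blast
  from choice[OF this] obtain \<pi> where \<pi>: "\<And>k. k \<le> N \<Longrightarrow> \<pi> k permutes {1..lcum lam k}"
    "\<And>k a. k \<le> N \<Longrightarrow> a \<in> {1..lcum lam k} \<Longrightarrow> (sw i (i+1) \<circ> ix I k) a = ix (s_part i I) k (\<pi> k a)"
    by blast
  show ?thesis
  proof (rule that[of \<pi>])
    show "tsub I (z \<circ> sw i (i+1)) k a = tsub (s_part i I) z k (\<pi> k a)" if "k \<le> N" "a \<in> {1..lcum lam k}" for z k a
      using \<pi>(2)[OF that] by (simp add: tsub_def)
  qed (fact \<pi>(1))
qed

text \<open>E is symmetric within each level, hence blind to enumeration order; P and Q see only
  which values z_a carry which colour.\<close>

lemma Kf_s_part:
  assumes I: "I \<in> ordparts lam N" and i: "i \<in> {1..<lcum lam N}"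
  shows "Kf lam N (s_part i I) z h = Kf lam N I (z \<circ> sw i (i+1)) h"
proof -
  obtain \<pi> where \<pi>: "\<And>k. k \<le> N \<Longrightarrow> \<pi> k permutes {1..lcum lam k}"
    "\<And>z k a. k \<le> N \<Longrightarrow> a \<in> {1..lcum lam k} \<Longrightarrow> tsub I (z \<circ> sw i (i+1)) k a = tsub (s_part i I) z k (\<pi> k a)"
    using tsub_s_part[OF I i] by metis
  let ?t = "tsub (s_part i I) (\<lambda>a. inverse (z a))"
  have "Ef lam N (tsub I ((\<lambda>a. inverse (z a)) \<circ> sw i (i+1))) h = Ef lam N ?t h" for h
    unfolding Ef_def
  proof (rule prod.cong[OF refl])
    fix k assume "k \<in> {1..<N}"
    then have k: "k \<le> N" by simp
    let ?F = "\<lambda>a b. 1 - h * ?t k b / ?t k a"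
    have "(\<Prod>a\<in>{1..lcum lam k}. \<Prod>b\<in>{1..lcum lam k}. 1 - h * tsub I ((\<lambda>a. inverse (z a)) \<circ> sw i (i+1)) k b / tsub I ((\<lambda>a. inverse (z a)) \<circ> sw i (i+1)) k a)
        = (\<Prod>a\<in>{1..lcum lam k}. \<Prod>b\<in>{1..lcum lam k}. ?F (\<pi> k a) (\<pi> k b))"
      by (intro prod.cong refl) (simp only: \<pi>(2)[OF k])
    also have "\<dots> = (\<Prod>a\<in>{1..lcum lam k}. \<Prod>b\<in>{1..lcum lam k}. ?F (\<pi> k a) b)"
      by (rule prod.cong[OF refl]) (rule prod.permute[OF \<pi>(1)[OF k], symmetric, unfolded comp_def])
    also have "\<dots> = (\<Prod>a\<in>{1..lcum lam k}. \<Prod>b\<in>{1..lcum lam k}. ?F a b)"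
      by (rule prod.permute[OF \<pi>(1)[OF k], symmetric, unfolded comp_def])
    finally show "(\<Prod>a\<in>{1..lcum lam k}. \<Prod>b\<in>{1..lcum lam k}. 1 - h * tsub I ((\<lambda>a. inverse (z a)) \<circ> sw i (i+1)) k b / tsub I ((\<lambda>a. inverse (z a)) \<circ> sw i (i+1)) k a)
        = (\<Prod>a\<in>{1..lcum lam k}. \<Prod>b\<in>{1..lcum lam k}. ?F a b)" .
  qed
  then show ?thesis unfolding Kf_def Pf_s_part Qf_s_part by (simp add: comp_def)
qed

text \<open>After reversal, i becomes an ascent n - i of \<open>rpart\<close>, so
  \<open>Psi_exchange\<close> applies at level N to the inverted variables. The common factor
  \<open>Kf\<close> drops out, and exchanging I together with z leaves the lower levels alone up to
  relabelling.\<close>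

lemma Xformula_exchange:
  assumes N: "N \<ge> 1" and I: "I \<in> ordparts lam N" and J: "J \<in> ordparts lam N" and i: "i \<in> {1..<lcum lam N}"
    and g: "gen (lcum lam N) z h" and le: "col J (i+1) \<le> col J i"
  defines "zs \<equiv> z \<circ> sw i (i+1)"
  shows "col J i = col J (i+1) \<Longrightarrow> Xformula lam N (s_part i I) J z h = Xformula lam N I J zs h"
    and "col J i \<noteq> col J (i+1) \<Longrightarrow> (z i - z (i+1)) * Xformula lam N I (s_part i J) zs h =
      (h * z i - z (i+1)) * Xformula lam N (s_part i I) J z h + (1 - h) * z (i+1) * Xformula lam N I J zs h"
proof -
  let ?n = "lcum lam N"
  let ?zi = "\<lambda>a. inverse (z a)" and ?r = "?n - i" and ?J' = "rpart ?n J"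
  let ?I' = "s_part i I" and ?H = "inverse h"
  let ?u = "?zi \<circ> sigma0 ?n"
  \<comment> \<open>The relation is applied at \<open>?v\<close>, so that its exchanged term is
    evaluated at the original \<open>?u\<close>.\<close>
  let ?v = "?u \<circ> sw ?r (?r+1)"
  let ?P = "\<lambda>J u. Psi lam J ?H (tsub ?I' ?zi) N u"
  have I': "?I' \<in> ordparts lam N" by (rule s_part_mem[OF I i])
  have J': "?J' \<in> ordparts lam N" by (rule rpart_mem[OF J])
  have nz: "z i \<noteq> 0" "z (i+1) \<noteq> 0" "h \<noteq> 0" "h * z i \<noteq> z (i+1)"
  proof -
    have "i \<in> {1..?n}" "i+1 \<in> {1..?n}" using i by auto
    then show "z i \<noteq> 0" "z (i+1) \<noteq> 0" "h \<noteq> 0" "h * z i \<noteq> z (i+1)" using g unfolding gen_def by metis+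
  qed
  have r: "?r \<in> {1..<?n}" using i by auto
  have rr: "?r \<in> {1..?n}" "?r + 1 \<in> {1..?n}" using i by auto
  have s0: "sigma0 ?n ?r = i + 1" "sigma0 ?n (?r + 1) = i" using i by (auto simp: sigma0_def)
  have colr: "col ?J' ?r = col J (i+1)" "col ?J' (?r+1) = col J i"
    using rr[THEN col_rpart[OF J]] s0 by simp_all
  have cumN: "cum ?J' N = {1..?n}"
    using cum_iff_col[OF J'] col_range[OF J'] by auto
  have ixN: "ix ?J' N a = a" if "a \<in> {1..?n}" for a
    by (rule ix_eqI[of ?n "\<lambda>a. a"]) (use cumN that in auto)
  have pos: "ix I' k a \<in> {1..?n}" if "I' \<in> ordparts lam N" "k < N" "a \<in> {1..lcum lam k}" for I' k a
    using ix_mem[OF that(1) less_imp_le[OF that(2)] that(3)] cum_iff_col[OF that(1)] by blast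
  have t1: "inj_on (tsub ?I' ?zi k) {1..lcum lam k}" if "k < N" for k
  proof (rule inj_onI)
    fix a b assume ab: "a \<in> {1..lcum lam k}" "b \<in> {1..lcum lam k}" "tsub ?I' ?zi k a = tsub ?I' ?zi k b"
    then have "z (ix ?I' k a) = z (ix ?I' k b)" by (simp add: tsub_def)
    then have "ix ?I' k a = ix ?I' k b"
      using g pos[OF I' that ab(1)] pos[OF I' that ab(2)] unfolding gen_def inj_on_def by blast
    then show "a = b" using inj_onD[OF ix_inj[OF I' less_imp_le[OF that]]] ab(1,2) by blast
  qed
  have t2: "tsub ?I' ?zi k a \<noteq> 0" if "k < N" "a \<in> {1..lcum lam k}" for k a
    using g pos[OF I' that] unfolding gen_def tsub_def by auto
  have ex: "(?v (?r+1) - ?v ?r) * ?P (s_part ?r ?J') ?v =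
    (?v (?r+1) - ?H * ?v ?r) * ?P ?J' (?v \<circ> sw ?r (?r+1)) - (1 - ?H) * ?v ?r * ?P ?J' ?v"
  proof (rule Psi_exchange[OF J' r])
    show "col ?J' ?r \<le> col ?J' (?r+1)" using le colr by simp
    show "col ?J' (?r+1) \<le> N" using col_range[OF J' rr(2)] by simp
    show "ix ?J' N ?r = ?r" "ix ?J' N (?r+1) = ?r+1" using ixN rr by blast+
  qed (use t1 t2 r in auto)
  have vv: "?v \<circ> sw ?r (?r+1) = ?u" by (simp add: fun_eq_iff)
  have v: "?v ?r = inverse (z i)" "?v (?r+1) = inverse (z (i+1))" using s0 by simp_all
  have ex': "h * (z i - z (i+1)) * ?P (s_part ?r ?J') ?v = (h * z i - z (i+1)) * ?P ?J' ?u + (1 - h) * z (i+1) * ?P ?J' ?v"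
  proof -
    \<comment> \<open>The multiplier h z_i z_{i+1} leads back from inverted variables and inverted h
      to z and h.\<close>
    have e: "h * z i * z (i+1) * (inverse (z (i+1)) - inverse (z i)) = h * (z i - z (i+1))"
      "h * z i * z (i+1) * (inverse (z (i+1)) - ?H * inverse (z i)) = h * z i - z (i+1)"
      "h * z i * z (i+1) * ((1 - ?H) * inverse (z i)) = - ((1 - h) * z (i+1))"
      using nz(1-3) by (simp_all add: field_simps)
    have "h * z i * z (i+1) * (?v (?r+1) - ?v ?r) * ?P (s_part ?r ?J') ?v =
      h * z i * z (i+1) * (?v (?r+1) - ?H * ?v ?r) * ?P ?J' ?u - h * z i * z (i+1) * ((1 - ?H) * ?v ?r) * ?P ?J' ?v"
    proof -
      have "w * d * A = w * e * B - w * f * C" if "d * A = e * B - f * C" for w d e f A B C :: complex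
        using that by (simp add: mult.assoc right_diff_distrib)
      from this[OF ex] show ?thesis unfolding vv .
    qed
    then show ?thesis unfolding v e by simp
  qed
  obtain \<pi> where \<pi>: "\<And>k. k \<le> N \<Longrightarrow> \<pi> k permutes {1..lcum lam k}"
    "\<And>z k a. k \<le> N \<Longrightarrow> a \<in> {1..lcum lam k} \<Longrightarrow> tsub I (z \<circ> sw i (i+1)) k a = tsub ?I' z k (\<pi> k a)"
    using tsub_s_part[OF I i] by metis
  have Pt: "Psi lam J1 ?H (tsub I (?zi \<circ> sw i (i+1))) N ((?zi \<circ> sw i (i+1)) \<circ> sigma0 ?n) = ?P J1 ?v" for J1
  proof -
    have "Psi lam J1 ?H (tsub I (?zi \<circ> sw i (i+1))) N u = ?P J1 u" for u
      by (rule Psi_permute_variables[of N \<pi>]) (use \<pi> in auto)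
    moreover have "?P J1 ((?zi \<circ> sw i (i+1)) \<circ> sigma0 ?n) = ?P J1 ?v"
      by (rule Psi_cong) (use sw_sigma0[OF i] in simp)
    ultimately show ?thesis by simp
  qed
  have zs: "(\<lambda>a. inverse (zs a)) = ?zi \<circ> sw i (i+1)" by (simp add: zs_def comp_def)
  define K where "K = Kf lam N ?I' z h"
  have X1: "Xformula lam N ?I' J z h = h ^ pinv N J * (K * ?P ?J' ?u)"
    unfolding Xformula_Psi[OF N J] K_def ..
  have X2: "Xformula lam N I J1 zs h = h ^ pinv N J1 * (K * ?P (rpart ?n J1) ?v)" if "J1 \<in> ordparts lam N" for J1
    unfolding Xformula_Psi[OF N that] K_def Kf_s_part[OF I i] zs Pt by (simp add: zs_def)
  show "Xformula lam N ?I' J z h = Xformula lam N I J zs h" if "col J i = col J (i+1)"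
  proof -
    \<comment> \<open>With equal colours the relation reduces to an equality multiplied by h z_i -
      z_{i+1}, which genericity cancels.\<close>
    have "s_part ?r ?J' = ?J'" by (rule s_part_same[OF J' r]) (use colr that in simp)
    then have "(h * z i - z (i+1)) * ?P ?J' ?v = (h * z i - z (i+1)) * ?P ?J' ?u"
      using ex' by (simp add: algebra_simps)
    then show ?thesis unfolding X1 X2[OF J] using nz(4) by simp
  qed
  show "(z i - z (i+1)) * Xformula lam N I (s_part i J) zs h =
      (h * z i - z (i+1)) * Xformula lam N ?I' J z h + (1 - h) * z (i+1) * Xformula lam N I J zs h"
    if "col J i \<noteq> col J (i+1)"
  proof -
    \<comment> \<open>The extra h on the left of \<open>ex'\<close> is supplied by the additional
      inversion in \<open>pinv\<close>.\<close>
    have p: "pinv N (s_part i J) = Suc (pinv N J)" by (rule pinv_s_part[OF J i]) (use le that in simp)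
    have "(h ^ pinv N J * K) * (h * (z i - z (i+1)) * A) = (h ^ pinv N J * K) * ((h * z i - z (i+1)) * B + (1 - h) * z (i+1) * C)
     \<Longrightarrow> (z i - z (i+1)) * (h ^ Suc (pinv N J) * (K * A)) = (h * z i - z (i+1)) * (h ^ pinv N J * (K * B)) + (1 - h) * z (i+1) * (h ^ pinv N J * (K * C))" for A B C
      by (simp add: algebra_simps)
    then show ?thesis
      unfolding X1 X2[OF J] X2[OF s_part_mem[OF J i]] p rpart_s_part[OF J i] ex'[symmetric] using ex' by simp
  qed
qed

section \<open>The initial condition\<close>

lemma cum_Imin:
  assumes "k \<le> N"
  shows "cum (Imin lam N) k = {1..lcum lam k}"
  using assms
proof (induction k)
  case (Suc k)
  have "cum (Imin lam N) (Suc k) = cum (Imin lam N) k \<union> Imin lam N (Suc k)"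
    by (auto simp: cum_def atLeastAtMostSuc_conv)
  also have "\<dots> = {1..lcum lam k} \<union> {lcum lam k + 1..lcum lam (Suc k)}"
    using Suc by (simp add: Imin_def)
  also have "\<dots> = {1..lcum lam (Suc k)}"
    using lcum_Suc[of lam k] by auto
  finally show ?case .
qed (simp add: cum_def)

lemma Imin_mem: "Imin lam N \<in> ordparts lam N"
proof -
  have u: "(\<Union>k\<in>{1..N}. Imin lam N k) = {1..lcum lam N}"
    using cum_Imin[of N N lam] by (simp add: cum_def)
  moreover have "card (Imin lam N k) = lam k" if "k \<in> {1..N}" for k
    using that lcum_Suc[of lam "k-1"] by (simp add: Imin_def)
  moreover have "Imin lam N k \<inter> Imin lam N l = {}" if "k \<in> {1..N}" "l \<in> {1..N}" "k \<noteq> l" for k l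
  proof -
    have "{lcum lam (k-1) + 1..lcum lam k} \<inter> {lcum lam (l-1) + 1..lcum lam l} = {}" if "k < l" for k l
    proof -
      have "lcum lam k \<le> lcum lam (l-1)" by (rule lcum_mono) (use that in simp)
      then show ?thesis by auto
    qed
    from this[of k l] this[of l k] show ?thesis using that by (auto simp: Imin_def neq_iff)
  qed
  moreover have "Imin lam N k \<subseteq> {1..lcum lam N}" if "k \<in> {1..N}" for k
    using u that by blast
  ultimately show ?thesis unfolding ordparts_def by (simp add: Imin_def)
qed

lemma col_Imin_le_iff:
  assumes "j \<in> {1..lcum lam N}" "k \<le> N"
  shows "col (Imin lam N) j \<le> k \<longleftrightarrow> j \<le> lcum lam k"
  using cum_iff_col[OF Imin_mem, of j lam N k] cum_Imin[OF assms(2), of lam] assms(1) by auto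

lemma col_Imin_mono:
  assumes "a \<in> {1..lcum lam N}" "b \<in> {1..lcum lam N}" "a \<le> b"
  shows "col (Imin lam N) a \<le> col (Imin lam N) b"
proof -
  have c: "col (Imin lam N) b \<le> N" using col_range[OF Imin_mem assms(2)] by simp
  show ?thesis using col_Imin_le_iff[OF assms(2) c] col_Imin_le_iff[OF assms(1) c] assms(3) by simp
qed

lemma linv_Imin: "linv (lcum lam N) (Imin lam N) = {}"
  using col_Imin_mono[of _ lam N] by (force simp: linv_def)

lemma ix_Imin: "k \<le> N \<Longrightarrow> a \<in> {1..lcum lam k} \<Longrightarrow> ix (Imin lam N) k a = a"
  by (rule ix_eqI[of "lcum lam k" "\<lambda>a. a"]) (use cum_Imin in auto)

lemma ordparts_eq_cumI:
  assumes I: "I \<in> ordparts lam N" and J: "J \<in> ordparts lam N" and c: "\<And>k. k \<le> N \<Longrightarrow> cum I k = cum J k"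
  shows "I = J"
proof (rule ordparts_eqI[OF I J])
  fix j assume j: "j \<in> {1..lcum lam N}"
  have le: "col I j \<le> k \<longleftrightarrow> col J j \<le> k" if "k \<le> N" for k
    using c[OF that] cum_iff_col[OF I, of j k] cum_iff_col[OF J, of j k] j by blast
  show "col I j = col J j"
    using le[of "col I j"] le[of "col J j"] col_range[OF I j] col_range[OF J j] by auto
qed

lemma rpart_rpart:
  assumes J: "J \<in> ordparts lam N"
  shows "rpart (lcum lam N) (rpart (lcum lam N) J) = J"
  by (rule ordparts_eqI[OF rpart_mem[OF rpart_mem[OF J]] J])
    (metis J col_rpart rpart_mem sigma0_interval sigma0_sigma0)

lemma cum_rpart:
  assumes J: "J \<in> ordparts lam N"
  shows "cum (rpart (lcum lam N) J) k = {j \<in> {1..lcum lam N}. sigma0 (lcum lam N) j \<in> cum J k}"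
proof (rule set_eqI)
  fix j
  show "j \<in> cum (rpart (lcum lam N) J) k \<longleftrightarrow> j \<in> {j \<in> {1..lcum lam N}. sigma0 (lcum lam N) j \<in> cum J k}"
    unfolding cum_iff_col[OF rpart_mem[OF J]] mem_Collect_eq cum_iff_col[OF J] sigma0_interval
    using col_rpart[OF J, of j] by auto
qed

lemma cum_rpart_Imin:
  assumes "k \<le> N"
  shows "cum (rpart (lcum lam N) (Imin lam N)) k = {lcum lam N + 1 - lcum lam k..lcum lam N}"
  unfolding cum_rpart[OF Imin_mem] cum_Imin[OF assms] using lcum_mono[OF assms, of lam] by (auto simp: sigma0_def)

lemma strict_mono_upper_bound:
  assumes "\<And>a b. 1 \<le> a \<Longrightarrow> a < b \<Longrightarrow> b \<le> m \<Longrightarrow> (f a :: nat) < f b" "1 \<le> a" "a \<le> m" "f m \<le> n"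
  shows "f a + (m - a) \<le> n"
  using assms(3,2)
proof (induction a rule: inc_induct)
  case (step a)
  then show ?case using assms(1)[of a "Suc a"] by auto
qed (use assms(4) in simp)

section \<open>Collapse of the symmetrization at the minimal partition\<close>

context
  fixes lam :: "nat \<Rightarrow> nat" and N :: nat and Z :: "nat \<Rightarrow> complex" and H :: complex
  assumes Z: "inj_on Z {1..lcum lam N}" "\<And>a. a \<in> {1..lcum lam N} \<Longrightarrow> Z a \<noteq> 0"
  fixes T :: "nat \<Rightarrow> nat \<Rightarrow> complex"
  assumes T_def: "\<And>k a. T k a = Z (lcum lam N - lcum lam k + a)"
begin

lemma T_mem: "k \<le> N \<Longrightarrow> a \<in> {1..lcum lam k} \<Longrightarrow> lcum lam N - lcum lam k + a \<in> {1..lcum lam N}"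
  using lcum_mono[of k N lam] by auto

text \<open>The variables of level k are the last ones of level k+1, so each
  \<open>T k (\<sigma> a)\<close> recurs above. A position too far left would produce a factor 1 -
  1, which forces \<open>ix J k a\<close> \<ge> n - m + \<open>\<sigma> a\<close>. An increasing
  enumeration bounded by n gives \<open>ix J k a\<close> \<le> n - m + a. Hence
  \<open>\<sigma> a\<close> \<le> a for all a, so \<open>\<sigma>\<close> is the identity and both
  bounds are attained.\<close>

lemma lvl_top_nonzero:
  assumes J: "J \<in> ordparts lam N" and k: "Suc k \<le> N"
    and top: "cum J (Suc k) = {lcum lam N + 1 - lcum lam (Suc k)..lcum lam N}"
    and \<sigma>: "\<sigma> permutes {1..lcum lam k}"
    and nz: "lvl (lcum lam k) (lcum lam (Suc k)) (ix J k) (ix J (Suc k)) H (T k \<circ> \<sigma>) (T (Suc k)) \<noteq> 0"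
  shows "\<sigma> = id" "cum J k = {lcum lam N + 1 - lcum lam k..lcum lam N}"
proof -
  let ?n = "lcum lam N" and ?m = "lcum lam k" and ?m' = "lcum lam (Suc k)"
  have mm: "?m \<le> ?m'" "?m' \<le> ?n" using lcum_mono[of k "Suc k" lam] lcum_mono[OF k, of lam] by auto
  have ix': "ix J (Suc k) c = ?n - ?m' + c" if "c \<in> {1..?m'}" for c
  proof (rule ix_eqI[OF _ _ that])
    have "(\<lambda>c. c + (?n - ?m')) ` {1..?m'} = {1 + (?n - ?m')..?m' + (?n - ?m')}" by (rule image_add_atLeastAtMost')
    then show "(\<lambda>c. ?n - ?m' + c) ` {1..?m'} = cum J (Suc k)" unfolding top using mm by (simp add: add.commute Suc_diff_le)
  qed simp
  have low: "?n - ?m + \<sigma> a \<le> ix J k a" if a: "a \<in> {1..?m}" for a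
  proof (rule ccontr)
    assume neg: "\<not> ?thesis"
    \<comment> \<open>The index at level k+1 carrying the same variable as \<open>\<sigma> a\<close>
      at level k.\<close>
    let ?c = "?m' - ?m + \<sigma> a"
    have sa: "\<sigma> a \<in> {1..?m}" using permutes_in_image[OF \<sigma>] a by blast
    then have c: "?c \<in> {1..?m'}" using mm by auto
    have e: "?n - ?m' + ?c = ?n - ?m + \<sigma> a" using mm by simp
    then have gt: "ix J (Suc k) ?c > ix J k a" using ix'[OF c] neg by simp
    have "T (Suc k) ?c = T k (\<sigma> a)" unfolding T_def e ..
    moreover have "T k (\<sigma> a) \<noteq> 0" unfolding T_def using T_mem[OF _ sa] Z(2) k by simp
    ultimately have z: "1 - T (Suc k) ?c / (T k \<circ> \<sigma>) a = 0" by simp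
    have "(\<Prod>c\<in>{c\<in>{1..?m'}. ix J (Suc k) c > ix J k a}. 1 - T (Suc k) c / (T k \<circ> \<sigma>) a) = 0"
      by (rule prod_zero) (use gt c z in auto)
    then have "lvl ?m ?m' (ix J k) (ix J (Suc k)) H (T k \<circ> \<sigma>) (T (Suc k)) = 0"
      unfolding lvl_def by (intro prod_zero) (use a in auto)
    with nz show False by simp
  qed
  have up: "ix J k a \<le> ?n - ?m + a" if a: "a \<in> {1..?m}" for a
  proof -
    have "ix J k a + (?m - a) \<le> ?n"
    proof (rule strict_mono_upper_bound)
      show "ix J k ?m \<le> ?n" using ix_mem[OF J, of k ?m] cum_iff_col[OF J] k a by auto
    qed (use ix_strict_mono[OF J] k a in auto)
    then show ?thesis using a mm by auto
  qed
  show id: "\<sigma> = id"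
    by (rule permutes_natset_le[OF \<sigma>]) (use low up in force)
  have "ix J k a = a + (?n - ?m)" if "a \<in> {1..?m}" for a using low[OF that] up[OF that] id by simp
  then have "ix J k ` {1..?m} = (\<lambda>a. a + (?n - ?m)) ` {1..?m}" by (rule image_cong[OF refl])
  then have "cum J k = (\<lambda>a. a + (?n - ?m)) ` {1..?m}"
    using bij_betw_imp_surj_on[OF ix_bij[OF J Suc_leD[OF k]]] by (simp only:)
  also have "\<dots> = {1 + (?n - ?m)..?m + (?n - ?m)}" by (rule image_add_atLeastAtMost')
  finally show "cum J k = {?n + 1 - ?m..?n}" using mm by (simp add: Suc_diff_le)
qed

lemma Psi_top_Suc:
  assumes J: "J \<in> ordparts lam N" and k: "Suc k \<le> N"
    and top: "cum J (Suc k) = {lcum lam N + 1 - lcum lam (Suc k)..lcum lam N}"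
  shows "Psi lam J H T (Suc k) (T (Suc k)) = Psi lam J H T k (T k)
     * lvl (lcum lam k) (lcum lam (Suc k)) (ix J k) (ix J (Suc k)) H (T k) (T (Suc k))"
proof -
  let ?P = "{\<sigma>. \<sigma> permutes {1..lcum lam k}}"
  let ?F = "\<lambda>\<sigma>. Psi lam J H T k (T k \<circ> \<sigma>) * lvl (lcum lam k) (lcum lam (Suc k)) (ix J k) (ix J (Suc k)) H (T k \<circ> \<sigma>) (T (Suc k))"
  have "sum ?F ?P = sum ?F {id}"
    by (rule sum.mono_neutral_right)
      (use lvl_top_nonzero(1)[OF J k top] permutes_id finite_permutations in auto)
  then show ?thesis by simp
qed

text \<open>Downward induction from level N, whose cumulative set is everything: a nonzero value at
  one level makes both factors of its single surviving term nonzero.\<close>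

lemma Psi_top_nonzero:
  assumes J: "J \<in> ordparts lam N" and nz: "Psi lam J H T N (T N) \<noteq> 0" and k: "k \<le> N"
  shows "cum J k = {lcum lam N + 1 - lcum lam k..lcum lam N}"
proof -
  have "cum J k = {lcum lam N + 1 - lcum lam k..lcum lam N} \<and> Psi lam J H T k (T k) \<noteq> 0"
    using k
  proof (induction k rule: inc_induct)
    case base
    have "cum J N = {1..lcum lam N}" using cum_iff_col[OF J] col_range[OF J] by auto
    then show ?case using nz by simp
  next
    case (step k)
    then have *: "Psi lam J H T k (T k) * lvl (lcum lam k) (lcum lam (Suc k)) (ix J k) (ix J (Suc k)) H (T k) (T (Suc k)) \<noteq> 0"
      using Psi_top_Suc[OF J, of k] by simp
    have "cum J k = {lcum lam N + 1 - lcum lam k..lcum lam N}"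
      by (rule lvl_top_nonzero(2)[OF J, of _ id]) (use step * in \<open>auto intro: permutes_id\<close>)
    then show ?case using * by simp
  qed
  then show ?thesis ..
qed

text \<open>For fixed a, the factors 1 - T_c/T_a with c to the right cancel the same-level
  denominators and leave their H-numerators in place. The index d + a, carrying the position of a
  itself, is absent from U; one factor 1 - H of the prefactor fills the gap.\<close>

lemma lvl_top_value:
  assumes k: "k < N" and p: "\<And>a. a \<in> {1..lcum lam k} \<Longrightarrow> p a = lcum lam N - lcum lam k + a"
    and q: "\<And>a. a \<in> {1..lcum lam (Suc k)} \<Longrightarrow> q a = lcum lam N - lcum lam (Suc k) + a"
  shows "(1 - H) ^ lcum lam k * lvl (lcum lam k) (lcum lam (Suc k)) p q H (T k) (T (Suc k))
    = (\<Prod>a\<in>{1..lcum lam k}. \<Prod>c\<in>{1..lcum lam (Suc k)}. 1 - H * T (Suc k) c / T k a)"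
proof -
  let ?n = "lcum lam N" and ?m = "lcum lam k" and ?m' = "lcum lam (Suc k)"
  have mm: "?m \<le> ?m'" "?m' \<le> ?n" using lcum_mono[of k "Suc k" lam] lcum_mono[of "Suc k" N lam] k by auto
  define d where "d = ?m' - ?m"
  have d: "?m' = d + ?m" using mm by (simp add: d_def)
  have TT: "T (Suc k) (d + b) = T k b" for b unfolding T_def d_def using mm by simp
  have "(1 - H) * ((\<Prod>c\<in>{c\<in>{1..?m'}. q c < p a}. (1 - H * T (Suc k) c / T k a))
     * (\<Prod>c\<in>{c\<in>{1..?m'}. q c > p a}. (1 - T (Suc k) c / T k a))
     * (\<Prod>b\<in>{a<..?m}. (1 - H * T k b / T k a) / (1 - T k b / T k a))) = (\<Prod>c\<in>{1..?m'}. 1 - H * T (Suc k) c / T k a)"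
    if a: "a \<in> {1..?m}" for a
  proof -
    let ?g = "\<lambda>c. 1 - H * T (Suc k) c / T k a"
    have s: "q c < p a \<longleftrightarrow> c < d + a" "q c > p a \<longleftrightarrow> c > d + a" if "c \<in> {1..?m'}" for c
      using p[OF a] q[OF that] mm by (auto simp: d_def)
    have s1: "{c\<in>{1..?m'}. q c < p a} = {1..<d+a}" using s a d by auto
    have s2: "{c\<in>{1..?m'}. q c > p a} = {d+a<..?m'}" using s a d by auto
    have re: "prod f {d+a<..?m'} = (\<Prod>b\<in>{a<..?m}. f (d + b))" for f :: "nat \<Rightarrow> complex"
      by (rule prod.reindex_bij_witness[where i = "\<lambda>b. d + b" and j = "\<lambda>c. c - d"]) (auto simp: d)
    have nz: "1 - T k b / T k a \<noteq> 0" if b: "b \<in> {a<..?m}" for b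
    proof -
      have ma: "?n - ?m + a \<in> {1..?n}" by (rule T_mem[OF less_imp_le[OF k] a])
      have mb: "?n - ?m + b \<in> {1..?n}" by (rule T_mem[OF less_imp_le[OF k]]) (use b in auto)
      have "T k b \<noteq> T k a" unfolding T_def using inj_onD[OF Z(1) _ mb ma] b by auto
      moreover have "T k a \<noteq> 0" unfolding T_def using Z(2)[OF ma] .
      ultimately show ?thesis by simp
    qed
    have "T k a \<noteq> 0" unfolding T_def using Z(2) T_mem[OF less_imp_le[OF k] a] by simp
    then have c0: "?g (d + a) = 1 - H" by (simp add: TT)
    have "(\<Prod>c\<in>{d+a<..?m'}. (1 - T (Suc k) c / T k a)) * (\<Prod>b\<in>{a<..?m}. (1 - H * T k b / T k a) / (1 - T k b / T k a))
       = prod ?g {d+a<..?m'}"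
      unfolding re TT prod.distrib[symmetric] using nz by (intro prod.cong) auto
    then have "(1 - H) * (prod ?g {1..<d+a} * (\<Prod>c\<in>{d+a<..?m'}. (1 - T (Suc k) c / T k a)) * (\<Prod>b\<in>{a<..?m}. (1 - H * T k b / T k a) / (1 - T k b / T k a)))
       = prod ?g {1..<d+a} * (?g (d+a) * prod ?g {d+a<..?m'})"
      unfolding c0 by (simp add: mult_ac)
    also have "?g (d+a) * prod ?g {d+a<..?m'} = prod ?g {d+a..?m'}"
      by (rule prod.head[symmetric]) (use a d in simp)
    also have "prod ?g {1..<d+a} * prod ?g {d+a..?m'} = prod ?g {1..?m'}"
      by (subst prod.union_disjoint[symmetric]) (use a d in \<open>auto intro!: prod.cong\<close>)
    finally show ?thesis unfolding s1 s2 .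
  qed
  moreover have "(1 - H) ^ ?m = (\<Prod>a\<in>{1..?m}. 1 - H)" by simp
  ultimately show ?thesis
    unfolding lvl_def by (simp only: prod.distrib[symmetric] cong: prod.cong)
qed

end

lemma prod_interval_reverse: "(\<Prod>a\<in>{1..m}. g (m + 1 - a)) = (\<Prod>a\<in>{1..m::nat}. g a)"
  by (rule prod.reindex_bij_witness[where i = "\<lambda>a. m + 1 - a" and j = "\<lambda>a. m + 1 - a"]) auto

text \<open>A nonzero value forces the reversed J to have the cumulative sets of the reversed
  \<open>Imin\<close>. For J = \<open>Imin\<close> the one surviving term is a full product: its
  pairs within a level cancel E, and the remaining pairs combine with P and the power of h into
  Q.\<close>

lemma Xformula_Imin:
  assumes N: "N \<ge> 1" and J: "J \<in> ordparts lam N" and g: "gen (lcum lam N) z h"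
  shows "Xformula lam N (Imin lam N) J z h = (if J = Imin lam N then 1 else 0)"
proof -
  let ?n = "lcum lam N" and ?H = "inverse h" and ?zi = "\<lambda>a. inverse (z a)" and ?I = "Imin lam N"
  let ?J' = "rpart ?n J"
  define Z where "Z = ?zi \<circ> sigma0 ?n"
  have z: "h \<noteq> 0" "inj_on z {1..?n}" "\<And>a. a \<in> {1..?n} \<Longrightarrow> z a \<noteq> 0" "\<And>a b. a \<in> {1..?n} \<Longrightarrow> b \<in> {1..?n} \<Longrightarrow> z a \<noteq> h * z b"
    using g unfolding gen_def by blast+
  have Z: "inj_on Z {1..?n}" "\<And>a. a \<in> {1..?n} \<Longrightarrow> Z a \<noteq> 0"
  proof -
    show "inj_on Z {1..?n}"
    proof (rule inj_onI)
      fix a b assume ab: "a \<in> {1..?n}" "b \<in> {1..?n}" "Z a = Z b"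
      then have "sigma0 ?n a = sigma0 ?n b" using inj_onD[OF z(2), of "sigma0 ?n a" "sigma0 ?n b"] sigma0_interval by (simp add: Z_def)
      then show "a = b" using ab sigma0_sigma0 by metis
    qed
    show "Z a \<noteq> 0" if "a \<in> {1..?n}" for a using z(3)[of "sigma0 ?n a"] that sigma0_interval[of ?n a] by (simp add: Z_def)
  qed
  define T where "T k a = Z (?n - lcum lam k + a)" for k a
  have Tz: "T k a = ?zi (lcum lam k + 1 - a)" if "k \<le> N" "a \<in> {1..lcum lam k}" for k a
    using lcum_mono[OF that(1), of lam] that(2) unfolding T_def Z_def by (simp add: sigma0_def)
  have PsiT: "Psi lam J1 ?H (tsub ?I ?zi) N Z = Psi lam J1 ?H T N (T N)" for J1
  proof -
    \<comment> \<open>\<open>tsub\<close> lists the values at level k upwards in the index of z,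
      \<open>T\<close> lists the same values downwards.\<close>
    define \<pi> where "\<pi> k a = (if a \<in> {1..lcum lam k} then lcum lam k + 1 - a else a)" for k a
    have "Psi lam J1 ?H (tsub ?I ?zi) N Z = Psi lam J1 ?H T N Z"
    proof (rule Psi_permute_variables[of N \<pi>])
      show "\<pi> k permutes {1..lcum lam k}" for k
      proof (rule bij_imp_permutes)
        show "bij_betw (\<pi> k) {1..lcum lam k} {1..lcum lam k}"
          by (rule bij_betw_byWitness[where f' = "\<pi> k"]) (auto simp: \<pi>_def)
      qed (auto simp: \<pi>_def)
      show "tsub ?I ?zi k a = T k (\<pi> k a)" if "k < N" "a \<in> {1..lcum lam k}" for k a
        using that by (subst Tz) (auto simp: tsub_def ix_Imin \<pi>_def)
    qed
    also have "\<dots> = Psi lam J1 ?H T N (T N)"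
      by (rule Psi_cong) (simp add: T_def)
    finally show ?thesis .
  qed
  have X: "Xformula lam N ?I J z h = h ^ pinv N J * (Kf lam N ?I z h * Psi lam ?J' ?H T N (T N))"
    unfolding Xformula_Psi[OF N J] PsiT[unfolded Z_def] Z_def ..
  show ?thesis
  proof (cases "J = ?I")
    case False
    have "Psi lam ?J' ?H T N (T N) = 0"
    proof (rule ccontr)
      assume nz: "\<not> ?thesis"
      have "?J' = rpart ?n ?I"
      proof (rule ordparts_eq_cumI[OF rpart_mem[OF J] rpart_mem[OF Imin_mem]])
        show "cum ?J' k = cum (rpart ?n ?I) k" if "k \<le> N" for k
          unfolding cum_rpart_Imin[OF that] by (rule Psi_top_nonzero[OF Z T_def rpart_mem[OF J] nz that])
      qed
      then show False using False rpart_rpart[OF J] rpart_rpart[OF Imin_mem, of lam N] by metis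
    qed
    then show ?thesis using False X by simp
  next
    case True
    let ?M = "rpart ?n ?I"
    note M = rpart_mem[OF Imin_mem, of lam N]
    have ixM: "ix ?M k a = ?n - lcum lam k + a" if "k \<le> N" "a \<in> {1..lcum lam k}" for k a
    proof (rule ix_eqI[OF _ _ that(2)])
      have "(\<lambda>c. c + (?n - lcum lam k)) ` {1..lcum lam k} = {1 + (?n - lcum lam k)..lcum lam k + (?n - lcum lam k)}"
        by (rule image_add_atLeastAtMost')
      then show "(\<lambda>c. ?n - lcum lam k + c) ` {1..lcum lam k} = cum ?M k"
        unfolding cum_rpart_Imin[OF that(1)] using lcum_mono[OF that(1), of lam] by (simp add: add.commute Suc_diff_le)
    qed simp
    let ?L = "\<lambda>k. lvl (lcum lam k) (lcum lam (Suc k)) (ix ?M k) (ix ?M (Suc k)) ?H (T k) (T (Suc k))"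
    have Psi: "Psi lam ?M ?H T k (T k) = (\<Prod>j\<in>{1..<k}. ?L j)" if "k \<le> N" for k
      using that
    proof (induction k)
      case (Suc k)
      have "Psi lam ?M ?H T (Suc k) (T (Suc k)) = (\<Prod>j\<in>{1..<k}. ?L j) * ?L k"
        using Suc Psi_top_Suc[OF Z T_def M Suc.prems cum_rpart_Imin[OF Suc.prems]] by simp
      also have "\<dots> = (\<Prod>j\<in>{1..<Suc k}. ?L j)"
        by (cases "k = 0") (simp_all add: lvl_def prod.atLeastLessThan_Suc)
      finally show ?case .
    qed simp
    let ?G = "\<lambda>a c. 1 - ?H * ?zi c / ?zi a"
    let ?R = "\<lambda>k. \<Prod>a\<in>{1..lcum lam k}. \<Prod>c\<in>{lcum lam k + 1..lcum lam (Suc k)}. ?G a c"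
    let ?E = "\<lambda>k. \<Prod>a\<in>{1..lcum lam k}. \<Prod>b\<in>{1..lcum lam k}. ?G a b"
    have L: "(1 - ?H) ^ lcum lam k * ?L k = ?E k * ?R k" if "k < N" for k
    proof -
      have "(1 - ?H) ^ lcum lam k * ?L k = (\<Prod>a\<in>{1..lcum lam k}. \<Prod>c\<in>{1..lcum lam (Suc k)}. 1 - ?H * T (Suc k) c / T k a)"
        by (rule lvl_top_value[OF Z T_def that]) (use ixM that in auto)
      also have "\<dots> = (\<Prod>a\<in>{1..lcum lam k}. \<Prod>c\<in>{1..lcum lam (Suc k)}. ?G (lcum lam k + 1 - a) (lcum lam (Suc k) + 1 - c))"
        by (intro prod.cong refl) (use Tz that in auto)
      also have "\<dots> = (\<Prod>a\<in>{1..lcum lam k}. \<Prod>c\<in>{1..lcum lam (Suc k)}. ?G a c)"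
        unfolding prod_interval_reverse[of "\<lambda>c. ?G _ c"] by (rule prod_interval_reverse)
      also have "\<dots> = (\<Prod>a\<in>{1..lcum lam k}. (\<Prod>c\<in>{1..lcum lam k}. ?G a c) * (\<Prod>c\<in>{lcum lam k + 1..lcum lam (Suc k)}. ?G a c))"
      proof (rule prod.cong[OF refl])
        fix a
        have "{1..lcum lam (Suc k)} = {1..lcum lam k} \<union> {lcum lam k + 1..lcum lam (Suc k)}"
          using lcum_mono[of k "Suc k" lam] by auto
        then show "(\<Prod>c\<in>{1..lcum lam (Suc k)}. ?G a c) = (\<Prod>c\<in>{1..lcum lam k}. ?G a c) * (\<Prod>c\<in>{lcum lam k + 1..lcum lam (Suc k)}. ?G a c)"
          by (simp only:) (rule prod.union_disjoint, auto)
      qed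
      finally show ?thesis by (simp add: prod.distrib)
    qed
    have Ef: "Ef lam N (tsub ?I ?zi) ?H = (\<Prod>k\<in>{1..<N}. ?E k)"
      unfolding Ef_def by (intro prod.cong refl) (auto simp: tsub_def ix_Imin)
    have Enz: "(\<Prod>k\<in>{1..<N}. ?E k) \<noteq> 0"
    proof -
      have "?G a b \<noteq> 0" if "k < N" "a \<in> {1..lcum lam k}" "b \<in> {1..lcum lam k}" for k a b
      proof -
        have "a \<in> {1..?n}" "b \<in> {1..?n}" using that lcum_mono[of k N lam] by auto
        then show ?thesis using z(1) z(3)[of a] z(3)[of b] z(4)[of a b] by (auto simp: field_simps)
      qed
      then show ?thesis by (simp only: prod_zero_iff finite_atLeastLessThan finite_atLeastAtMost) force
    qed
    have "(1 - ?H) ^ (\<Sum>k\<in>{1..<N}. lcum lam k) * Psi lam ?M ?H T N (T N) = (\<Prod>k\<in>{1..<N}. (1 - ?H) ^ lcum lam k * ?L k)"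
      unfolding Psi[OF order_refl] by (simp add: power_sum prod.distrib)
    also have "\<dots> = (\<Prod>k\<in>{1..<N}. ?E k) * (\<Prod>k\<in>{1..<N}. ?R k)"
      by (subst prod.distrib[symmetric]) (rule prod.cong, use L in auto)
    finally have KP0: "(1 - ?H) ^ (\<Sum>k\<in>{1..<N}. lcum lam k) * Psi lam ?M ?H T N (T N) = (\<Prod>k\<in>{1..<N}. ?E k) * (\<Prod>k\<in>{1..<N}. ?R k)" .
    have "c / E * p / q * P = R * p / q" if "c * P = E * R" "E \<noteq> 0" for c E p q P R :: complex
    proof -
      have "c / E * p / q * P = (c * P) / E * (p / q)" by simp
      then show ?thesis unfolding that(1) using that(2) by simp
    qed
    from this[OF KP0 Enz] have KP: "Kf lam N ?I z h * Psi lam ?M ?H T N (T N) = (\<Prod>k\<in>{1..<N}. ?R k) * Pf N ?I z / Qf N ?I z h"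
      unfolding Kf_def Ef .
    let ?D = "{(a, b). a \<in> {1..?n} \<and> b \<in> {1..?n} \<and> col ?I a < col ?I b}"
    have fD: "finite ?D" by (rule finite_subset[of _ "{1..?n} \<times> {1..?n}"]) auto
    have R: "(\<Prod>k\<in>{1..<N}. ?R k) = (\<Prod>(a, b)\<in>?D. ?G a b)"
    proof -
      have "(\<Prod>k\<in>{1..<N}. ?R k) = (\<Prod>k\<in>{1..<N}. \<Prod>x\<in>{1..lcum lam k} \<times> {lcum lam k + 1..lcum lam (Suc k)}. ?G (fst x) (snd x))"
        by (simp add: prod.cartesian_product split_def)
      also have "\<dots> = (\<Prod>(k, x)\<in>(SIGMA k:{1..<N}. {1..lcum lam k} \<times> {lcum lam k + 1..lcum lam (Suc k)}). ?G (fst x) (snd x))"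
        by (rule prod.Sigma) auto
      also have "\<dots> = (\<Prod>(a, b)\<in>?D. ?G a b)"
      \<comment> \<open>The second position lies in block k+1, so k is its colour minus 1.\<close>
      proof (rule prod.reindex_bij_witness[where i = "\<lambda>(a, b). (col ?I b - 1, (a, b))" and j = snd], goal_cases)
        case (1 x)
        obtain k a c where x: "x = (k, (a, c))" by (cases x) auto
        have k: "k < N" and c: "lcum lam k + 1 \<le> c" "c \<le> lcum lam (Suc k)" using 1 x by auto
        then have "c \<in> ?I (Suc k)" by (simp add: Imin_def)
        then have "col ?I c = Suc k" by (rule col_eqI[OF Imin_mem])
        then show ?case using x by simp
      next
        case (2 x)
        obtain k a c where x: "x = (k, (a, c))" by (cases x) auto
        have k: "k < N" and a: "1 \<le> a" "a \<le> lcum lam k" and c: "lcum lam k + 1 \<le> c" "c \<le> lcum lam (Suc k)" using 2 x by auto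
        then have "c \<in> ?I (Suc k)" by (simp add: Imin_def)
        then have "col ?I c = Suc k" by (rule col_eqI[OF Imin_mem])
        moreover have "a \<in> {1..?n}" "c \<in> {1..?n}" using a c k lcum_mono[of k N lam] lcum_mono[of "Suc k" N lam] by auto
        moreover have "col ?I a \<le> k" using col_Imin_le_iff[OF \<open>a \<in> {1..?n}\<close>, of k] a k by simp
        ultimately show ?case using x by simp
      next
        case (3 x) then show ?case by auto
      next
        case (4 x)
        then obtain a b where x: "x = (a, b)" and ab: "a \<in> {1..?n}" "b \<in> {1..?n}" "col ?I a < col ?I b" by blast
        define k where "k = col ?I b - 1"
        have kb: "col ?I b = Suc k" using ab(3) by (simp add: k_def)
        have kN: "Suc k \<le> N" "1 \<le> k" using col_range[OF Imin_mem ab(2)] col_range[OF Imin_mem ab(1)] kb ab(3) by auto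
        have "a \<le> lcum lam k" using col_Imin_le_iff[OF ab(1), of k] kN ab(3) kb by simp
        moreover have "\<not> b \<le> lcum lam k" "b \<le> lcum lam (Suc k)"
          using col_Imin_le_iff[OF ab(2), of k] col_Imin_le_iff[OF ab(2), of "Suc k"] kN kb by auto
        ultimately show ?case using kN ab(1) unfolding x split_conv k_def[symmetric] by auto
      next
        case (5 x) then show ?case by (auto simp: split_def)
      qed
      finally show ?thesis .
    qed
    have p: "h ^ pinv N ?I = (\<Prod>(a, b)\<in>?D. h)"
    proof -
      \<comment> \<open>In \<open>Imin\<close> colours increase weakly with position, so a pair with
        increasing colours is automatically in increasing order and is counted by p.\<close>
      have "pinv N ?I = card ?D"
        unfolding pinv_col[OF Imin_mem]
      proof (rule bij_betw_same_card[of prod.swap], rule bij_betw_byWitness[where f' = prod.swap], goal_cases)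
        case 4
        show ?case
        proof
          fix x assume "x \<in> prod.swap ` ?D"
          then obtain a b where x: "x = (b, a)" "a \<in> {1..?n}" "b \<in> {1..?n}" "col ?I a < col ?I b" by auto
          then show "x \<in> {(x, y). x \<in> {1..?n} \<and> y \<in> {1..?n} \<and> y < x \<and> col ?I y < col ?I x}"
            using col_Imin_mono[OF x(3,2)] by force
        qed
      qed auto
      then show ?thesis by (simp add: split_def)
    qed
    have "(\<Prod>(a, b)\<in>?D. h) * ((\<Prod>(a, b)\<in>?D. ?G a b) * (\<Prod>(a, b)\<in>?D. - z b / z a) / (\<Prod>(a, b)\<in>?D. 1 - h * z b / z a))
       = (\<Prod>(a, b)\<in>?D. h * (?G a b * (- z b / z a) / (1 - h * z b / z a)))"
      by (simp only: split_def prod.distrib prod_dividef)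
    also have "\<dots> = 1"
    proof (rule prod.neutral, clarify)
      fix a b assume ab: "a \<in> {1..?n}" "b \<in> {1..?n}"
      have nz: "z a \<noteq> 0" "z b \<noteq> 0" "z a - h * z b \<noteq> 0" using z(3,4) ab by auto
      \<comment> \<open>A single factor of h^p, of the level product and of P multiply to a single
        factor of Q.\<close>
      have e1: "h * (?G a b * (- z b / z a)) = 1 - h * z b / z a" using nz z(1) by (simp add: field_simps)
      have e2: "1 - h * z b / z a \<noteq> 0" using nz by (simp add: field_simps)
      have "h * (?G a b * (- z b / z a) / (1 - h * z b / z a)) = h * (?G a b * (- z b / z a)) / (1 - h * z b / z a)" by simp
      also have "\<dots> = 1" unfolding e1 using e2 by simp
      finally show "h * (?G a b * (- z b / z a) / (1 - h * z b / z a)) = 1" .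
    qed
    finally have "h ^ pinv N ?I * ((\<Prod>k\<in>{1..<N}. ?R k) * Pf N ?I z / Qf N ?I z h) = 1"
      unfolding p R Pf_def Qf_def prod_blocks[OF Imin_mem] .
    then show ?thesis using X KP True by simp
  qed
qed

section \<open>Coefficient rings and density\<close>

text \<open>Membership is a statement about functions on the nose, not only about their values on the domain,
  so that it is stable under exchanging variables.\<close>

inductive_set ringS :: "nat \<Rightarrow> (nat \<times> nat) set \<Rightarrow> coef set" for n :: nat and S :: "(nat \<times> nat) set" where
  rconst: "(\<lambda>z h. c) \<in> ringS n S"
| rvar: "i \<in> {1..n} \<Longrightarrow> (\<lambda>z h. z i) \<in> ringS n S"
| rivar: "i \<in> {1..n} \<Longrightarrow> (\<lambda>z h. inverse (z i)) \<in> ringS n S"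
| rh: "(\<lambda>z h. h) \<in> ringS n S"
| rih: "(\<lambda>z h. inverse h) \<in> ringS n S"
| rden: "(b, a) \<in> S \<Longrightarrow> (\<lambda>z h. inverse (1 - h * z b / z a)) \<in> ringS n S"
| radd: "p \<in> ringS n S \<Longrightarrow> q \<in> ringS n S \<Longrightarrow> (\<lambda>z h. p z h + q z h) \<in> ringS n S"
| rmult: "p \<in> ringS n S \<Longrightarrow> q \<in> ringS n S \<Longrightarrow> (\<lambda>z h. p z h * q z h) \<in> ringS n S"

lemma ringS_mono: "f \<in> ringS n S \<Longrightarrow> S \<subseteq> S' \<Longrightarrow> f \<in> ringS n S'"
  by (induction rule: ringS.induct) (auto intro: ringS.intros)

lemma ringS_diff:
  assumes "p \<in> ringS n S" "q \<in> ringS n S"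
  shows "(\<lambda>z h. p z h - q z h) \<in> ringS n S"
  using radd[OF assms(1) rmult[OF rconst[of "-1"] assms(2)]] by simp

text \<open>The set of allowed denominators moves with the variables. Along an ascent its image
  consists of inversions of the new partition, by \<open>linv_s_part\<close>.\<close>

lemma ringS_swap:
  assumes "f \<in> ringS n S" and i: "i \<in> {1..<n}"
  shows "(\<lambda>z h. f (z \<circ> sw i (i+1)) h) \<in> ringS n (map_prod (sw i (i+1)) (sw i (i+1)) ` S)"
  using assms(1)
proof (induction rule: ringS.induct)
  case (rvar j)
  then have "sw i (i+1) j \<in> {1..n}" using i sw_interval[of i n j] by auto
  then show ?case by (simp add: ringS.rvar)
next
  case (rivar j)
  then have "sw i (i+1) j \<in> {1..n}" using i sw_interval[of i n j] by auto
  then show ?case by (simp add: ringS.rivar)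
next
  case (rden b a)
  then have "(sw i (i+1) b, sw i (i+1) a) \<in> map_prod (sw i (i+1)) (sw i (i+1)) ` S" by force
  then show ?case by (simp add: ringS.rden)
qed (auto intro: ringS.intros)

lemma laurent_prod:
  assumes "finite A" "\<And>x. x \<in> A \<Longrightarrow> g x \<in> laurent n"
  shows "(\<lambda>z h. \<Prod>x\<in>A. g x z h) \<in> laurent n"
  using assms by (induction A rule: finite_induct) (auto intro: laurent.intros)

lemma laurent_power: "p \<in> laurent n \<Longrightarrow> (\<lambda>z h. p z h ^ k) \<in> laurent n"
  by (induction k) (auto intro: laurent.intros)

lemma laurent_factor:
  assumes "x \<in> upairs n"
  shows "(\<lambda>z h. 1 - h * z (fst x) / z (snd x)) \<in> laurent n"
proof -
  have "fst x \<in> {1..n}" "snd x \<in> {1..n}" using assms by (auto simp: upairs_def)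
  then have "(\<lambda>z h. 1 + (-1) * (h * z (fst x) * inverse (z (snd x)))) \<in> laurent n"
    by (intro laurent.intros)
  then show ?thesis by (simp add: divide_inverse)
qed

lemma Dv_upairs: "Dv n z h = (\<Prod>x\<in>upairs n. 1 - h * z (fst x) / z (snd x))"
proof -
  have "Dv n z h = (\<Prod>(a, b)\<in>(SIGMA a:{1..n}. {1..<a}). 1 - h * z b / z a)"
    unfolding Dv_def by (rule prod.Sigma) auto
  also have "\<dots> = (\<Prod>x\<in>upairs n. 1 - h * z (fst x) / z (snd x))"
    by (rule prod.reindex_bij_witness[where i = prod.swap and j = prod.swap]) (auto simp: upairs_def)
  finally show ?thesis .
qed

lemma Dv_laurent: "Dv n \<in> laurent n"
  unfolding Dv_upairs[abs_def] by (rule laurent_prod) (auto intro: laurent_factor)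

lemma gdom_factor: "gdom n z h \<Longrightarrow> (b, a) \<in> upairs n \<Longrightarrow> 1 - h * z b / z a \<noteq> 0"
  unfolding gdom_def Dv_upairs by (force simp: prod_zero_iff)

lemma in_ringI:
  assumes "p \<in> laurent n" "\<And>z h. gdom n z h \<Longrightarrow> f z h = p z h / Dv n z h ^ k"
  shows "in_ring n f"
  unfolding in_ring_def using assms by auto

lemma laurent_in_ring: "p \<in> laurent n \<Longrightarrow> in_ring n p"
  by (rule in_ringI[where k = 0]) auto

text \<open>The inverse of one factor of D is the product of the others divided by D; sums are put
  over a common power of D.\<close>

lemma ringS_in_ring:
  assumes "f \<in> ringS n S" and S: "S \<subseteq> upairs n"
  shows "in_ring n f"
  using assms(1)
proof (induction rule: ringS.induct)
  case (rden b a)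
  then have ba: "(b, a) \<in> upairs n" using S by blast
  let ?p = "\<lambda>z h. \<Prod>x\<in>upairs n - {(b, a)}. 1 - h * z (fst x) / z (snd x)"
  have "?p \<in> laurent n" by (rule laurent_prod) (auto intro: laurent_factor)
  moreover have "inverse (1 - h * z b / z a) = ?p z h / Dv n z h ^ 1" if g: "gdom n z h" for z h
  proof -
    have "Dv n z h = (1 - h * z b / z a) * ?p z h"
      unfolding Dv_upairs
      using prod.remove[OF finite_upairs ba, of "\<lambda>x. 1 - h * z (fst x) / z (snd x)"] by simp
    moreover have "Dv n z h \<noteq> 0" using g by (simp add: gdom_def)
    ultimately show ?thesis by (simp add: inverse_eq_divide)
  qed
  ultimately show ?case by (rule in_ringI)
next
  case (radd f g)
  then obtain p k q l where p: "p \<in> laurent n" "\<And>z h. gdom n z h \<Longrightarrow> f z h = p z h / Dv n z h ^ k"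
    and q: "q \<in> laurent n" "\<And>z h. gdom n z h \<Longrightarrow> g z h = q z h / Dv n z h ^ l"
    unfolding in_ring_def by blast
  have "(\<lambda>z h. p z h * Dv n z h ^ l + q z h * Dv n z h ^ k) \<in> laurent n"
    by (intro laurent.intros p(1) q(1) laurent_power Dv_laurent)
  moreover have "f z h + g z h = (p z h * Dv n z h ^ l + q z h * Dv n z h ^ k) / Dv n z h ^ (k + l)" if gd: "gdom n z h" for z h
  proof -
    have D: "Dv n z h \<noteq> 0" using gd by (simp add: gdom_def)
    have "(p z h * Dv n z h ^ l + q z h * Dv n z h ^ k) / Dv n z h ^ (k + l)
       = p z h * Dv n z h ^ l / (Dv n z h ^ k * Dv n z h ^ l) + q z h * Dv n z h ^ k / (Dv n z h ^ l * Dv n z h ^ k)"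
      by (simp add: power_add add_divide_distrib mult.commute)
    then show ?thesis using p(2)[OF gd] q(2)[OF gd] D by simp
  qed
  ultimately show ?case by (rule in_ringI)
next
  case (rmult f g)
  then obtain p k q l where p: "p \<in> laurent n" "\<And>z h. gdom n z h \<Longrightarrow> f z h = p z h / Dv n z h ^ k"
    and q: "q \<in> laurent n" "\<And>z h. gdom n z h \<Longrightarrow> g z h = q z h / Dv n z h ^ l"
    unfolding in_ring_def by blast
  have "(\<lambda>z h. p z h * q z h) \<in> laurent n" by (intro laurent.intros p(1) q(1))
  moreover have "f z h * g z h = p z h * q z h / Dv n z h ^ (k + l)" if gd: "gdom n z h" for z h
    using p(2)[OF gd] q(2)[OF gd] by (simp add: power_add)
  ultimately show ?case by (rule in_ringI)
qed (auto intro!: laurent_in_ring laurent.intros)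

section \<open>Limits along curves of generic points\<close>

lemma laurent_tendsto:
  assumes "p \<in> laurent n" and z: "\<And>a. a \<in> {1..n} \<Longrightarrow> ((\<lambda>e. zc e a) \<longlongrightarrow> z a) F" "\<And>a. a \<in> {1..n} \<Longrightarrow> z a \<noteq> 0"
    and h: "(hc \<longlongrightarrow> h) F" "h \<noteq> 0"
  shows "((\<lambda>e. p (zc e) (hc e)) \<longlongrightarrow> p z h) F"
  using assms(1) by (induction rule: laurent.induct) (use z h in \<open>auto intro!: tendsto_intros\<close>)

lemma in_ring_tendsto:
  assumes "in_ring n f" and g: "gdom n z h" and z: "\<And>a. a \<in> {1..n} \<Longrightarrow> ((\<lambda>e. zc e a) \<longlongrightarrow> z a) F"
    and h: "(hc \<longlongrightarrow> h) F" and ev: "\<forall>\<^sub>F e in F. gdom n (zc e) (hc e)"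
  shows "((\<lambda>e. f (zc e) (hc e)) \<longlongrightarrow> f z h) F"
proof -
  obtain p k where p: "p \<in> laurent n" "\<And>z h. gdom n z h \<Longrightarrow> f z h = p z h / Dv n z h ^ k"
    using assms(1) unfolding in_ring_def by blast
  have nz: "\<And>a. a \<in> {1..n} \<Longrightarrow> z a \<noteq> 0" "h \<noteq> 0" "Dv n z h \<noteq> 0" using g by (auto simp: gdom_def)
  have "((\<lambda>e. p (zc e) (hc e) / Dv n (zc e) (hc e) ^ k) \<longlongrightarrow> p z h / Dv n z h ^ k) F"
    by (intro tendsto_intros laurent_tendsto[OF p(1)] laurent_tendsto[OF Dv_laurent] z h nz) (use nz in auto)
  moreover have "\<forall>\<^sub>F e in F. p (zc e) (hc e) / Dv n (zc e) (hc e) ^ k = f (zc e) (hc e)"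
    using ev by eventually_elim (simp add: p(2))
  ultimately show ?thesis unfolding p(2)[OF g] by (rule Lim_transform_eventually)
qed

lemma eventually_poly_nonzero:
  fixes p :: "complex poly"
  assumes "p \<noteq> 0"
  shows "\<forall>\<^sub>F x in at 0. poly p x \<noteq> 0"
proof -
  let ?S = "- ({x. poly p x = 0} - {0})"
  have "open ?S" by (intro open_Compl finite_imp_closed finite_Diff poly_roots_finite assms)
  then show ?thesis unfolding eventually_at_topological by (intro exI[of _ ?S]) auto
qed

text \<open>The exponents are chosen so that none of the differences of coordinates, nor of their
  multiples by the deformed parameter, vanishes identically along the curve.\<close>

lemma eventually_gen:
  fixes z :: "nat \<Rightarrow> complex" and h :: complex
  assumes "\<And>a. a \<in> {1..n} \<Longrightarrow> z a \<noteq> 0" "h \<noteq> 0"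
  shows "\<forall>\<^sub>F e in at 0. gen n (\<lambda>a. z a + of_nat a * e) (h + e ^ 2)"
proof -
  have 1: "\<forall>\<^sub>F e in at 0. h + e ^ 2 \<noteq> 0"
    using eventually_poly_nonzero[of "[:h, 0, 1:]"] by (simp add: power2_eq_square)
  have "\<forall>\<^sub>F e in at 0. z a + of_nat a * e \<noteq> 0" if "a \<in> {1..n}" for a
    using eventually_poly_nonzero[of "[:z a, of_nat a:]"] assms(1)[OF that] by (simp add: mult.commute)
  then have 2: "\<forall>\<^sub>F e in at 0. \<forall>a\<in>{1..n}. z a + of_nat a * e \<noteq> 0"
    by (intro eventually_ball_finite) auto
  have "\<forall>\<^sub>F e in at 0. a \<noteq> b \<longrightarrow> z a + of_nat a * e \<noteq> z b + of_nat b * e" for a b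
  proof (cases "a = b")
    case False
    then have "[:z a - z b, of_nat a - of_nat b:] \<noteq> (0 :: complex poly)" by simp
    from eventually_poly_nonzero[OF this] show ?thesis
      by eventually_elim (auto simp: algebra_simps)
  qed simp
  then have 3: "\<forall>\<^sub>F e in at 0. \<forall>a\<in>{1..n}. \<forall>b\<in>{1..n}. a \<noteq> b \<longrightarrow> z a + of_nat a * e \<noteq> z b + of_nat b * e"
    by (intro eventually_ball_finite ballI finite_atLeastAtMost)
  have "\<forall>\<^sub>F e in at 0. z a + of_nat a * e \<noteq> (h + e ^ 2) * (z b + of_nat b * e)" if "b \<in> {1..n}" for a b
  proof -
    \<comment> \<open>The cubic coefficient -b is nonzero because b \<ge> 1; this covers a = b as
      well.\<close>
    have "[:z a - h * z b, of_nat a - h * of_nat b, - z b, - of_nat b:] \<noteq> (0 :: complex poly)" using that by simp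
    from eventually_poly_nonzero[OF this] show ?thesis
      by eventually_elim (auto simp: algebra_simps power2_eq_square)
  qed
  then have 4: "\<forall>\<^sub>F e in at 0. \<forall>a\<in>{1..n}. \<forall>b\<in>{1..n}. z a + of_nat a * e \<noteq> (h + e ^ 2) * (z b + of_nat b * e)"
    by (intro eventually_ball_finite ballI finite_atLeastAtMost)
  show ?thesis using 1 2 3 4
  proof eventually_elim
    case (elim e)
    then show ?case unfolding gen_def inj_on_def by blast
  qed
qed

lemma curve_tendsto:
  "((\<lambda>e. z a + of_nat a * e) \<longlongrightarrow> z a) (at (0::complex))" "((\<lambda>e. h + e ^ 2) \<longlongrightarrow> h) (at (0::complex))"
proof -
  have "((\<lambda>e. z a + of_nat a * e) \<longlongrightarrow> z a + of_nat a * 0) (at (0::complex))" by (intro tendsto_intros)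
  then show "((\<lambda>e. z a + of_nat a * e) \<longlongrightarrow> z a) (at (0::complex))" by simp
  have "((\<lambda>e. h + e ^ 2) \<longlongrightarrow> h + 0 ^ 2) (at (0::complex))" by (intro tendsto_intros)
  then show "((\<lambda>e. h + e ^ 2) \<longlongrightarrow> h) (at (0::complex))" by simp
qed

lemma lvl_tendsto:
  assumes "(H \<longlongrightarrow> H0) F" "\<And>a. a \<in> {1..m} \<Longrightarrow> ((\<lambda>e. f e a) \<longlongrightarrow> f0 a) F" "\<And>c. c \<in> {1..m'} \<Longrightarrow> ((\<lambda>e. u e c) \<longlongrightarrow> u0 c) F"
    "\<And>a. a \<in> {1..m} \<Longrightarrow> f0 a \<noteq> 0" "inj_on f0 {1..m}"
  shows "((\<lambda>e. lvl m m' p q (H e) (f e) (u e)) \<longlongrightarrow> lvl m m' p q H0 f0 u0) F"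
proof -
  have nz: "f0 a \<noteq> 0" "1 - f0 b / f0 a \<noteq> 0" if "a \<in> {1..m}" "b \<in> {a<..m}" for a b
    using assms(4)[OF that(1)] inj_onD[OF assms(5), of a b] that by auto
  show ?thesis unfolding lvl_def
    by (intro tendsto_intros assms(1)) (use assms nz in auto)
qed

text \<open>Only variables of levels below N occur in denominators, so distinctness and nonvanishing
  in the limit are required there alone.\<close>

lemma Psi_tendsto:
  assumes "(H \<longlongrightarrow> H0) F" "\<And>k a. k < N \<Longrightarrow> a \<in> {1..lcum lam k} \<Longrightarrow> ((\<lambda>e. t e k a) \<longlongrightarrow> t0 k a) F"
    "\<And>k a. k < N \<Longrightarrow> a \<in> {1..lcum lam k} \<Longrightarrow> t0 k a \<noteq> 0" "\<And>k. k < N \<Longrightarrow> inj_on (t0 k) {1..lcum lam k}"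
  shows "k \<le> N \<Longrightarrow> (\<And>c. c \<in> {1..lcum lam k} \<Longrightarrow> ((\<lambda>e. u e c) \<longlongrightarrow> u0 c) F) \<Longrightarrow>
    ((\<lambda>e. Psi lam I (H e) (t e) k (u e)) \<longlongrightarrow> Psi lam I H0 t0 k u0) F"
proof (induction k arbitrary: u u0)
  case (Suc k)
  have kN: "k < N" using Suc.prems by simp
  show ?case unfolding Psi.simps
  proof (intro tendsto_sum tendsto_mult)
    fix \<sigma> assume "\<sigma> \<in> {\<sigma>. \<sigma> permutes {1..lcum lam k}}"
    then have \<sigma>: "\<sigma> permutes {1..lcum lam k}" by simp
    have t: "((\<lambda>e. (t e k \<circ> \<sigma>) c) \<longlongrightarrow> (t0 k \<circ> \<sigma>) c) F" if "c \<in> {1..lcum lam k}" for c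
      using assms(2)[OF kN, of "\<sigma> c"] permutes_in_image[OF \<sigma>] that by (simp add: comp_def)
    show "((\<lambda>e. Psi lam I (H e) (t e) k (t e k \<circ> \<sigma>)) \<longlongrightarrow> Psi lam I H0 t0 k (t0 k \<circ> \<sigma>)) F"
      by (rule Suc.IH) (use Suc.prems t in auto)
    show "((\<lambda>e. lvl (lcum lam k) (lcum lam (Suc k)) (ix I k) (ix I (Suc k)) (H e) (t e k \<circ> \<sigma>) (u e)) \<longlongrightarrow>
       lvl (lcum lam k) (lcum lam (Suc k)) (ix I k) (ix I (Suc k)) H0 (t0 k \<circ> \<sigma>) u0) F"
    proof (rule lvl_tendsto[OF assms(1)])
      show "inj_on (t0 k \<circ> \<sigma>) {1..lcum lam k}"
        by (rule comp_inj_on) (use permutes_inj_on[OF \<sigma>] permutes_image[OF \<sigma>] assms(4)[OF kN] in auto)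
      show "(t0 k \<circ> \<sigma>) a \<noteq> 0" if "a \<in> {1..lcum lam k}" for a
        using assms(3)[OF kN, of "\<sigma> a"] permutes_in_image[OF \<sigma>] that by simp
    qed (use t Suc.prems in auto)
  qed
qed simp

text \<open>Continuity at every point of \<open>xgen\<close> carries the formula from generic points
  to its whole stated domain.\<close>

lemma Xformula_tendsto:
  assumes N: "N \<ge> 1" and I: "I \<in> ordparts lam N" and J: "J \<in> ordparts lam N" and g: "xgen lam N I z h"
    and zc: "\<And>a. a \<in> {1..lcum lam N} \<Longrightarrow> ((\<lambda>e. zc e a) \<longlongrightarrow> z a) F" and hc: "(hc \<longlongrightarrow> h) F"
  shows "((\<lambda>e. Xformula lam N I J (zc e) (hc e)) \<longlongrightarrow> Xformula lam N I J z h) F"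
proof -
  let ?n = "lcum lam N"
  have nz: "h \<noteq> 0" "inj_on z {1..?n}" "\<And>a. a \<in> {1..?n} \<Longrightarrow> z a \<noteq> 0" "Qf N I z h \<noteq> 0"
    "Ef lam N (tsub I (\<lambda>a. inverse (z a))) (inverse h) \<noteq> 0"
    using g unfolding xgen_def gdom_def by blast+
  have zi: "((\<lambda>e. inverse (zc e a)) \<longlongrightarrow> inverse (z a)) F" if "a \<in> {1..?n}" for a
    using zc[OF that] nz(3)[OF that] by (rule tendsto_inverse)
  have hi: "((\<lambda>e. inverse (hc e)) \<longlongrightarrow> inverse h) F" using hc nz(1) by (rule tendsto_inverse)
  have pos: "ix I k a \<in> {1..?n}" if "k < N" "a \<in> {1..lcum lam k}" for k a
    using ix_mem[OF I less_imp_le[OF that(1)] that(2)] cum_iff_col[OF I] by blast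
  have part: "a \<in> {1..?n}" if "a \<in> I k" for a k using ordpartsD(3)[OF I] that by blast
  have t: "((\<lambda>e. tsub I (\<lambda>a. inverse (zc e a)) k a) \<longlongrightarrow> tsub I (\<lambda>a. inverse (z a)) k a) F"
    "tsub I (\<lambda>a. inverse (z a)) k a \<noteq> 0" if "k < N" "a \<in> {1..lcum lam k}" for k a
    using zi[OF pos[OF that]] nz(3)[OF pos[OF that]] by (simp_all add: tsub_def)
  have inj: "inj_on (tsub I (\<lambda>a. inverse (z a)) k) {1..lcum lam k}" if k: "k < N" for k
  proof (rule inj_onI)
    fix a b assume ab: "a \<in> {1..lcum lam k}" "b \<in> {1..lcum lam k}" "tsub I (\<lambda>a. inverse (z a)) k a = tsub I (\<lambda>a. inverse (z a)) k b"
    then have "ix I k a = ix I k b"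
      using inj_onD[OF nz(2) _ pos[OF k ab(1)] pos[OF k ab(2)]] by (simp add: tsub_def)
    then show "a = b" using inj_onD[OF ix_inj[OF I less_imp_le[OF k]]] ab(1,2) by blast
  qed
  have "((\<lambda>e. Psi lam (rpart ?n J) (inverse (hc e)) (tsub I (\<lambda>a. inverse (zc e a))) N ((\<lambda>a. inverse (zc e a)) \<circ> sigma0 ?n))
    \<longlongrightarrow> Psi lam (rpart ?n J) (inverse h) (tsub I (\<lambda>a. inverse (z a))) N ((\<lambda>a. inverse (z a)) \<circ> sigma0 ?n)) F"
  proof (rule Psi_tendsto[where N = N])
    show "((\<lambda>e. ((\<lambda>a. inverse (zc e a)) \<circ> sigma0 ?n) c) \<longlongrightarrow> ((\<lambda>a. inverse (z a)) \<circ> sigma0 ?n) c) F" if "c \<in> {1..?n}" for c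
      using zi[of "sigma0 ?n c"] sigma0_interval[of ?n c] that by simp
  qed (use hi t inj in auto)
  moreover have "((\<lambda>e. Pf N I (zc e)) \<longlongrightarrow> Pf N I z) F"
    unfolding Pf_def by (intro tendsto_intros) (use zc nz part in auto)
  moreover have "((\<lambda>e. Qf N I (zc e) (hc e)) \<longlongrightarrow> Qf N I z h) F"
    unfolding Qf_def by (intro tendsto_intros hc) (use zc nz part in auto)
  moreover have "((\<lambda>e. Ef lam N (tsub I (\<lambda>a. inverse (zc e a))) (inverse (hc e))) \<longlongrightarrow> Ef lam N (tsub I (\<lambda>a. inverse (z a))) (inverse h)) F"
    unfolding Ef_def by (intro tendsto_intros hi) (use t in auto)
  ultimately show ?thesis
    unfolding Xformula_Psi[OF N J] Kf_def
    by (intro tendsto_intros hc hi) (use nz in auto)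
qed

section \<open>The order and the action on words\<close>

text \<open>Counting functions describe the order without enumerations, and an exchange at i alters
  them only at x = i.\<close>

definition cnt :: "nat set \<Rightarrow> nat \<Rightarrow> nat" where
  "cnt A x = card {y \<in> A. y \<le> x}"

lemma cnt_Suc: "finite A \<Longrightarrow> cnt A (Suc x) = cnt A x + (if Suc x \<in> A then 1 else 0)"
proof -
  assume "finite A"
  moreover have "{y \<in> A. y \<le> Suc x} = (if Suc x \<in> A then insert (Suc x) {y \<in> A. y \<le> x} else {y \<in> A. y \<le> x})"
    by (auto simp: le_Suc_eq)
  ultimately show ?thesis by (simp add: cnt_def)
qed

lemma cnt_sw:
  assumes "x \<noteq> i"
  shows "cnt (sw i (i+1) ` A) x = cnt A x"
proof -
  have "sw i (i+1) y \<le> x \<longleftrightarrow> y \<le> x" for y using assms by (auto simp: sw_def)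
  then have "{y \<in> sw i (i+1) ` A. y \<le> x} = sw i (i+1) ` {y \<in> A. y \<le> x}" by auto
  then show ?thesis unfolding cnt_def by (simp add: card_image[OF inj_on_subset[OF inj_sw subset_UNIV]])
qed

text \<open>Enumeration and counting function are adjoint, so inequalities between enumerations
  become reversed inequalities between counts.\<close>

lemma ix_le_iff_cnt:
  assumes I: "I \<in> ordparts lam N" and k: "k \<le> N" and a: "a \<in> {1..lcum lam k}"
  shows "ix I k a \<le> x \<longleftrightarrow> a \<le> cnt (cum I k) x"
proof -
  let ?m = "lcum lam k"
  let ?S = "{a \<in> {1..?m}. ix I k a \<le> x}"
  have mono: "ix I k a \<le> ix I k b" if "1 \<le> a" "a \<le> b" "b \<le> ?m" for a b
    using ix_strict_mono[OF I k that(1), of b] that by (cases "a = b") auto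
  have "{y \<in> cum I k. y \<le> x} = ix I k ` ?S"
    unfolding bij_betw_imp_surj_on[OF ix_bij[OF I k], symmetric] by auto
  then have c: "cnt (cum I k) x = card ?S"
    unfolding cnt_def by (simp only:) (rule card_image, rule inj_on_subset[OF ix_inj[OF I k]], auto)
  show ?thesis
  proof
    assume le: "ix I k a \<le> x"
    have "ix I k b \<le> x" if "b \<in> {1..a}" for b using mono[of b a] le a that by auto
    then have "{1..a} \<subseteq> ?S" using a by auto
    then have "card {1..a} \<le> card ?S" by (intro card_mono) auto
    then show "a \<le> cnt (cum I k) x" unfolding c by simp
  next
    assume le: "a \<le> cnt (cum I k) x"
    show "ix I k a \<le> x"
    proof (rule ccontr)
      assume gt: "\<not> ix I k a \<le> x"
      have "?S \<subseteq> {1..<a}"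
      proof
        fix b assume b: "b \<in> ?S"
        show "b \<in> {1..<a}" using b gt mono[of a b] a by (cases "b < a") auto
      qed
      then have "card ?S \<le> card {1..<a}" by (intro card_mono) auto
      then show False using le a unfolding c by auto
    qed
  qed
qed

lemma leid_cnt:
  assumes I: "I \<in> ordparts lam N" and J: "J \<in> ordparts lam N"
  shows "leid lam N J I \<longleftrightarrow> (\<forall>k\<in>{1..<N}. \<forall>x. cnt (cum I k) x \<le> cnt (cum J k) x)"
proof
  assume l: "leid lam N J I"
  show "\<forall>k\<in>{1..<N}. \<forall>x. cnt (cum I k) x \<le> cnt (cum J k) x"
  proof (intro ballI allI)
    fix k x assume k: "k \<in> {1..<N}"
    then have kN: "k \<le> N" by simp
    let ?c = "cnt (cum I k) x"
    have "?c \<le> lcum lam k"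
      unfolding cnt_def card_cum[OF I kN, symmetric] by (intro card_mono finite_cum[OF I]) auto
    then show "?c \<le> cnt (cum J k) x"
    proof (cases "?c = 0")
      case False
      then have c: "?c \<in> {1..lcum lam k}" using \<open>?c \<le> lcum lam k\<close> by simp
      have "ix I k ?c \<le> x" using ix_le_iff_cnt[OF I kN c] by simp
      moreover have "ix J k ?c \<le> ix I k ?c" using l k c unfolding leid_def by blast
      ultimately show ?thesis using ix_le_iff_cnt[OF J kN c, of x] by simp
    qed simp
  qed
next
  assume c: "\<forall>k\<in>{1..<N}. \<forall>x. cnt (cum I k) x \<le> cnt (cum J k) x"
  show "leid lam N J I" unfolding leid_def
  proof (intro ballI)
    fix k a assume k: "k \<in> {1..<N}" and a: "a \<in> {1..lcum lam k}"
    then have kN: "k \<le> N" by simp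
    have "a \<le> cnt (cum I k) (ix I k a)" using ix_le_iff_cnt[OF I kN a] by blast
    also have "\<dots> \<le> cnt (cum J k) (ix I k a)" using c k by blast
    finally show "ix J k a \<le> ix I k a" using ix_le_iff_cnt[OF J kN a] by blast
  qed
qed

lemma leid_refl: "leid lam N I I"
  by (simp add: leid_def)

lemma cnt_at_swap:
  assumes "finite A" "1 \<le> i"
  shows "cnt A i = cnt A (i-1) + (if i \<in> A then 1 else 0)" "cnt A (i+1) = cnt A i + (if i+1 \<in> A then 1 else 0)"
    "cnt (sw i (i+1) ` A) i = cnt A (i-1) + (if i+1 \<in> A then 1 else 0)"
proof -
  obtain j where j: "i = Suc j" using assms(2) by (cases i) auto
  show "cnt A i = cnt A (i-1) + (if i \<in> A then 1 else 0)" using cnt_Suc[OF assms(1), of j] j by simp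
  show "cnt A (i+1) = cnt A i + (if i+1 \<in> A then 1 else 0)" using cnt_Suc[OF assms(1), of i] by simp
  have m: "i \<in> sw i (i+1) ` A \<longleftrightarrow> i+1 \<in> A"
    using inj_image_mem_iff[OF inj_sw[of i "i+1"], of "i+1" A] by simp
  have "cnt (sw i (i+1) ` A) i = cnt (sw i (i+1) ` A) (i-1) + (if i \<in> sw i (i+1) ` A then 1 else 0)"
    using cnt_Suc[OF finite_imageI[OF assms(1)], of "sw i (i+1)" j] j by simp
  then show "cnt (sw i (i+1) ` A) i = cnt A (i-1) + (if i+1 \<in> A then 1 else 0)"
    using cnt_sw[of "i-1" i A] assms(2) m by simp
qed

text \<open>The lifting property of a Bruhat-type order, in the form needed for triangularity: an
  ascent of I dominates J as soon as I dominates J or its exchange.\<close>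

lemma leid_s_part:
  assumes I: "I \<in> ordparts lam N" and J: "J \<in> ordparts lam N" and i: "i \<in> {1..<lcum lam N}"
    and c: "col I i < col I (i+1)" and l: "leid lam N J I \<or> leid lam N (s_part i J) I"
  shows "leid lam N J (s_part i I)"
  unfolding leid_cnt[OF s_part_mem[OF I i] J] cum_s_part
proof (intro ballI allI)
  fix k x assume k: "k \<in> {1..<N}"
  have i1: "1 \<le> i" using i by simp
  let ?A = "cum I k" and ?B = "cum J k"
  note A = cnt_at_swap[OF finite_cum[OF I] i1, of k] and B = cnt_at_swap[OF finite_cum[OF J] i1, of k]
  \<comment> \<open>This is where the ascent enters: the lower colour i joins the cumulative sets no
    later than i+1.\<close>
  have AA: "i + 1 \<in> ?A \<Longrightarrow> i \<in> ?A" using cum_iff_col[OF I] c i by auto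
  have l': "(\<forall>x. cnt ?A x \<le> cnt ?B x) \<or> (\<forall>x. cnt ?A x \<le> cnt (sw i (i+1) ` ?B) x)"
    using l k unfolding leid_cnt[OF I J] leid_cnt[OF I s_part_mem[OF J i]] cum_s_part by blast
  show "cnt (sw i (i+1) ` ?A) x \<le> cnt ?B x"
  proof (cases "x = i")
    case False
    then show ?thesis using l' cnt_sw[OF False] by metis
  next
    case True
    from l' show ?thesis
    proof
      assume "\<forall>x. cnt ?A x \<le> cnt ?B x"
      from this[rule_format, of i] show ?thesis using A B AA True by (auto split: if_splits)
    next
      assume h: "\<forall>x. cnt ?A x \<le> cnt (sw i (i+1) ` ?B) x"
      \<comment> \<open>At i - 1 and i + 1 the exchange leaves the counts unchanged; these two
        inequalities determine the one at i.\<close>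
      have "cnt ?A (i-1) \<le> cnt ?B (i-1)" using h[rule_format, of "i-1"] cnt_sw[of "i-1" i ?B] i1 by simp
      moreover have "cnt ?A (i+1) \<le> cnt ?B (i+1)" using h[rule_format, of "i+1"] cnt_sw[of "i+1" i ?B] by simp
      ultimately show ?thesis using A B AA True by (auto split: if_splits)
    qed
  qed
qed

text \<open>At level \<open>col I i\<close> the cumulative set contains i but not i+1, so the count
  at i drops. Hence the word of \<open>s_part i I\<close> is absent from the vector of I.\<close>

lemma not_leid_s_part:
  assumes I: "I \<in> ordparts lam N" and i: "i \<in> {1..<lcum lam N}" and c: "col I i < col I (i+1)"
  shows "\<not> leid lam N (s_part i I) I"
proof
  assume l: "leid lam N (s_part i I) I"
  let ?k = "col I i"
  have k: "?k \<in> {1..<N}" using col_range[OF I, of i] col_range[OF I, of "i+1"] i c by auto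
  have "i \<in> cum I ?k" "i+1 \<notin> cum I ?k" using cum_iff_col[OF I] i c by auto
  moreover have "cnt (cum I ?k) i \<le> cnt (sw i (i+1) ` cum I ?k) i"
    using l k unfolding leid_cnt[OF I s_part_mem[OF I i]] cum_s_part by blast
  ultimately show False using cnt_at_swap[OF finite_cum[OF I], of i ?k] i by simp
qed

text \<open>Weakly increasing colours make every cumulative set an initial segment, determined by
  its size.\<close>

lemma Imin_if_no_descent:
  assumes I: "I \<in> ordparts lam N" and d: "\<And>i. i \<in> {1..<lcum lam N} \<Longrightarrow> col I i \<le> col I (i+1)"
  shows "I = Imin lam N"
proof (rule ordparts_eq_cumI[OF I Imin_mem])
  fix k assume k: "k \<le> N"
  have mono: "col I a \<le> col I b" if "1 \<le> a" "a \<le> b" "b \<le> lcum lam N" for a b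
    using that(2,3)
  proof (induction b rule: dec_induct)
    case (step b)
    then show ?case using d[of b] that(1) by auto
  qed simp
  have "cum I k \<subseteq> {1..lcum lam k}"
  proof
    fix j assume j: "j \<in> cum I k"
    have "b \<in> cum I k" if "b \<in> {1..j}" for b
      using mono[of b j] that j cum_iff_col[OF I, of j k] cum_iff_col[OF I, of b k] by auto
    then have "{1..j} \<subseteq> cum I k" by blast
    then have "card {1..j} \<le> card (cum I k)" by (intro card_mono finite_cum[OF I])
    then show "j \<in> {1..lcum lam k}" using card_cum[OF I k] j cum_iff_col[OF I] by auto
  qed
  then have "cum I k = {1..lcum lam k}"
    using card_cum[OF I k] by (intro card_subset_eq) auto
  then show "cum I k = cum (Imin lam N) k" using cum_Imin[OF k, of lam] by simp
qed

text \<open>Induction on the number of inversions: any I other than \<open>Imin\<close> has a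
  descent, and undoing it removes one inversion.\<close>

lemma ordparts_induct [consumes 1, case_names Imin step]:
  assumes I: "I \<in> ordparts lam N" and base: "P (Imin lam N)"
    and step: "\<And>I i. I \<in> ordparts lam N \<Longrightarrow> i \<in> {1..<lcum lam N} \<Longrightarrow> col I i < col I (i+1) \<Longrightarrow> P I \<Longrightarrow> P (s_part i I)"
  shows "P I"
  using I
proof (induction "card (linv (lcum lam N) I)" arbitrary: I rule: less_induct)
  case less
  show ?case
  proof (cases "\<exists>i\<in>{1..<lcum lam N}. col I (i+1) < col I i")
    case False
    then have "I = Imin lam N" by (intro Imin_if_no_descent[OF less.prems]) (auto simp: not_less)
    then show ?thesis using base by simp
  next
    case True
    then obtain i where i: "i \<in> {1..<lcum lam N}" "col I (i+1) < col I i" by blast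
    have mem: "s_part i I \<in> ordparts lam N" by (rule s_part_mem[OF less.prems i(1)])
    have c: "col (s_part i I) i < col (s_part i I) (i+1)" using i(2) by (simp add: col_s_part)
    have "card (linv (lcum lam N) (s_part i (s_part i I))) = Suc (card (linv (lcum lam N) (s_part i I)))"
      by (rule card_linv_s_part[OF i(1) c])
    then have "P (s_part i I)" by (intro less.hyps mem) simp
    from step[OF mem i(1) c this] show ?thesis by simp
  qed
qed

section \<open>Words and the two-term form of the R-matrix action\<close>

definition wswap :: "nat \<Rightarrow> nat list \<Rightarrow> nat list" where
  "wswap i w = w[i - 1 := w ! i, i := w ! (i - 1)]"

lemma wswap_words: "w \<in> words n N \<Longrightarrow> i \<in> {1..<n} \<Longrightarrow> wswap i w \<in> words n N"
  unfolding words_def wswap_def using set_update_subset_insert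
  by (auto intro!: subsetD[OF set_update_subsetI, of _ "{1..N}"])

lemma wswap_wswap: "w \<in> words n N \<Longrightarrow> i \<in> {1..<n} \<Longrightarrow> wswap i (wswap i w) = w"
  unfolding words_def wswap_def by (auto intro!: nth_equalityI simp: nth_list_update)

lemma wordof_col: "wordof n J = map (col J) [1..<n+1]"
  unfolding wordof_def col_def ..

lemma wordof_nth:
  assumes "i \<in> {1..<n}"
  shows "wordof n J ! (i - 1) = col J i" "wordof n J ! i = col J (i+1)"
proof -
  have "i - 1 < length [1..<n+1]" "i < length [1..<n+1]" using assms by auto
  then show "wordof n J ! (i - 1) = col J i" "wordof n J ! i = col J (i+1)"
    unfolding wordof_col using assms by (auto simp del: upt_Suc)
qed

lemma wordof_words: "J \<in> ordparts lam N \<Longrightarrow> wordof (lcum lam N) J \<in> words (lcum lam N) N"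
  unfolding words_def wordof_col using col_range[of J lam N] by (auto simp: atLeastLessThanSuc_atLeastAtMost simp del: upt_Suc)

lemma wordof_inj:
  assumes "I \<in> ordparts lam N" "J \<in> ordparts lam N" "wordof (lcum lam N) I = wordof (lcum lam N) J"
  shows "I = J"
proof (rule ordparts_eqI[OF assms(1,2)])
  fix j assume "j \<in> {1..lcum lam N}"
  then have "j \<in> set [1..<lcum lam N + 1]" by auto
  then show "col I j = col J j" using assms(3) unfolding wordof_col by (auto simp: map_eq_conv simp del: upt_Suc)
qed

lemma wordof_s_part:
  assumes "i \<in> {1..<n}"
  shows "wordof n (s_part i J) = wswap i (wordof n J)"
proof (rule nth_equalityI)
  show "length (wordof n (s_part i J)) = length (wswap i (wordof n J))" by (simp add: wordof_col wswap_def del: upt_Suc)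
  fix j assume "j < length (wordof n (s_part i J))"
  then have j: "j < n" by (simp add: wordof_col del: upt_Suc)
  have nth: "wordof n J' ! j = col J' (Suc j)" if "j < n" for j J' using that by (simp add: wordof_col del: upt_Suc)
  have i: "i - 1 < n" "i < n" "Suc (i - 1) = i" using assms by auto
  show "wordof n (s_part i J) ! j = wswap i (wordof n J) ! j"
    unfolding nth[OF j] wswap_def col_s_part using j i nth
    by (auto simp: nth_list_update sw_def wordof_col simp del: upt_Suc)
qed

lemma Rent_eq_0:
  assumes "(a, b) \<noteq> (c, d)" "(a, b) \<noteq> (d, c)"
  shows "Rent x h c d a b = 0"
proof -
  have n: "(c = a \<and> d = b) = False" "(c = b \<and> d = a) = False" using assms by blast+
  show ?thesis
  proof (cases "a = b")
    case True
    then have "(c = a \<and> d = a) = False" using n by blast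
    then show ?thesis unfolding Rent_def using True by (simp only: if_True if_False if_cancel)
  next
    case False
    then show ?thesis unfolding Rent_def n by (simp only: if_False if_cancel)
  qed
qed

text \<open>R preserves the unordered pair of letters, so at most two terms of the double sum
  survive. Because of P, the output letters are read in the order \<open>w ! i\<close>,
  \<open>w ! (i - 1)\<close>.\<close>

lemma ts_expand:
  assumes w: "w \<in> words n N" and i: "i \<in> {1..<n}"
  defines "a \<equiv> w ! (i - 1)" and "b \<equiv> w ! i"
  shows "ts n N i f w z h =
    (let x = z i / z (i+1); g = (\<lambda>u. f u (z \<circ> sw i (i+1)) h) in
     if a = b then g w
     else if a < b then (1 - h) * x / (1 - h * x) * g w + h * (1 - x) / (1 - h * x) * g (wswap i w)
     else (1 - h) / (1 - h * x) * g w + (1 - x) / (1 - h * x) * g (wswap i w))"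
proof -
  let ?x = "z i / z (i+1)"
  let ?F = "\<lambda>p. Rent ?x h b a (fst p) (snd p) * f (w[i - 1 := fst p, i := snd p]) (z \<circ> sw i (i+1)) h"
  have len: "i - 1 < length w" "i < length w" "i - 1 \<noteq> i" using w i by (auto simp: words_def)
  have mem: "a \<in> {1..N}" "b \<in> {1..N}" using w nth_mem[OF len(1)] nth_mem[OF len(2)] unfolding words_def a_def b_def by blast+
  have id: "w[i - 1 := a, i := b] = w" unfolding a_def b_def using len by (simp add: list_update_swap)
  have ws: "wswap i w = w[i - 1 := b, i := a]" by (simp add: wswap_def a_def b_def)
  have "ts n N i f w z h = sum ?F ({1..N} \<times> {1..N})"
    using w unfolding ts_def a_def b_def by (simp add: sum.cartesian_product split_def)
  also have "\<dots> = sum ?F {(a, b), (b, a)}"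
  proof (rule sum.mono_neutral_right)
    show "\<forall>p\<in>{1..N} \<times> {1..N} - {(a, b), (b, a)}. ?F p = 0"
    proof
      fix p assume "p \<in> {1..N} \<times> {1..N} - {(a, b), (b, a)}"
      then have "Rent ?x h b a (fst p) (snd p) = 0" by (intro Rent_eq_0) (auto simp: prod_eq_iff)
      then show "?F p = 0" by simp
    qed
  qed (use mem in auto)
  finally have s: "ts n N i f w z h = sum ?F {(a, b), (b, a)}" .
  show ?thesis
  proof (cases "a = b")
    case True
    then show ?thesis unfolding s using id by (simp add: Rent_def Let_def)
  next
    case False
    have "sum ?F {(a, b), (b, a)} = Rent ?x h b a a b * f w (z \<circ> sw i (i+1)) h + Rent ?x h b a b a * f (wswap i w) (z \<circ> sw i (i+1)) h"
      using False id ws by simp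
    moreover have "Rent ?x h b a a b = (if a < b then (1 - h) * ?x / (1 - h * ?x) else (1 - h) / (1 - h * ?x))"
      "Rent ?x h b a b a = (if a < b then h * (1 - ?x) / (1 - h * ?x) else (1 - ?x) / (1 - h * ?x))"
      using False unfolding Rent_def by simp_all
    ultimately show ?thesis unfolding s Let_def using False by simp
  qed
qed

section \<open>Construction of the vectors\<close>

text \<open>If i is a descent of J, the exchange relation is this recursion after division by
  z_{i+1}. If i is an ascent, the relation is available only at \<open>s_part i J\<close> and has to
  be used twice.\<close>

lemma ts_Xformula:
  assumes N: "N \<ge> 1" and I: "I \<in> ordparts lam N" and J: "J \<in> ordparts lam N" and i: "i \<in> {1..<lcum lam N}"
    and g: "gen (lcum lam N) z h"
    and f: "\<And>J'. J' \<in> ordparts lam N \<Longrightarrow> f (wordof (lcum lam N) J') (z \<circ> sw i (i+1)) h = Xformula lam N I J' (z \<circ> sw i (i+1)) h"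
  shows "ts (lcum lam N) N i f (wordof (lcum lam N) J) z h = Xformula lam N (s_part i I) J z h"
proof -
  let ?n = "lcum lam N" and ?zs = "z \<circ> sw i (i+1)" and ?J1 = "s_part i J"
  have J1: "?J1 \<in> ordparts lam N" by (rule s_part_mem[OF J i])
  have I1: "s_part i I \<in> ordparts lam N" by (rule s_part_mem[OF I i])
  have "i \<in> {1..?n}" "i+1 \<in> {1..?n}" using i by auto
  then have nz: "z (i+1) \<noteq> 0" "z (i+1) \<noteq> h * z i" "z i \<noteq> z (i+1)"
    using g inj_onD[of z "{1..?n}" i "i+1"] unfolding gen_def by (metis, metis, metis n_not_Suc_n Suc_eq_plus1)
  define x where "x = z i / z (i+1)"
  have zi: "z i = x * z (i+1)" using nz by (simp add: x_def)
  have x: "1 - h * x \<noteq> 0" "1 - x \<noteq> 0" using nz by (auto simp: x_def field_simps)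
  define X where "X = Xformula lam N (s_part i I) J z h"
  define A where "A = Xformula lam N I J ?zs h"
  define B where "B = Xformula lam N I ?J1 ?zs h"
  note ts = ts_expand[OF wordof_words[OF J] i, of f z h, unfolded wordof_nth[OF i] wordof_s_part[OF i, symmetric] f[OF J] f[OF J1] Let_def,
      folded A_def B_def x_def]
  consider "col J i = col J (i+1)" | "col J (i+1) < col J i" | "col J i < col J (i+1)" by linarith
  then have "ts ?n N i f (wordof ?n J) z h = X"
  proof cases
    case 1
    then show ?thesis using ts Xformula_exchange(1)[OF N I J i g] by (simp add: X_def A_def)
  next
    case 2
    have "(z i - z (i+1)) * B = (h * z i - z (i+1)) * X + (1 - h) * z (i+1) * A"
      unfolding X_def A_def B_def by (rule Xformula_exchange(2)[OF N I J i g]) (use 2 in auto)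
    then have "z (i+1) * ((1 - h * x) * X) = z (i+1) * ((1 - h) * A + (1 - x) * B)"
      unfolding zi by (simp add: algebra_simps)
    then have "(1 - h * x) * X = (1 - h) * A + (1 - x) * B" using nz(1) by (metis mult_left_cancel)
    then have "X = ((1 - h) * A + (1 - x) * B) / (1 - h * x)" using x(1) by (metis nonzero_mult_div_cancel_left)
    then show ?thesis using ts 2 by (simp add: add_divide_distrib)
  next
    case 3
    \<comment> \<open>\<open>Y\<close> is auxiliary: it occurs in the relation for I at z and in the
      one for \<open>s_part i I\<close> at the exchanged variables, and eliminating it leaves the
      required formula for \<open>X\<close>.\<close>
    define Y where "Y = Xformula lam N (s_part i I) ?J1 z h"
    have c: "col ?J1 (i+1) < col ?J1 i" using 3 by (simp add: col_s_part)
    have zz: "?zs \<circ> sw i (i+1) = z" by (simp add: fun_eq_iff)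
    have e1: "(z i - z (i+1)) * A = (h * z i - z (i+1)) * Y + (1 - h) * z (i+1) * B"
      using Xformula_exchange(2)[OF N I J1 i g] c unfolding A_def B_def Y_def by simp
    have e2: "(z (i+1) - z i) * X = (h * z (i+1) - z i) * B + (1 - h) * z i * Y"
      using Xformula_exchange(2)[OF N I1 J1 i gen_sw[OF g i]] c unfolding B_def X_def Y_def zz by simp
    have f1: "(x - 1) * A = (h * x - 1) * Y + (1 - h) * B"
    proof -
      have "z (i+1) * ((x - 1) * A) = z (i+1) * ((h * x - 1) * Y + (1 - h) * B)" using e1 unfolding zi by (simp add: algebra_simps)
      then show ?thesis using nz by simp
    qed
    have f2: "(1 - x) * X = (h - x) * B + (1 - h) * x * Y"
    proof -
      have "z (i+1) * ((1 - x) * X) = z (i+1) * ((h - x) * B + (1 - h) * x * Y)" using e2 unfolding zi by (simp add: algebra_simps)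
      then show ?thesis using nz by simp
    qed
    have "(1 - x) * ((1 - h * x) * X) = (1 - x) * ((1 - h) * x * A + h * (1 - x) * B)"
      using f1 f2 by algebra
    then have "(1 - h * x) * X = (1 - h) * x * A + h * (1 - x) * B" using x(2) by simp
    then have "X = ((1 - h) * x * A + h * (1 - x) * B) / (1 - h * x)" using x(1) by (metis nonzero_mult_div_cancel_left)
    then show ?thesis using ts 3 by (simp add: add_divide_distrib)
  qed
  then show ?thesis by (simp add: X_def)
qed

lemma linv_upairs: "linv n I \<subseteq> upairs n"
  by (auto simp: linv_def upairs_def)

text \<open>The invariant carried along ascents. Ring membership, support and diagonal hold as
  identities of functions, so they survive K_i at every point; the formula is claimed only on
  \<open>gen\<close>, which K_i preserves.\<close>

definition xi_spec :: "(nat \<Rightarrow> nat) \<Rightarrow> nat \<Rightarrow> opart \<Rightarrow> tvec \<Rightarrow> bool" where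
  "xi_spec lam N I f \<longleftrightarrow> (\<forall>w. f w \<in> ringS (lcum lam N) (linv (lcum lam N) I))
    \<and> (\<forall>w. w \<notin> words (lcum lam N) N \<longrightarrow> f w = (\<lambda>z h. 0))
    \<and> (\<forall>w. (\<forall>J\<in>ordparts lam N. leid lam N J I \<longrightarrow> w \<noteq> wordof (lcum lam N) J) \<longrightarrow> f w = (\<lambda>z h. 0))
    \<and> (\<forall>z h. f (wordof (lcum lam N) I) z h = Xdiag N I z h)
    \<and> (\<forall>J\<in>ordparts lam N. \<forall>z h. gen (lcum lam N) z h \<longrightarrow> f (wordof (lcum lam N) J) z h = Xformula lam N I J z h)"

lemma xi_specD:
  assumes "xi_spec lam N I f"
  shows "f w \<in> ringS (lcum lam N) (linv (lcum lam N) I)"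
    "w \<notin> words (lcum lam N) N \<Longrightarrow> f w = (\<lambda>z h. 0)"
    "(\<And>J. J \<in> ordparts lam N \<Longrightarrow> leid lam N J I \<Longrightarrow> w \<noteq> wordof (lcum lam N) J) \<Longrightarrow> f w = (\<lambda>z h. 0)"
    "f (wordof (lcum lam N) I) z h = Xdiag N I z h"
    "J \<in> ordparts lam N \<Longrightarrow> gen (lcum lam N) z h \<Longrightarrow> f (wordof (lcum lam N) J) z h = Xformula lam N I J z h"
  using assms unfolding xi_spec_def by blast+

lemma xi_spec_Imin:
  assumes N: "N \<ge> 1"
  shows "xi_spec lam N (Imin lam N) (bvec (wordof (lcum lam N) (Imin lam N)))"
  unfolding xi_spec_def
proof (intro conjI allI ballI impI)
  let ?n = "lcum lam N" and ?w0 = "wordof (lcum lam N) (Imin lam N)"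
  show "bvec ?w0 w \<in> ringS ?n (linv ?n (Imin lam N))" for w
    unfolding bvec_def by (rule rconst)
  show "bvec ?w0 w = (\<lambda>z h. 0)" if "w \<notin> words ?n N" for w
    using that wordof_words[OF Imin_mem, of lam N] by (auto simp: bvec_def)
  show "bvec ?w0 w = (\<lambda>z h. 0)" if "\<forall>J\<in>ordparts lam N. leid lam N J (Imin lam N) \<longrightarrow> w \<noteq> wordof ?n J" for w
    using that leid_refl Imin_mem by (fastforce simp: bvec_def)
  show "bvec ?w0 ?w0 z h = Xdiag N (Imin lam N) z h" for z h
    unfolding Xdiag_linv[OF Imin_mem] linv_Imin by (simp add: bvec_def)
  show "bvec ?w0 (wordof ?n J) z h = Xformula lam N (Imin lam N) J z h" if "J \<in> ordparts lam N" "gen ?n z h" for J z h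
    unfolding Xformula_Imin[OF N that] using wordof_inj[OF that(1) Imin_mem] by (auto simp: bvec_def)
qed

text \<open>The sole denominator of the R-matrix is the one indexed by (i, i+1), the inversion
  created by an ascent.\<close>

lemma ringS_ts_coefficients:
  assumes i: "i \<in> {1..<n}" and S: "(i, i+1) \<in> S"
  shows "(\<lambda>z h. (1 - h) * (z i / z (i+1)) / (1 - h * (z i / z (i+1)))) \<in> ringS n S"
    "(\<lambda>z h. h * (1 - z i / z (i+1)) / (1 - h * (z i / z (i+1)))) \<in> ringS n S"
    "(\<lambda>z h. (1 - h) / (1 - h * (z i / z (i+1)))) \<in> ringS n S"
    "(\<lambda>z h. (1 - z i / z (i+1)) / (1 - h * (z i / z (i+1)))) \<in> ringS n S"
proof -
  have v: "i \<in> {1..n}" "i+1 \<in> {1..n}" using i by auto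
  have x: "(\<lambda>z h. z i / z (i+1)) \<in> ringS n S"
    unfolding divide_inverse by (intro rmult rvar rivar v)
  have d: "(\<lambda>z h. inverse (1 - h * (z i / z (i+1)))) \<in> ringS n S"
    using rden[OF S, of n] by simp
  have h: "(\<lambda>z h. 1 - h) \<in> ringS n S" by (intro ringS_diff rconst rh)
  have x1: "(\<lambda>z h. 1 - z i / z (i+1)) \<in> ringS n S" by (intro ringS_diff rconst x)
  show "(\<lambda>z h. (1 - h) * (z i / z (i+1)) / (1 - h * (z i / z (i+1)))) \<in> ringS n S"
    using rmult[OF rmult[OF h x] d] by (simp only: divide_inverse)
  show "(\<lambda>z h. h * (1 - z i / z (i+1)) / (1 - h * (z i / z (i+1)))) \<in> ringS n S"
    using rmult[OF rmult[OF rh x1] d] by (simp only: divide_inverse)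
  show "(\<lambda>z h. (1 - h) / (1 - h * (z i / z (i+1)))) \<in> ringS n S"
    using rmult[OF h d] by (simp only: divide_inverse)
  show "(\<lambda>z h. (1 - z i / z (i+1)) / (1 - h * (z i / z (i+1)))) \<in> ringS n S"
    using rmult[OF x1 d] by (simp only: divide_inverse)
qed

lemma xi_spec_step:
  assumes N: "N \<ge> 1" and I: "I \<in> ordparts lam N" and i: "i \<in> {1..<lcum lam N}" and c: "col I i < col I (i+1)"
    and f: "xi_spec lam N I f"
  shows "xi_spec lam N (s_part i I) (ts (lcum lam N) N i f)"
  unfolding xi_spec_def
proof (intro conjI allI ballI impI)
  let ?n = "lcum lam N" and ?I' = "s_part i I"
  let ?f = "ts ?n N i f"
  have I': "?I' \<in> ordparts lam N" by (rule s_part_mem[OF I i])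
  note L = linv_s_part[OF i c]
  show out: "?f w = (\<lambda>z h. 0)" if "w \<notin> words ?n N" for w
    using that by (simp add: ts_def)
  show "?f w \<in> ringS ?n (linv ?n ?I')" for w
  proof (cases "w \<in> words ?n N")
    case False
    then show ?thesis using out rconst[of 0] by simp
  next
    case w: True
    have g: "(\<lambda>z h. f u (z \<circ> sw i (i+1)) h) \<in> ringS ?n (linv ?n ?I')" for u
      by (rule ringS_mono[OF ringS_swap[OF xi_specD(1)[OF f] i]]) (use L(1) in blast)
    have "(i, i+1) \<in> linv ?n ?I'" using L(1) by blast
    note C = ringS_ts_coefficients[OF i this]
    note e = ts_expand[OF w i, of f, unfolded Let_def]
    consider "w ! (i-1) = w ! i" | "w ! (i-1) < w ! i" | "w ! (i-1) > w ! i" by linarith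
    then show ?thesis
    proof cases
      case 1
      then have "?f w = (\<lambda>z h. f w (z \<circ> sw i (i+1)) h)" by (simp add: e fun_eq_iff)
      then show ?thesis using g by simp
    next
      case 2
      then have "?f w = (\<lambda>z h. (1 - h) * (z i / z (i+1)) / (1 - h * (z i / z (i+1))) * f w (z \<circ> sw i (i+1)) h
         + h * (1 - z i / z (i+1)) / (1 - h * (z i / z (i+1))) * f (wswap i w) (z \<circ> sw i (i+1)) h)" by (simp add: e fun_eq_iff)
      then show ?thesis using radd[OF rmult[OF C(1) g] rmult[OF C(2) g]] by simp
    next
      case 3
      then have "?f w = (\<lambda>z h. (1 - h) / (1 - h * (z i / z (i+1))) * f w (z \<circ> sw i (i+1)) h
         + (1 - z i / z (i+1)) / (1 - h * (z i / z (i+1))) * f (wswap i w) (z \<circ> sw i (i+1)) h)" by (simp add: e fun_eq_iff)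
      then show ?thesis using radd[OF rmult[OF C(3) g] rmult[OF C(4) g]] by simp
    qed
  qed
  show "?f w = (\<lambda>z h. 0)" if tri: "\<forall>J\<in>ordparts lam N. leid lam N J ?I' \<longrightarrow> w \<noteq> wordof ?n J" for w
  proof (cases "w \<in> words ?n N")
    case False
    then show ?thesis by (rule out)
  next
    case w: True
    have "f w = (\<lambda>z h. 0)"
    proof (rule xi_specD(3)[OF f])
      fix J assume J: "J \<in> ordparts lam N" "leid lam N J I"
      then show "w \<noteq> wordof ?n J" using tri leid_s_part[OF I J(1) i c] by blast
    qed
    moreover have "f (wswap i w) = (\<lambda>z h. 0)"
    proof (rule xi_specD(3)[OF f])
      fix J assume J: "J \<in> ordparts lam N" "leid lam N J I"
      show "wswap i w \<noteq> wordof ?n J"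
      proof
        assume "wswap i w = wordof ?n J"
        then have "w = wordof ?n (s_part i J)" using wswap_wswap[OF w i] wordof_s_part[OF i, of J] by simp
        moreover have "leid lam N (s_part i J) ?I'"
          by (rule leid_s_part[OF I s_part_mem[OF J(1) i] i c]) (use J(2) in simp)
        ultimately show False using tri s_part_mem[OF J(1) i] by blast
      qed
    qed
    ultimately show ?thesis using ts_expand[OF w i, of f] by (simp add: fun_eq_iff Let_def)
  qed
  show "?f (wordof ?n ?I') z h = Xdiag N ?I' z h" for z h
  proof -
    let ?zs = "z \<circ> sw i (i+1)"
    let ?G = "\<lambda>z x. (1 - z (fst x) / z (snd x)) / (1 - h * z (fst x) / z (snd x) :: complex)"
    \<comment> \<open>By strictness of the ascent the word of \<open>s_part i I\<close> does not
      occur in \<open>f\<close>, so the diagonal coefficient comes from the word of I alone. Its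
      R-matrix entry is the factor of the new inversion (i, i+1).\<close>
    have "f (wordof ?n ?I') = (\<lambda>z h. 0)"
    proof (rule xi_specD(3)[OF f])
      fix J assume J: "J \<in> ordparts lam N" "leid lam N J I"
      then show "wordof ?n ?I' \<noteq> wordof ?n J" using wordof_inj[OF I' J(1)] not_leid_s_part[OF I i c] by blast
    qed
    moreover have "wswap i (wordof ?n ?I') = wordof ?n I" using wordof_s_part[OF i, of ?I'] by simp
    ultimately have "?f (wordof ?n ?I') z h = (1 - z i / z (i+1)) / (1 - h * (z i / z (i+1))) * f (wordof ?n I) ?zs h"
      using ts_expand[OF wordof_words[OF I'] i, of f z h] c
      unfolding wordof_nth[OF i] by (simp add: Let_def col_s_part)
    also have "f (wordof ?n I) ?zs h = prod (?G ?zs) (linv ?n I)"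
      unfolding xi_specD(4)[OF f] Xdiag_linv[OF I] by (simp add: split_def)
    also have "\<dots> = prod (?G z) (map_prod (sw i (i+1)) (sw i (i+1)) ` linv ?n I)"
      unfolding prod.reindex[OF L(3)] by (simp add: comp_def)
    also have "(1 - z i / z (i+1)) / (1 - h * (z i / z (i+1))) * \<dots> = prod (?G z) (linv ?n ?I')"
      unfolding L(1) using L(2) by simp
    also have "\<dots> = Xdiag N ?I' z h" unfolding Xdiag_linv[OF I'] by (simp add: split_def)
    finally show ?thesis .
  qed
  show "?f (wordof ?n J) z h = Xformula lam N ?I' J z h" if J: "J \<in> ordparts lam N" and g: "gen ?n z h" for J z h
    by (rule ts_Xformula[OF N I J i g]) (rule xi_specD(5)[OF f _ gen_sw[OF g i]])
qed

text \<open>Two domain conditions: the R-matrix is evaluated at z, the vector at the exchanged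
  variables.\<close>

lemma ts_tendsto:
  assumes f: "is_vec n N f" and i: "i \<in> {1..<n}" and g: "gdom n z h" "gdom n (z \<circ> sw i (i+1)) h"
    and z: "\<And>a. a \<in> {1..n} \<Longrightarrow> ((\<lambda>e. zc e a) \<longlongrightarrow> z a) F" and h: "(hc \<longlongrightarrow> h) F"
    and ev: "\<forall>\<^sub>F e in F. gdom n (zc e \<circ> sw i (i+1)) (hc e)"
  shows "((\<lambda>e. ts n N i f w (zc e) (hc e)) \<longlongrightarrow> ts n N i f w z h) F"
proof (cases "w \<in> words n N")
  case False
  then show ?thesis by (simp add: ts_def)
next
  case w: True
  have i1: "i \<in> {1..n}" "i+1 \<in> {1..n}" "1 \<le> i" "i < n" using i by auto
  have fz: "((\<lambda>e. f u (zc e \<circ> sw i (i+1)) (hc e)) \<longlongrightarrow> f u (z \<circ> sw i (i+1)) h) F" if "u \<in> words n N" for u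
  proof (rule in_ring_tendsto[OF _ g(2) _ h ev])
    show "in_ring n (f u)" using f that by (simp add: is_vec_def)
    show "((\<lambda>e. (zc e \<circ> sw i (i+1)) a) \<longlongrightarrow> (z \<circ> sw i (i+1)) a) F" if "a \<in> {1..n}" for a
      using z[of "sw i (i+1) a"] sw_interval[OF i1(3,4), of a] that by simp
  qed
  have nz: "z (i+1) \<noteq> 0" using g(1) i1 by (simp add: gdom_def)
  have d: "1 - h * (z i / z (i+1)) \<noteq> 0" using gdom_factor[OF g(1), of i "i+1"] i by (simp add: upairs_def)
  note t = fz[OF w] fz[OF wswap_words[OF w i]] z[OF i1(1)] z[OF i1(2)]
  let ?x = "\<lambda>z. z i / z (i+1)" and ?f = "\<lambda>u z. f u (z \<circ> sw i (i+1))"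
  have 1: "((\<lambda>e. (1 - hc e) * ?x (zc e) / (1 - hc e * ?x (zc e)) * ?f w (zc e) (hc e) + hc e * (1 - ?x (zc e)) / (1 - hc e * ?x (zc e)) * ?f (wswap i w) (zc e) (hc e))
    \<longlongrightarrow> (1 - h) * ?x z / (1 - h * ?x z) * ?f w z h + h * (1 - ?x z) / (1 - h * ?x z) * ?f (wswap i w) z h) F"
    by (intro tendsto_intros t h d nz)
  have 2: "((\<lambda>e. (1 - hc e) / (1 - hc e * ?x (zc e)) * ?f w (zc e) (hc e) + (1 - ?x (zc e)) / (1 - hc e * ?x (zc e)) * ?f (wswap i w) (zc e) (hc e))
    \<longlongrightarrow> (1 - h) / (1 - h * ?x z) * ?f w z h + (1 - ?x z) / (1 - h * ?x z) * ?f (wswap i w) z h) F"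
    by (intro tendsto_intros t h d nz)
  consider "w ! (i-1) = w ! i" | "w ! (i-1) < w ! i" | "w ! (i-1) > w ! i" by linarith
  then show ?thesis
    unfolding ts_expand[OF w i] Let_def by cases (use t(1) 1 2 in simp_all)
qed

section \<open>Existence and uniqueness\<close>

lemma is_vec_xi_spec: "xi_spec lam N I f \<Longrightarrow> is_vec (lcum lam N) N f"
  unfolding is_vec_def using ringS_in_ring[OF xi_specD(1) linv_upairs] xi_specD(2) by blast

lemma xi_spec_exists:
  assumes N: "N \<ge> 1" and I: "I \<in> ordparts lam N"
  shows "\<exists>f. xi_spec lam N I f"
  using I by (induction rule: ordparts_induct) (use xi_spec_Imin[OF N] xi_spec_step[OF N] in blast)+

text \<open>Phrased through limits along curves rather than ring membership, so that it applies
  alike to coefficients, to \<open>ts\<close> of a vector and to \<open>Xformula\<close>.\<close>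

lemma gdom_eq_by_density:
  assumes u: "\<And>zc hc. (\<And>a. a \<in> {1..n} \<Longrightarrow> ((\<lambda>e. zc e a) \<longlongrightarrow> z a) (at 0)) \<Longrightarrow> (hc \<longlongrightarrow> h) (at 0) \<Longrightarrow>
      \<forall>\<^sub>F e in at 0. gen n (zc e) (hc e) \<Longrightarrow> ((\<lambda>e. u (zc e) (hc e)) \<longlongrightarrow> u z h) (at (0::complex))"
    and v: "\<And>zc hc. (\<And>a. a \<in> {1..n} \<Longrightarrow> ((\<lambda>e. zc e a) \<longlongrightarrow> z a) (at 0)) \<Longrightarrow> (hc \<longlongrightarrow> h) (at 0) \<Longrightarrow>
      \<forall>\<^sub>F e in at 0. gen n (zc e) (hc e) \<Longrightarrow> ((\<lambda>e. v (zc e) (hc e)) \<longlongrightarrow> v z h) (at (0::complex))"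
    and eq: "\<And>z h. gen n z h \<Longrightarrow> u z h = v z h" and g: "gdom n z h"
  shows "u z h = (v z h :: complex)"
proof -
  let ?zc = "\<lambda>e a. z a + of_nat a * e" and ?hc = "\<lambda>e. h + e ^ 2"
  have ev: "\<forall>\<^sub>F e in at 0. gen n (?zc e) (?hc e)" by (rule eventually_gen) (use g in \<open>auto simp: gdom_def\<close>)
  have "((\<lambda>e. u (?zc e) (?hc e)) \<longlongrightarrow> u z h) (at 0)" by (intro u curve_tendsto ev)
  moreover have "((\<lambda>e. v (?zc e) (?hc e)) \<longlongrightarrow> v z h) (at 0)" by (intro v curve_tendsto ev)
  then have "((\<lambda>e. u (?zc e) (?hc e)) \<longlongrightarrow> v z h) (at 0)"
    by (rule Lim_transform_eventually) (use ev in eventually_elim, simp add: eq)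
  ultimately show ?thesis by (rule tendsto_unique[rotated]) simp
qed

lemma in_ring_tendsto_gen:
  assumes "in_ring n f" "gdom n z h" "\<And>a. a \<in> {1..n} \<Longrightarrow> ((\<lambda>e. zc e a) \<longlongrightarrow> z a) F" "(hc \<longlongrightarrow> h) F"
    "\<forall>\<^sub>F e in F. gen n (zc e) (hc e)"
  shows "((\<lambda>e. f (zc e) (hc e)) \<longlongrightarrow> f z h) F"
  by (rule in_ring_tendsto[OF assms(1-4)]) (use assms(5) in \<open>auto elim: eventually_mono intro: gen_gdom\<close>)

lemma is_vec_in_ring:
  assumes "is_vec n N f"
  shows "in_ring n (f w)"
  using assms laurent_in_ring[OF lconst[of 0]] unfolding is_vec_def by metis

lemma is_vec_recursion_by_density:
  assumes f: "is_vec n N f" and f': "is_vec n N f'" and i: "i \<in> {1..<n}"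
    and eq: "\<And>z h. gen n z h \<Longrightarrow> f' w z h = ts n N i f w z h"
    and g: "gdom n z h" "gdom n (z \<circ> sw i (i+1)) h"
  shows "f' w z h = ts n N i f w z h"
proof (rule gdom_eq_by_density[OF _ _ eq g(1)])
  fix zc :: "complex \<Rightarrow> nat \<Rightarrow> complex" and hc
  assume t: "\<And>a. a \<in> {1..n} \<Longrightarrow> ((\<lambda>e. zc e a) \<longlongrightarrow> z a) (at 0)" "(hc \<longlongrightarrow> h) (at 0)"
    and ev: "\<forall>\<^sub>F e in at 0. gen n (zc e) (hc e)"
  show "((\<lambda>e. f' w (zc e) (hc e)) \<longlongrightarrow> f' w z h) (at 0)"
    by (rule in_ring_tendsto_gen[OF is_vec_in_ring[OF f'] g(1) t ev])
  have ev': "\<forall>\<^sub>F e in at 0. gdom n (zc e \<circ> sw i (i+1)) (hc e)"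
    using ev by eventually_elim (rule gen_gdom[OF gen_sw[OF _ i]])
  show "((\<lambda>e. ts n N i f w (zc e) (hc e)) \<longlongrightarrow> ts n N i f w z h) (at 0)"
    by (rule ts_tendsto[OF f i g t ev'])
qed

text \<open>Both vectors are tied to the formula on \<open>gen\<close>, so i may be an ascent, a
  descent or a pair of equal colours, and the vectors may stem from unrelated chains.\<close>

lemma xi_spec_recursion:
  assumes N: "N \<ge> 1" and I: "I \<in> ordparts lam N" and i: "i \<in> {1..<lcum lam N}"
    and f: "xi_spec lam N I f" and f': "xi_spec lam N (s_part i I) f'"
    and g: "gdom (lcum lam N) z h" "gdom (lcum lam N) (z \<circ> sw i (i+1)) h"
  shows "f' w z h = ts (lcum lam N) N i f w z h"
proof (rule is_vec_recursion_by_density[OF is_vec_xi_spec[OF f] is_vec_xi_spec[OF f'] i _ g])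
  fix z h assume gen: "gen (lcum lam N) z h"
  let ?n = "lcum lam N"
  show "f' w z h = ts ?n N i f w z h"
  proof (cases "\<exists>J\<in>ordparts lam N. w = wordof ?n J")
    case True
    then obtain J where J: "J \<in> ordparts lam N" "w = wordof ?n J" by blast
    show ?thesis
      unfolding J(2) xi_specD(5)[OF f' J(1) gen]
      by (rule ts_Xformula[OF N I J(1) i gen, symmetric]) (rule xi_specD(5)[OF f _ gen_sw[OF gen i]])
  next
    case no: False
    \<comment> \<open>Words of a different content lie outside the support of both vectors, and
      exchanging two letters preserves the content.\<close>
    have f'0: "f' w = (\<lambda>z h. 0)" by (rule xi_specD(3)[OF f']) (use no in blast)
    show ?thesis
    proof (cases "w \<in> words ?n N")
      case False
      then show ?thesis using f'0 by (simp add: ts_def)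
    next
      case w: True
      have "f w = (\<lambda>z h. 0)" by (rule xi_specD(3)[OF f]) (use no in blast)
      moreover have "f (wswap i w) = (\<lambda>z h. 0)"
      proof (rule xi_specD(3)[OF f])
        fix J assume J: "J \<in> ordparts lam N"
        show "wswap i w \<noteq> wordof ?n J"
        proof
          assume "wswap i w = wordof ?n J"
          then have "w = wordof ?n (s_part i J)" using wswap_wswap[OF w i] wordof_s_part[OF i, of J] by simp
          then show False using no s_part_mem[OF J i] by blast
        qed
      qed
      ultimately show ?thesis using f'0 ts_expand[OF w i, of f z h] by (simp add: Let_def)
    qed
  qed
qed

lemma ts_cong:
  assumes w: "w \<in> words n N" and i: "i \<in> {1..<n}" and e: "\<And>u. u \<in> words n N \<Longrightarrow> f u (z \<circ> sw i (i+1)) h = g u (z \<circ> sw i (i+1)) h"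
  shows "ts n N i f w z h = ts n N i g w z h"
  by (simp only: ts_expand[OF w i] Let_def e[OF w] e[OF wswap_words[OF w i]])

theorem theorem8p2:
  fixes N :: nat and lam :: "nat \<Rightarrow> nat"
  assumes "N \<ge> 1"
  defines "n \<equiv> lcum lam N"
  shows "\<exists>\<xi> :: opart \<Rightarrow> tvec.
    (\<forall>I\<in>ordparts lam N. is_vec n N (\<xi> I))
  \<and> veq n N (\<xi> (Imin lam N)) (bvec (wordof n (Imin lam N)))
  \<and> (\<forall>I\<in>ordparts lam N. \<forall>i\<in>{1..<n}. \<forall>z h.
        gdom n z h \<and> gdom n (z \<circ> sw i (i+1)) h \<longrightarrow>
        (\<forall>w. \<xi> (s_part i I) w z h = ts n N i (\<xi> I) w z h))
  \<and> (\<forall>\<eta> :: opart \<Rightarrow> tvec.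
        (\<forall>I\<in>ordparts lam N. is_vec n N (\<eta> I))
      \<and> veq n N (\<eta> (Imin lam N)) (bvec (wordof n (Imin lam N)))
      \<and> (\<forall>I\<in>ordparts lam N. \<forall>i\<in>{1..<n}. \<forall>z h.
            gdom n z h \<and> gdom n (z \<circ> sw i (i+1)) h \<longrightarrow>
            (\<forall>w. \<eta> (s_part i I) w z h = ts n N i (\<eta> I) w z h))
      \<longrightarrow> (\<forall>I\<in>ordparts lam N. veq n N (\<eta> I) (\<xi> I)))
  \<and> (\<forall>I\<in>ordparts lam N. \<forall>w\<in>words n N. \<forall>z h.
        gdom n z h \<and> (\<forall>J\<in>ordparts lam N. leid lam N J I \<longrightarrow> w \<noteq> wordof n J)
        \<longrightarrow> \<xi> I w z h = 0)
  \<and> (\<forall>I\<in>ordparts lam N. \<forall>z h. gdom n z h \<longrightarrow>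
        \<xi> I (wordof n I) z h = Xdiag N I z h)
  \<and> (\<forall>I\<in>ordparts lam N. \<forall>J\<in>ordparts lam N. \<forall>z h. xgen lam N I z h \<longrightarrow>
        \<xi> I (wordof n J) z h = Xformula lam N I J z h)"
proof -
  note N = assms(1)
  \<comment> \<open>Choosing \<open>bvec\<close> itself at \<open>Imin\<close> makes the initial
    condition hold by definition; elsewhere any vector meeting the invariant will do.\<close>
  define \<xi> where "\<xi> I = (if I = Imin lam N then bvec (wordof n (Imin lam N)) else SOME f. xi_spec lam N I f)" for I
  have spec: "xi_spec lam N I (\<xi> I)" if I: "I \<in> ordparts lam N" for I
    using xi_spec_Imin[OF N, of lam] someI_ex[OF xi_spec_exists[OF N I]] by (simp add: \<xi>_def n_def)
  have vec: "is_vec n N (\<xi> I)" if "I \<in> ordparts lam N" for I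
    using is_vec_xi_spec[OF spec[OF that]] by (simp add: n_def)
  have rec: "\<xi> (s_part i I) w z h = ts n N i (\<xi> I) w z h"
    if "I \<in> ordparts lam N" "i \<in> {1..<n}" "gdom n z h" "gdom n (z \<circ> sw i (i+1)) h" for I i z h w
    using xi_spec_recursion[OF N that(1) _ spec[OF that(1)] spec[OF s_part_mem[OF that(1)]]] that(2-4) by (simp add: n_def)
  have base: "veq n N (\<xi> (Imin lam N)) (bvec (wordof n (Imin lam N)))" by (simp add: veq_def \<xi>_def)
  have uniq: "veq n N (\<eta> I) (\<xi> I)"
    if \<eta>: "\<And>I. I \<in> ordparts lam N \<Longrightarrow> is_vec n N (\<eta> I)" "veq n N (\<eta> (Imin lam N)) (bvec (wordof n (Imin lam N)))"
      and \<eta>rec: "\<And>I i z h w. I \<in> ordparts lam N \<Longrightarrow> i \<in> {1..<n} \<Longrightarrow> gdom n z h \<Longrightarrow> gdom n (z \<circ> sw i (i+1)) h \<Longrightarrow>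
        \<eta> (s_part i I) w z h = ts n N i (\<eta> I) w z h"
      and I: "I \<in> ordparts lam N" for \<eta> I
    using I
  proof (induction rule: ordparts_induct)
    case Imin
    then show ?case using \<eta>(2) by (simp add: \<xi>_def)
  next
    case (step I i)
    have i: "i \<in> {1..<n}" using step.hyps(2) by (simp add: n_def)
    have I': "s_part i I \<in> ordparts lam N" by (rule s_part_mem[OF step.hyps(1,2)])
    show ?case unfolding veq_def
    proof (intro ballI allI impI)
      fix w z h assume w: "w \<in> words n N" and g: "gdom n z h"
      show "\<eta> (s_part i I) w z h = \<xi> (s_part i I) w z h"
      \<comment> \<open>The recursion for \<open>\<eta>\<close> is given only where both z and the
        exchanged z lie in \<open>gdom\<close>. It is used on \<open>gen\<close>, and continuity of
        ring elements covers the rest of \<open>gdom\<close>.\<close>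
      proof (rule gdom_eq_by_density[OF _ _ _ g])
        fix z h assume gen: "gen n z h"
        note gd = gen_gdom[OF gen] gen_gdom[OF gen_sw[OF gen i]]
        show "\<eta> (s_part i I) w z h = \<xi> (s_part i I) w z h"
          unfolding \<eta>rec[OF step.hyps(1) i gd] rec[OF step.hyps(1) i gd]
          by (rule ts_cong[OF w i]) (use step.IH gd(2) in \<open>auto simp: veq_def\<close>)
      qed (rule in_ring_tendsto_gen[OF is_vec_in_ring[OF \<eta>(1)[OF I']] g] in_ring_tendsto_gen[OF is_vec_in_ring[OF vec[OF I']] g]; assumption)+
    qed
  qed
  have tri: "\<xi> I w z h = 0" if "I \<in> ordparts lam N" "\<forall>J\<in>ordparts lam N. leid lam N J I \<longrightarrow> w \<noteq> wordof n J" for I w z h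
    using xi_specD(3)[OF spec[OF that(1)], of w] that(2) by (simp add: n_def)
  have diag: "\<xi> I (wordof n I) z h = Xdiag N I z h" if "I \<in> ordparts lam N" for I z h
    using xi_specD(4)[OF spec[OF that]] by (simp add: n_def)
  have formula: "\<xi> I (wordof n J) z h = Xformula lam N I J z h"
    if I: "I \<in> ordparts lam N" and J: "J \<in> ordparts lam N" and x: "xgen lam N I z h" for I J z h
  proof -
    have g: "gdom n z h" using x by (simp add: xgen_def n_def)
    show ?thesis
    \<comment> \<open>\<open>xi_spec\<close> gives the formula on \<open>gen\<close>; both sides are
      continuous at points of \<open>xgen\<close>.\<close>
    proof (rule gdom_eq_by_density[OF _ _ _ g])
      show "\<xi> I (wordof n J) z h = Xformula lam N I J z h" if "gen n z h" for z h
        using xi_specD(5)[OF spec[OF I] J] that by (simp add: n_def)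
      fix zc :: "complex \<Rightarrow> nat \<Rightarrow> complex" and hc
      assume t: "\<And>a. a \<in> {1..n} \<Longrightarrow> ((\<lambda>e. zc e a) \<longlongrightarrow> z a) (at 0)" "(hc \<longlongrightarrow> h) (at 0)"
        and ev: "\<forall>\<^sub>F e in at 0. gen n (zc e) (hc e)"
      show "((\<lambda>e. \<xi> I (wordof n J) (zc e) (hc e)) \<longlongrightarrow> \<xi> I (wordof n J) z h) (at 0)"
        by (rule in_ring_tendsto_gen[OF is_vec_in_ring[OF vec[OF I]] g t ev])
      show "((\<lambda>e. Xformula lam N I J (zc e) (hc e)) \<longlongrightarrow> Xformula lam N I J z h) (at 0)"
        by (rule Xformula_tendsto[OF N I J x t[unfolded n_def]])
    qed
  qed
  show ?thesis
  proof (rule exI[of _ \<xi>], intro conjI allI impI, goal_cases)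
    case (4 \<eta>)
    show ?case by (rule ballI, rule uniq) (use 4 in blast)+
  qed (use vec base rec tri diag formula in blast)+
qed

end
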